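(* Let $\mathcal H$ be an infinite dimensional Hilbert space, let $B(\mathcal H)$ denote the bounded linear operators on $\mathcal H$, and let $\mathcal D$ be the set of all pairs $(A,B)$ of bounded positive semi-definite operators on $\mathcal H$. Let $F\colon\mathcal D\to B(\mathcal H)$ be a regular map (as defined in the context) with self-adjoint values satisfying the following conditions: (i) $F(tA,tB)=t\,F(A,B)$ for all $t>0$ and all $(A,B)\in\mathcal D$; (ii) for all $(A_1,B_1),(A_2,B_2)\in\mathcal D$, \[ F\left(\frac{A_1+A_2}{2},\frac{B_1+B_2}{2}\right)\le\frac{F(A_1,B_1)+F(A_2,B_2)}{2}; \] (iii) $F(0,0)=0$, and the map $B\mapsto F(1,B)$ is continuous on bounded subsets (of the positive semi-definite operators) in the strong operator topology, where $1$ denotes the unit operator on $\mathcal H$. Then there exists an operator convex function $f\colon(0,\infty)\to\mathbf R$ such that \[ F(1,t\cdot 1)=f(t)\,1\qquad\text{for all } t>0. \] Furthermore, \[ F(A,B)=A^{1/2}f\bigl(A^{-1/2}BA^{-1/2}\bigr)A^{1/2} \] for all positive definite invertible operators $A$ and $B$ on $\mathcal H$; that is, $F(A,B)$ is the non-commutative perspective $\mathcal P_f(A,B)$ of $f$.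
   Context: The order $\le$ is the usual (Löwner) order on self-adjoint operators: $X\le Y$ means that $Y-X$ is positive semi-definite. Strong continuity in (iii) means continuity from the strong operator topology to the strong operator topology. Regular map: Let $\mathcal D\subseteq B(\mathcal H)\times B(\mathcal H)$ be convex. A function of two variables $F\colon\mathcal D\to B(\mathcal H)$ is called regular if: (a) $\mathcal D$ is invariant under unitary transformations of $\mathcal H$ (that is, $(u^*xu,u^*yu)\in\mathcal D$ whenever $(x,y)\in\mathcal D$ and $u$ is unitary) and \[ F(u^*xu,u^*yu)=u^*F(x,y)u\qquad (x,y)\in\mathcal D \] for every unitary $u$ on $\mathcal H$; (b) for mutually orthogonal (self-adjoint) projections $p$ and $q$ on $\mathcal H$ (so $pq=0$) and arbitrary $x,y\in B(\mathcal H)$ such that $(pxp,pyp)$ and $(qxq,qyq)$ are in $\mathcal D$, the pair $(pxp+qxq,\,pyp+qyq)$ is in $\mathcal D$ and \[ F(pxp+qxq,\,pyp+qyq)=p\,F(pxp,pyp)\,p+q\,F(qxq,qyq)\,q . \] Operator convex function: $f\colon(0,\infty)\to\mathbf R$ is operator convex if $f(\lambda X+(1-\lambda)Y)\le\lambda f(X)+(1-\lambda)f(Y)$ for all $\lambda\in[0,1]$ and all positive definite matrices $X,Y$ of the same (arbitrary) order, where $f(X)$ is given by the functional calculus. The expression $f(A^{-1/2}BA^{-1/2})$ is likewise given by the functional calculus for self-adjoint operators. Non-commutative perspective: here, for positive definite invertible $A,B$, $\mathcal P_f(A,B)=A^{1/2}f(A^{-1/2}BA^{-1/2})A^{1/2}$.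 *)

theory Defs
  imports
    "HOL-Analysis.Analysis"
    "HOL-Computational_Algebra.Polynomial"
    "Jordan_Normal_Form.Schur_Decomposition"
begin

section \<open>Complex Hilbert spaces\<close>

text \<open>The inner product \<open>cinner\<close> is linear in its second argument. Its real part is the
  inner product of the underlying real space, so the norm is the one induced by \<open>cinner\<close>;
  definiteness is inherited from \<^class>\<open>real_inner\<close>.\<close>

class complex_inner = real_inner +
  fixes scaleC :: "complex \<Rightarrow> 'a \<Rightarrow> 'a"  (infixr \<open>*\<^sub>C\<close> 75)
    and cinner :: "'a \<Rightarrow> 'a \<Rightarrow> complex"
  assumes scaleC_add_right: "a *\<^sub>C (x + y) = a *\<^sub>C x + a *\<^sub>C y"
    and scaleC_add_left: "(a + b) *\<^sub>C x = a *\<^sub>C x + b *\<^sub>C x"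
    and scaleC_scaleC: "a *\<^sub>C (b *\<^sub>C x) = (a * b) *\<^sub>C x"
    and scaleC_of_real: "complex_of_real r *\<^sub>C x = r *\<^sub>R x"
    and cinner_commute: "cinner x y = cnj (cinner y x)"
    and cinner_add_right: "cinner x (y + z) = cinner x y + cinner x z"
    and cinner_scaleC_right: "cinner x (a *\<^sub>C y) = a * cinner x y"
    and Re_cinner: "Re (cinner x y) = inner x y"

class chilbert_space = complex_inner + complete_space

subclass (in chilbert_space) banach ..

global_interpretation complex_vector:
  vector_space "scaleC :: complex \<Rightarrow> 'a \<Rightarrow> 'a::complex_inner"
  by standard
    (simp_all add: scaleC_add_right scaleC_add_left scaleC_scaleC
      scaleC_of_real[where r = 1, simplified])

definition infinite_dimensional :: "'a::complex_inner itself \<Rightarrow> bool" where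
  "infinite_dimensional _ \<longleftrightarrow>
     \<not> (\<exists>S :: 'a set. finite S \<and> complex_vector.span S = UNIV)"


section \<open>Bounded operators\<close>

text \<open>The elements of \<^typ>\<open>'a \<Rightarrow>\<^sub>L 'a\<close> are the bounded real-linear maps; \<open>B(H)\<close> is the subset
  of the complex-linear ones.\<close>

definition bounded_ops :: "('a::complex_inner \<Rightarrow>\<^sub>L 'a) set"  (\<open>\<B>\<close>) where
  "\<B> = {T. \<forall>c x. blinfun_apply T (c *\<^sub>C x) = c *\<^sub>C blinfun_apply T x}"

text \<open>On a Hilbert space the adjoint of an element of \<^term>\<open>\<B>\<close> exists and is unique
  (Riesz representation theorem).\<close>

definition adj_op :: "('a::complex_inner \<Rightarrow>\<^sub>L 'a) \<Rightarrow> 'a \<Rightarrow>\<^sub>L 'a" where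
  "adj_op T = (THE S. S \<in> \<B> \<and>
     (\<forall>x y. cinner (blinfun_apply T x) y = cinner x (blinfun_apply S y)))"

definition self_adjoint :: "('a::complex_inner \<Rightarrow>\<^sub>L 'a) \<Rightarrow> bool" where
  "self_adjoint T \<longleftrightarrow> T \<in> \<B> \<and> adj_op T = T"

definition unitary_op :: "('a::complex_inner \<Rightarrow>\<^sub>L 'a) \<Rightarrow> bool" where
  "unitary_op u \<longleftrightarrow>
     u \<in> \<B> \<and> adj_op u o\<^sub>L u = id_blinfun \<and> u o\<^sub>L adj_op u = id_blinfun"

definition projection_op :: "('a::complex_inner \<Rightarrow>\<^sub>L 'a) \<Rightarrow> bool" where
  "projection_op p \<longleftrightarrow> self_adjoint p \<and> p o\<^sub>L p = p"

definition psd_op :: "('a::complex_inner \<Rightarrow>\<^sub>L 'a) \<Rightarrow> bool" where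
  "psd_op T \<longleftrightarrow> self_adjoint T \<and> (\<forall>x. 0 \<le> Re (cinner x (blinfun_apply T x)))"

definition op_le :: "('a::complex_inner \<Rightarrow>\<^sub>L 'a) \<Rightarrow> ('a \<Rightarrow>\<^sub>L 'a) \<Rightarrow> bool"  (infix \<open>\<preceq>\<close> 50) where
  "X \<preceq> Y \<longleftrightarrow> psd_op (Y - X)"

definition is_inverse_op :: "('a::complex_inner \<Rightarrow>\<^sub>L 'a) \<Rightarrow> ('a \<Rightarrow>\<^sub>L 'a) \<Rightarrow> bool" where
  "is_inverse_op T S \<longleftrightarrow> S \<in> \<B> \<and> S o\<^sub>L T = id_blinfun \<and> T o\<^sub>L S = id_blinfun"

definition invertible_op :: "('a::complex_inner \<Rightarrow>\<^sub>L 'a) \<Rightarrow> bool" where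
  "invertible_op T \<longleftrightarrow> T \<in> \<B> \<and> (\<exists>S. is_inverse_op T S)"

definition inverse_op :: "('a::complex_inner \<Rightarrow>\<^sub>L 'a) \<Rightarrow> 'a \<Rightarrow>\<^sub>L 'a" where
  "inverse_op T = (THE S. is_inverse_op T S)"

text \<open>The positive square root; it exists and is unique for positive semi-definite operators
  on a Hilbert space.\<close>

definition sqrt_op :: "('a::complex_inner \<Rightarrow>\<^sub>L 'a) \<Rightarrow> 'a \<Rightarrow>\<^sub>L 'a" where
  "sqrt_op A = (THE S. psd_op S \<and> S o\<^sub>L S = A)"


section \<open>Functional calculus for self-adjoint operators\<close>

text \<open>Only real spectral values are recorded: for a self-adjoint operator this is the whole
  spectrum.\<close>

definition real_spectrum :: "('a::complex_inner \<Rightarrow>\<^sub>L 'a) \<Rightarrow> real set" where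
  "real_spectrum T = {r. \<not> invertible_op (T - r *\<^sub>R id_blinfun)}"

definition poly_op :: "real poly \<Rightarrow> ('a::complex_inner \<Rightarrow>\<^sub>L 'a) \<Rightarrow> 'a \<Rightarrow>\<^sub>L 'a" where
  "poly_op p T = (\<Sum>i\<le>degree p. coeff p i *\<^sub>R (((o\<^sub>L) T) ^^ i) id_blinfun)"

text \<open>Continuous functional calculus: \<open>f(T)\<close> is the common norm limit of \<open>p\<^sub>n(T)\<close> over all
  sequences of polynomials \<open>p\<^sub>n\<close> converging to \<open>f\<close> uniformly on the spectrum of \<open>T\<close>. For
  self-adjoint \<open>T\<close> and \<open>f\<close> continuous on the spectrum, such sequences exist and the limit exists
  and does not depend on the sequence. Operator convex functions on \<open>(0, \<infinity>)\<close> are continuous, and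
  only the values of \<open>f\<close> on the spectrum enter.\<close>

definition fun_op :: "(real \<Rightarrow> real) \<Rightarrow> ('a::complex_inner \<Rightarrow>\<^sub>L 'a) \<Rightarrow> 'a \<Rightarrow>\<^sub>L 'a" where
  "fun_op f T = (THE S. \<forall>p :: nat \<Rightarrow> real poly.
     uniform_limit (real_spectrum T) (\<lambda>n. poly (p n)) f sequentially \<longrightarrow>
     (\<lambda>n. poly_op (p n) T) \<longlonglongrightarrow> S)"

definition perspective ::
    "(real \<Rightarrow> real) \<Rightarrow> ('a::complex_inner \<Rightarrow>\<^sub>L 'a) \<Rightarrow> ('a \<Rightarrow>\<^sub>L 'a) \<Rightarrow> 'a \<Rightarrow>\<^sub>L 'a" where
  "perspective f A B =
     (let R = sqrt_op A; R' = inverse_op R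
      in R o\<^sub>L fun_op f (R' o\<^sub>L B o\<^sub>L R') o\<^sub>L R)"


section \<open>Regular maps\<close>

definition regular_map ::
    "(('a::complex_inner \<Rightarrow>\<^sub>L 'a) \<times> ('a \<Rightarrow>\<^sub>L 'a)) set \<Rightarrow>
     (('a \<Rightarrow>\<^sub>L 'a) \<times> ('a \<Rightarrow>\<^sub>L 'a) \<Rightarrow> 'a \<Rightarrow>\<^sub>L 'a) \<Rightarrow> bool" where
  "regular_map D F \<longleftrightarrow>
     D \<subseteq> \<B> \<times> \<B> \<and> convex D \<and> F ` D \<subseteq> \<B> \<and>
     (\<forall>u x y. unitary_op u \<and> (x, y) \<in> D \<longrightarrow>
        (adj_op u o\<^sub>L x o\<^sub>L u, adj_op u o\<^sub>L y o\<^sub>L u) \<in> D \<and>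
        F (adj_op u o\<^sub>L x o\<^sub>L u, adj_op u o\<^sub>L y o\<^sub>L u) = adj_op u o\<^sub>L F (x, y) o\<^sub>L u) \<and>
     (\<forall>p q. \<forall>x\<in>\<B>. \<forall>y\<in>\<B>.
        projection_op p \<and> projection_op q \<and> p o\<^sub>L q = 0 \<and>
        (p o\<^sub>L x o\<^sub>L p, p o\<^sub>L y o\<^sub>L p) \<in> D \<and> (q o\<^sub>L x o\<^sub>L q, q o\<^sub>L y o\<^sub>L q) \<in> D \<longrightarrow>
        ((p o\<^sub>L x o\<^sub>L p) + (q o\<^sub>L x o\<^sub>L q), (p o\<^sub>L y o\<^sub>L p) + (q o\<^sub>L y o\<^sub>L q)) \<in> D \<and>
        F ((p o\<^sub>L x o\<^sub>L p) + (q o\<^sub>L x o\<^sub>L q), (p o\<^sub>L y o\<^sub>L p) + (q o\<^sub>L y o\<^sub>L q)) =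
          (p o\<^sub>L F (p o\<^sub>L x o\<^sub>L p, p o\<^sub>L y o\<^sub>L p) o\<^sub>L p) +
          (q o\<^sub>L F (q o\<^sub>L x o\<^sub>L q, q o\<^sub>L y o\<^sub>L q) o\<^sub>L q))"


section \<open>Operator convex functions\<close>

definition psd_mat :: "nat \<Rightarrow> complex mat \<Rightarrow> bool" where
  "psd_mat n X \<longleftrightarrow> X \<in> carrier_mat n n \<and> mat_adjoint X = X \<and>
     (\<forall>v\<in>carrier_vec n. 0 \<le> Re ((X *\<^sub>v v) \<bullet>c v))"

definition pd_mat :: "nat \<Rightarrow> complex mat \<Rightarrow> bool" where
  "pd_mat n X \<longleftrightarrow> X \<in> carrier_mat n n \<and> mat_adjoint X = X \<and>
     (\<forall>v\<in>carrier_vec n. v \<noteq> 0\<^sub>v n \<longrightarrow> 0 < Re ((X *\<^sub>v v) \<bullet>c v))"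

definition unitary_mat :: "nat \<Rightarrow> complex mat \<Rightarrow> bool" where
  "unitary_mat n U \<longleftrightarrow> U \<in> carrier_mat n n \<and>
     mat_adjoint U * U = 1\<^sub>m n \<and> U * mat_adjoint U = 1\<^sub>m n"

text \<open>Functional calculus for Hermitian matrices: \<open>U diag(d) U\<^sup>*\<close> is sent to \<open>U diag(f(d)) U\<^sup>*\<close>,
  which does not depend on the chosen diagonalization.\<close>

definition fun_mat :: "(real \<Rightarrow> real) \<Rightarrow> complex mat \<Rightarrow> complex mat" where
  "fun_mat f X = (THE Y. \<exists>U (d :: nat \<Rightarrow> real). unitary_mat (dim_row X) U \<and>
     X = U * mat_diag (dim_row X) (\<lambda>i. complex_of_real (d i)) * mat_adjoint U \<and>
     Y = U * mat_diag (dim_row X) (\<lambda>i. complex_of_real (f (d i))) * mat_adjoint U)"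

text \<open>Operator convexity on \<open>(0, \<infinity>)\<close>: the values of \<open>f\<close> elsewhere are irrelevant, as all
  eigenvalues involved are positive. The Loewner order is spelled out because \<open>\<le>\<close> on
  \<^typ>\<open>complex mat\<close> is entrywise.\<close>

definition operator_convex :: "(real \<Rightarrow> real) \<Rightarrow> bool" where
  "operator_convex f \<longleftrightarrow> (\<forall>n X Y. \<forall>l\<in>{0..1::real}. pd_mat n X \<and> pd_mat n Y \<longrightarrow>
     psd_mat n
       ((complex_of_real l \<cdot>\<^sub>m fun_mat f X + complex_of_real (1 - l) \<cdot>\<^sub>m fun_mat f Y)
        - fun_mat f (complex_of_real l \<cdot>\<^sub>m X + complex_of_real (1 - l) \<cdot>\<^sub>m Y)))"

end

theory Submission
  imports Defs "Jordan_Normal_Form.Spectral_Radius"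
begin

text \<open>Unitary invariance makes \<open>F (a 1, b 1)\<close> commute with every symmetry \<open>1 - 2 p\<close>, so it is a scalar
\<open>c(a, b)\<close> (\<open>F_scalar_exists\<close>), and \<open>f(t) = c(1, t)\<close> is the only candidate. Compatibility with orthogonal
sums then gives \<open>F\<close> entrywise on pairs that are diagonal in one finite orthonormal family
(\<open>F_diag_op_full\<close>). For a finite-dimensional projection \<open>P\<close>, the compression \<open>P X P\<close> can be made to agree
with \<open>X\<close> on any finite set of vectors, and these compressions approximate \<open>X\<close> strongly; so
strong continuity yields \<open>F (1, X) = f(X)\<close> (\<open>fun_op_scalar_value\<close>).

For invertible \<open>A\<close> put \<open>C = A\<^sup>1\<^sup>/\<^sup>2\<close> and \<open>X = C\<^sup>-\<^sup>1 B C\<^sup>-\<^sup>1\<close>. The claim is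
\<open>F (C C, C X C) = C F (1, X) C\<close>. Continuity is available only at pairs \<open>(1, B)\<close>, so limits in the
first variable are out of reach. Both inequalities are therefore tested on one vector at a time, where
finitely many vectors decide the matter.

\<^item> \<open>F \<le> perspective\<close>. Convexity and homogeneity make \<open>F\<close> subadditive. The crucial estimate is
  \<open>F (a T, b T) \<le> c(a, b) T\<close> for every positive \<open>T\<close> (\<open>F_multiple_le\<close>): to test it on \<open>x\<close>, split off from
  \<open>T\<close> the rank-one operator that agrees with \<open>T\<close> at \<open>x\<close>. The rest annihilates \<open>x\<close>, and so
  does the value of \<open>F\<close> at its multiples. Next, \<open>X' = X\<^sup>1\<^sup>/\<^sup>2 P X\<^sup>1\<^sup>/\<^sup>2\<close> has finite rank and lies below \<open>X\<close>.
  Diagonalizing \<open>X'\<close> writes \<open>(C C, C X C)\<close> as a finite sum of pairs \<open>(T, l T)\<close> plus \<open>(0, C (X - X') C)\<close>,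
  and for a suitable \<open>P\<close> the last term does not contribute at \<open>x\<close> (\<open>F_congruence_upper\<close>).

\<^item> \<open>perspective \<le> F\<close>. Averaging over the symmetry \<open>1 - 2 p\<close> shows that compressing the arguments gives
  at most the compressed value (\<open>F_compression\<close>). In infinite dimension every self-adjoint contraction
  on a finite-dimensional subspace is a corner of a symmetry of the whole space
  (\<open>contraction_dilation\<close>). Together they give \<open>F (q E A E q, q E B E q) \<le> q E F (A, B) E q\<close> for
  self-adjoint \<open>E\<close> and finite-dimensional \<open>q\<close>. Take \<open>E = C\<^sup>-\<^sup>1\<close>; only \<open>F (q, q X q)\<close> is left, and
  letting \<open>q\<close> grow turns it into \<open>F (1, X)\<close> (\<open>F_congruence_lower\<close>).

Matrices embed as finite-rank operators on the Hilbert space, and \<open>f\<close> of a matrix is a corner of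
\<open>F (1, X)\<close>. Hence operator convexity of \<open>f\<close> is midpoint convexity of \<open>F\<close> combined with continuity along
segments (\<open>scalar_value_operator_convex\<close>).

The functional calculus rests on a single device: the vector \<open>p(T) x\<close> lives in the span of
\<open>x, T x, T\<^sup>2 x, \<dots>\<close>, so it is computed by a finite-dimensional compression of \<open>T\<close>, which is diagonalizable
(\<open>poly_op_local_diagonal\<close>).\<close>

section \<open>Complex inner products\<close>

lemma cinner_add_left: "cinner (x + y) z = cinner x z + cinner (y::'a::complex_inner) z"
  by (metis cinner_add_right cinner_commute complex_cnj_add)

lemma cinner_scaleC_left: "cinner (a *\<^sub>C x) y = cnj a * cinner x (y::'a::complex_inner)"
  by (metis cinner_commute cinner_scaleC_right complex_cnj_mult)

lemma cinner_scaleR_right: "cinner x (r *\<^sub>R y) = of_real r * cinner x (y::'a::complex_inner)"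
  by (metis cinner_scaleC_right scaleC_of_real)

lemma cinner_scaleR_left: "cinner (r *\<^sub>R x) y = of_real r * cinner x (y::'a::complex_inner)"
  by (metis cinner_scaleC_left scaleC_of_real complex_cnj_complex_of_real)

lemma cinner_zero_right [simp]: "cinner x (0::'a::complex_inner) = 0"
  using cinner_scaleR_right[of x 0 0] by simp

lemma cinner_zero_left [simp]: "cinner (0::'a::complex_inner) x = 0"
  by (metis cinner_zero_right cinner_commute complex_cnj_zero)

lemma cinner_diff_right: "cinner x (y - z) = cinner x y - cinner x (z::'a::complex_inner)"
  using cinner_add_right[of x "y - z" z] by simp

lemma cinner_diff_left: "cinner (x - y) z = cinner x z - cinner y (z::'a::complex_inner)"
  using cinner_add_left[of "x - y" y z] by simp

lemma cinner_sum_right: "cinner x (sum f I) = (\<Sum>i\<in>I. cinner x (f i :: 'a::complex_inner))"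
  by (induction I rule: infinite_finite_induct) (auto simp: cinner_add_right)

lemma cinner_sum_left: "cinner (sum f I) x = (\<Sum>i\<in>I. cinner (f i :: 'a::complex_inner) x)"
  by (induction I rule: infinite_finite_induct) (auto simp: cinner_add_left)

lemma inner_eq_Re_cinner: "inner x y = Re (cinner x (y::'a::complex_inner))"
  by (simp add: Re_cinner)

lemma cinner_self: "cinner x x = complex_of_real ((norm (x::'a::complex_inner))\<^sup>2)"
proof -
  have "Im (cinner x x) = 0"
    using cinner_commute[of x x] by (metis add.inverse_inverse complex_cnj equation_minus_iff
        complex.sel(2) complex_surj neg_equal_zero)
  moreover have "Re (cinner x x) = (norm x)\<^sup>2"
    by (simp add: Re_cinner power2_norm_eq_inner)
  ultimately show ?thesis by (simp add: complex_eq_iff)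
qed

text \<open>With \<open>Re_cinner\<close> this recovers the complex inner product from the real one, so that identities
  between complex-linear operators need only be tested on real inner products.\<close>

lemma Im_cinner: "Im (cinner x y) = inner (\<i> *\<^sub>C x) (y::'a::complex_inner)"
  by (simp add: inner_eq_Re_cinner cinner_scaleC_left)

lemma norm_scaleC: "norm (c *\<^sub>C x) = cmod c * norm (x::'a::complex_inner)"
proof -
  have "complex_of_real ((norm (c *\<^sub>C x))\<^sup>2) = complex_of_real ((cmod c * norm x)\<^sup>2)"
    unfolding cinner_self[symmetric] cinner_scaleC_left cinner_scaleC_right
    by (simp add: cinner_self power_mult_distrib complex_norm_square[symmetric] mult_ac)
  then show ?thesis
    by (metis of_real_eq_iff norm_ge_zero mult_nonneg_nonneg power2_eq_imp_eq)
qed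

lemma cmod_cinner_le: "cmod (cinner x y) \<le> norm x * norm (y::'a::complex_inner)"
proof (cases "cinner x y = 0")
  case False
  \<comment> \<open>a phase that rotates \<open>y\<close> so that the inner product becomes real and nonnegative\<close>
  define c where "c = cnj (cinner x y) / of_real (cmod (cinner x y))"
  have "cmod c = 1" using False by (simp add: c_def norm_divide)
  have "c * cinner x y = of_real (cmod (cinner x y))"
    using False by (simp add: c_def complex_norm_square[symmetric] field_simps power2_eq_square mult.commute)
  then have "cmod (cinner x y) = Re (cinner x (c *\<^sub>C y))"
    by (simp add: cinner_scaleC_right)
  also have "\<dots> \<le> norm x * norm (c *\<^sub>C y)"
    by (metis Re_cinner norm_cauchy_schwarz)
  finally show ?thesis using \<open>cmod c = 1\<close> by (simp add: norm_scaleC)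
qed simp

lemma scaleR_scaleC: "r *\<^sub>R c *\<^sub>C x = c *\<^sub>C r *\<^sub>R (x::'a::complex_inner)"
  by (metis scaleC_of_real scaleC_scaleC mult.commute)

lemma scaleC_of_real_mult: "(of_real a * c) *\<^sub>C x = a *\<^sub>R c *\<^sub>C (x::'a::complex_inner)"
  by (simp only: scaleC_scaleC[symmetric] scaleC_of_real)

lemma scaleC_sum_right: "c *\<^sub>C (sum f I) = (\<Sum>i\<in>I. c *\<^sub>C (f i::'a::complex_inner))"
  by (rule complex_vector.scale_sum_right)

lemma scaleC_diff_right: "c *\<^sub>C (x - y) = c *\<^sub>C x - c *\<^sub>C (y::'a::complex_inner)"
  by (rule complex_vector.scale_right_diff_distrib)

section \<open>Adjoints and positive operators\<close>

text \<open>The functional \<open>x \<mapsto> \<parallel>x\<parallel>\<^sup>2 - 2 \<phi>(x)\<close> is bounded below, and by the parallelogram law its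
  minimizing sequences are Cauchy. Its minimizer represents \<open>\<phi>\<close>, because the derivative vanishes there.\<close>

lemma riesz_representation:
  fixes phi :: "'a::chilbert_space \<Rightarrow> real"
  assumes "bounded_linear phi"
  shows "\<exists>z. \<forall>x. phi x = inner x z"
proof -
  interpret bounded_linear phi by fact
  define J where "J x = (norm x)\<^sup>2 - 2 * phi x" for x
  obtain K where K: "\<And>x. norm (phi x) \<le> norm x * K" using bounded by blast
  have lowerbound: "J x \<ge> - K\<^sup>2" for x
  proof -
    have "phi x \<le> norm x * K" using K[of x] by simp
    moreover have "(norm x)\<^sup>2 - 2 * (norm x * K) + K\<^sup>2 = (norm x - K)\<^sup>2"
      by (simp add: power2_eq_square algebra_simps)
    ultimately show ?thesis unfolding J_def
      using zero_le_power2[of "norm x - K"] by linarith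
  qed
  define m where "m = (INF x. J x)"
  have bdd: "bdd_below (range J)" using lowerbound by (intro bdd_belowI[of _ "- K\<^sup>2"]) auto
  have m_le: "m \<le> J x" for x unfolding m_def by (rule cINF_lower[OF bdd]) simp
  have "\<exists>x. J x < m + 1 / Suc n" for n
    using cInf_lessD[of "range J" "m + 1 / Suc n"] unfolding m_def by auto
  then obtain s where s: "\<And>n. J (s n) < m + 1 / Suc n" by metis
  have par: "(norm (x - y))\<^sup>2 = 2 * J x + 2 * J y - 4 * J ((1/2) *\<^sub>R (x + y))" for x y
    unfolding J_def scaleR add
    by (simp add: power2_norm_eq_inner inner_simps inner_commute algebra_simps)
  have two: "2 / real (Suc i) = 2 * (1 / real (Suc i))" for i by simp
  have close: "(norm (s i - s j))\<^sup>2 \<le> 2 / Suc i + 2 / Suc j" for i j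
    using par[of "s i" "s j"] s[of i] s[of j] m_le[of "(1/2) *\<^sub>R (s i + s j)"]
    unfolding two by linarith
  have "Cauchy s"
  proof (rule CauchyI)
    fix e :: real assume "0 < e"
    then obtain N where N: "4 / e\<^sup>2 < real (Suc N)" by (metis less_Suc_eq reals_Archimedean2 of_nat_less_iff order_less_trans)
    have "norm (s i - s j) < e" if "i \<ge> N" "j \<ge> N" for i j
    proof -
      have "2 / Suc i + 2 / Suc j \<le> 2 / Suc N + 2 / Suc N"
        using that by (intro add_mono divide_left_mono) auto
      also have "\<dots> = 4 / Suc N" by simp
      also have "\<dots> < e\<^sup>2" using N \<open>0 < e\<close> by (simp add: field_simps)
      finally have "(norm (s i - s j))\<^sup>2 < e\<^sup>2" using close[of i j] by linarith
      then show ?thesis using \<open>0 < e\<close> by (simp add: power2_less_imp_less)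
    qed
    then show "\<exists>M. \<forall>i\<ge>M. \<forall>j\<ge>M. norm (s i - s j) < e" by blast
  qed
  then obtain z where z: "s \<longlonglongrightarrow> z" using Cauchy_convergent_iff convergent_def by blast
  have "(\<lambda>n. J (s n)) \<longlonglongrightarrow> J z"
    unfolding J_def by (intro tendsto_intros z tendsto)
  moreover have "(\<lambda>n. m + 1 / Suc n) \<longlonglongrightarrow> m + 0"
    by (intro tendsto_intros LIMSEQ_Suc lim_1_over_n)
  ultimately have "J z \<le> m + 0"
    by (rule LIMSEQ_le) (use s less_imp_le in blast)
  then have "J z \<le> m" by simp
  have "phi x = inner x z" for x
  proof (rule ccontr)
    define d where "d = inner x z - phi x"
    \<comment> \<open>a step against the derivative \<open>2 d\<close>, short enough for the quadratic term not to compensate\<close>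
    define t where "t = - d / ((norm x)\<^sup>2 + 1)"
    assume "phi x \<noteq> inner x z"
    then have "d \<noteq> 0" by (simp add: d_def)
    have "J (z + t *\<^sub>R x) = J z + 2 * t * d + t\<^sup>2 * (norm x)\<^sup>2"
      unfolding J_def add scaleR d_def
      by (simp add: power2_norm_eq_inner inner_simps inner_commute algebra_simps power2_eq_square[of t])
    then have "0 \<le> 2 * t * d + t\<^sup>2 * (norm x)\<^sup>2"
      using m_le[of "z + t *\<^sub>R x"] \<open>J z \<le> m\<close> by linarith
    also have "\<dots> \<le> 2 * t * d + t\<^sup>2 * ((norm x)\<^sup>2 + 1)" by (simp add: algebra_simps)
    also have "\<dots> = - d\<^sup>2 / ((norm x)\<^sup>2 + 1)"
    proof -
      have "2 * (- d / N) * d + (- d / N)\<^sup>2 * N = - d\<^sup>2 / N" if "N > 0" for N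
        using that by (simp add: field_simps power2_eq_square)
      then show ?thesis unfolding t_def by (simp add: add_nonneg_pos)
    qed
    also have "\<dots> < 0" using \<open>d \<noteq> 0\<close> by (simp add: add_nonneg_pos)
    finally show False by simp
  qed
  then show ?thesis by blast
qed

lemmas blinfun_linear = blinfun.add_left blinfun.diff_left blinfun.scaleR_left
  blinfun.add_right blinfun.diff_right blinfun.scaleR_right

lemma blinfun_compose_assoc: "(A o\<^sub>L B) o\<^sub>L C = A o\<^sub>L (B o\<^sub>L C)"
  by (rule blinfun_eqI) simp

lemma blinfun_compose_id [simp]: "id_blinfun o\<^sub>L A = A" "A o\<^sub>L id_blinfun = A"
  by (rule blinfun_eqI, simp)+

lemma bounded_opsD: "T \<in> \<B> \<Longrightarrow> T (c *\<^sub>C x) = c *\<^sub>C T x"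
  by (simp add: bounded_ops_def)

lemma bounded_ops_simps [simp]:
  shows "id_blinfun \<in> \<B>" "0 \<in> \<B>"
    and "S \<in> \<B> \<Longrightarrow> T \<in> \<B> \<Longrightarrow> S o\<^sub>L T \<in> \<B>"
    and "S \<in> \<B> \<Longrightarrow> T \<in> \<B> \<Longrightarrow> S + T \<in> \<B>"
    and "S \<in> \<B> \<Longrightarrow> T \<in> \<B> \<Longrightarrow> S - T \<in> \<B>"
    and "T \<in> \<B> \<Longrightarrow> r *\<^sub>R T \<in> \<B>"
  by (simp_all add: bounded_ops_def blinfun_linear scaleC_add_right scaleC_diff_right scaleR_scaleC)

lemma bounded_linear_scaleC: "bounded_linear (\<lambda>x::'a::complex_inner. c *\<^sub>C x)"
  by (rule bounded_linear_intro[where K = "cmod c"])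
     (simp_all add: scaleC_add_right scaleR_scaleC norm_scaleC mult.commute)

lemma bounded_ops_limit:
  assumes "\<And>n. S n \<in> \<B>" and "S \<longlonglongrightarrow> T"
  shows "T \<in> \<B>"
  unfolding bounded_ops_def
proof (intro CollectI allI)
  fix c x
  have l: "(\<lambda>n. S n y) \<longlonglongrightarrow> T y" for y
    using assms(2) by (intro tendsto_intros)
  have "(\<lambda>n. c *\<^sub>C S n x) \<longlonglongrightarrow> c *\<^sub>C T x"
    by (rule bounded_linear.tendsto[OF bounded_linear_scaleC l])
  then show "T (c *\<^sub>C x) = c *\<^sub>C T x"
    using l[of "c *\<^sub>C x"] assms(1) by (simp add: bounded_opsD LIMSEQ_unique)
qed

lemma cinner_adjoint_iff_inner:
  assumes "S \<in> \<B>" "T \<in> \<B>"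
  shows "(\<forall>x y. cinner (T x) y = cinner x (S y)) \<longleftrightarrow>
    (\<forall>x y. inner (T x) y = inner x (S y))"
  by (metis (mono_tags, opaque_lifting) Im_cinner Re_cinner assms bounded_opsD complex_eqI)

lemma adjoint_exists:
  fixes T :: "'a::chilbert_space \<Rightarrow>\<^sub>L 'a"
  assumes T: "T \<in> \<B>"
  shows "\<exists>S\<in>\<B>. \<forall>x y. cinner (T x) y = cinner x (S y)"
proof -
  have "\<exists>z. \<forall>x. inner (T x) y = inner x z" for y
    by (rule riesz_representation)
       (intro bounded_linear_inner_left_comp blinfun.bounded_linear_right)
  then obtain S where S: "\<And>x y. inner (T x) y = inner x (S y)" by metis
  have eqI: "a = b" if "\<And>x. inner x a = inner x b" for a b :: 'a
    by (metis that vector_eq_ldot)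
  have c: "cinner (T x) y = cinner x (S y)" for x y
    by (metis (mono_tags, opaque_lifting) Im_cinner Re_cinner S T bounded_opsD complex_eqI)
  have "bounded_linear S"
  proof (rule bounded_linear_intro)
    show "S (x + y) = S x + S y" for x y
      by (rule eqI) (simp add: S[symmetric] inner_add_right)
    show "S (r *\<^sub>R x) = r *\<^sub>R S x" for r x
      by (rule eqI) (simp add: S[symmetric])
    show "norm (S x) \<le> norm x * norm T" for x
    proof (cases "S x = 0")
      case False
      have "norm (S x) * norm (S x) = inner (T (S x)) x"
        by (simp add: S power2_norm_eq_inner[symmetric] power2_eq_square)
      also have "\<dots> \<le> norm (T (S x)) * norm x" by (rule norm_cauchy_schwarz)
      also have "\<dots> \<le> (norm T * norm (S x)) * norm x"
        by (intro mult_right_mono norm_blinfun) simp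
      finally show ?thesis using False by (simp add: mult.commute mult.left_commute)
    qed simp
  qed
  moreover have "S (d *\<^sub>C y) = d *\<^sub>C S y" for d y
  proof (rule eqI)
    fix x
    have "cinner x (S (d *\<^sub>C y)) = cinner x (d *\<^sub>C S y)"
      by (metis c cinner_scaleC_right)
    then show "inner x (S (d *\<^sub>C y)) = inner x (d *\<^sub>C S y)" by (simp add: inner_eq_Re_cinner)
  qed
  ultimately have "Blinfun S \<in> \<B>" "blinfun_apply (Blinfun S) = S"
    by (simp_all add: bounded_ops_def bounded_linear_Blinfun_apply)
  then show ?thesis using c by (intro bexI[of _ "Blinfun S"]) auto
qed

lemma adj_op_eqI:
  fixes T :: "'a::complex_inner \<Rightarrow>\<^sub>L 'a"
  assumes S: "S \<in> \<B>" and ST: "\<And>x y. cinner (T x) y = cinner x (S y)"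
  shows "adj_op T = S"
  unfolding adj_op_def
proof (rule the_equality)
  fix S' assume S': "S' \<in> \<B> \<and> (\<forall>x y. cinner (T x) y = cinner x (S' y))"
  have "S' y = S y" for y
    by (metis Re_cinner S' ST vector_eq_ldot)
  then show "S' = S" by (simp add: blinfun_eqI)
qed (use assms in auto)

text \<open>Symmetry characterizes \<open>self_adjoint\<close> only because adjoints exist: otherwise the definite
  description in \<open>adj_op\<close> would say nothing.\<close>

lemma self_adjoint_iff:
  "self_adjoint (T :: 'a::chilbert_space \<Rightarrow>\<^sub>L 'a) \<longleftrightarrow>
     T \<in> \<B> \<and> (\<forall>x y. inner (T x) y = inner x (T y))"
proof
  assume s: "self_adjoint T"
  then have "T \<in> \<B>" by (simp add: self_adjoint_def)
  then obtain S where "S \<in> \<B>" "\<forall>x y. cinner (T x) y = cinner x (S y)"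
    using adjoint_exists by blast
  moreover then have "S = T" using adj_op_eqI s unfolding self_adjoint_def by metis
  ultimately show "T \<in> \<B> \<and> (\<forall>x y. inner (T x) y = inner x (T y))"
    using cinner_adjoint_iff_inner by blast
next
  assume "T \<in> \<B> \<and> (\<forall>x y. inner (T x) y = inner x (T y))"
  then show "self_adjoint T"
    unfolding self_adjoint_def using cinner_adjoint_iff_inner adj_op_eqI by metis
qed

lemma self_adjoint_in_bounded_ops: "self_adjoint T \<Longrightarrow> T \<in> \<B>"
  by (simp add: self_adjoint_def)

lemma self_adjointD: "self_adjoint (T :: 'a::chilbert_space \<Rightarrow>\<^sub>L 'a) \<Longrightarrow>
    inner (T x) y = inner x (T y)"
  by (simp add: self_adjoint_iff)

lemma self_adjointD_cinner: "self_adjoint (T :: 'a::chilbert_space \<Rightarrow>\<^sub>L 'a) \<Longrightarrow>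
    cinner (T x) y = cinner x (T y)"
  using self_adjoint_iff cinner_adjoint_iff_inner by blast

lemma self_adjoint_simps [simp]:
  fixes S T :: "'a::chilbert_space \<Rightarrow>\<^sub>L 'a"
  shows "self_adjoint (id_blinfun :: 'a \<Rightarrow>\<^sub>L 'a)" "self_adjoint (0 :: 'a \<Rightarrow>\<^sub>L 'a)"
    and "self_adjoint S \<Longrightarrow> self_adjoint T \<Longrightarrow> self_adjoint (S + T)"
    and "self_adjoint S \<Longrightarrow> self_adjoint T \<Longrightarrow> self_adjoint (S - T)"
    and "self_adjoint T \<Longrightarrow> self_adjoint (r *\<^sub>R T)"
    and "self_adjoint S \<Longrightarrow> self_adjoint T \<Longrightarrow> self_adjoint (S o\<^sub>L T o\<^sub>L S)"
  by (auto simp: self_adjoint_iff blinfun_linear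
      inner_add_left inner_add_right inner_diff_left inner_diff_right)

lemma self_adjoint_sum:
  "(\<And>i. i \<in> I \<Longrightarrow> self_adjoint (f i :: 'a::chilbert_space \<Rightarrow>\<^sub>L 'a)) \<Longrightarrow> self_adjoint (sum f I)"
  by (induction I rule: infinite_finite_induct) auto

lemma self_adjoint_limit:
  fixes T :: "'a::chilbert_space \<Rightarrow>\<^sub>L 'a"
  assumes S: "\<And>n. self_adjoint (S n)" and lim: "S \<longlonglongrightarrow> T"
  shows "self_adjoint T"
  unfolding self_adjoint_iff
proof (intro conjI allI)
  show "T \<in> \<B>" using bounded_ops_limit[OF _ lim] S self_adjoint_in_bounded_ops by blast
  fix x y
  have l: "(\<lambda>n. S n z) \<longlonglongrightarrow> T z" for z
    using lim by (intro tendsto_intros)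
  have "(\<lambda>n. inner (S n x) y) \<longlonglongrightarrow> inner (T x) y"
    by (intro tendsto_intros l)
  moreover have "(\<lambda>n. inner (S n x) y) \<longlonglongrightarrow> inner x (T y)"
    unfolding self_adjointD[OF S] by (intro tendsto_intros l)
  ultimately show "inner (T x) y = inner x (T y)" by (rule LIMSEQ_unique)
qed

lemma psd_op_iff: "psd_op (T :: 'a::chilbert_space \<Rightarrow>\<^sub>L 'a) \<longleftrightarrow>
    self_adjoint T \<and> (\<forall>x. 0 \<le> inner x (T x))"
  by (simp add: psd_op_def Re_cinner)

lemma psd_op_self_adjoint: "psd_op T \<Longrightarrow> self_adjoint T"
  by (simp add: psd_op_def)

lemma psd_opD: "psd_op (T :: 'a::chilbert_space \<Rightarrow>\<^sub>L 'a) \<Longrightarrow> 0 \<le> inner x (T x)"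
  by (simp add: psd_op_iff)

lemma op_le_iff: "X \<preceq> Y \<longleftrightarrow> self_adjoint (Y - X) \<and>
    (\<forall>x::'a::chilbert_space. inner x (X x) \<le> inner x (Y x))"
  by (simp add: op_le_def psd_op_iff blinfun.diff_left inner_diff_right)

lemma op_leD: "X \<preceq> Y \<Longrightarrow> inner (x::'a::chilbert_space) (X x) \<le> inner x (Y x)"
  by (simp add: op_le_iff)

lemma psd_op_simps [simp]:
  fixes S T :: "'a::chilbert_space \<Rightarrow>\<^sub>L 'a"
  shows "psd_op (id_blinfun :: 'a \<Rightarrow>\<^sub>L 'a)" "psd_op (0 :: 'a \<Rightarrow>\<^sub>L 'a)"
    and "psd_op S \<Longrightarrow> psd_op T \<Longrightarrow> psd_op (S + T)"
    and "0 \<le> r \<Longrightarrow> psd_op T \<Longrightarrow> psd_op (r *\<^sub>R T)"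
  by (simp_all add: psd_op_iff blinfun_linear inner_add_right)

lemma psd_op_sandwich [simp]:
  fixes S T :: "'a::chilbert_space \<Rightarrow>\<^sub>L 'a"
  assumes "self_adjoint S" "psd_op T"
  shows "psd_op (S o\<^sub>L T o\<^sub>L S)"
  using assms by (simp add: psd_op_iff self_adjointD[OF assms(1), symmetric])

lemma psd_op_sum: "(\<And>i. i \<in> I \<Longrightarrow> psd_op (f i :: 'a::chilbert_space \<Rightarrow>\<^sub>L 'a)) \<Longrightarrow> psd_op (sum f I)"
  by (induction I rule: infinite_finite_induct) auto

text \<open>Positivity of \<open>T\<close> makes \<open>t \<mapsto> \<langle>x + t y, T (x + t y)\<rangle>\<close> a nonnegative quadratic polynomial, so its
  discriminant is at most zero.\<close>

lemma psd_op_Cauchy_Schwarz: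
  fixes T :: "'a::chilbert_space \<Rightarrow>\<^sub>L 'a"
  assumes T: "psd_op T"
  shows "(inner x (T y))\<^sup>2 \<le> inner x (T x) * inner y (T y)"
proof -
  define a b c where "a = inner x (T x)" and "b = inner x (T y)"
    and "c = inner y (T y)"
  have sym: "inner y (T x) = b"
    unfolding b_def using psd_op_self_adjoint[OF T] by (metis inner_commute self_adjointD)
  have q: "0 \<le> a + 2 * t * b + t\<^sup>2 * c" for t
    using psd_opD[OF T, of "x + t *\<^sub>R y"] sym
    by (simp add: blinfun_linear inner_add_left inner_add_right
        a_def b_def c_def power2_eq_square algebra_simps)
  have "0 \<le> a" "0 \<le> c" using psd_opD[OF T] by (auto simp: a_def c_def)
  have "b\<^sup>2 \<le> a * c"
  proof (cases "c = 0")
    case True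
    have "b = 0"
    proof (rule ccontr)
      assume "b \<noteq> 0"
      then show False using q[of "- (a + 1) / (2 * b)"] True by (simp add: field_simps)
    qed
    then show ?thesis using True by simp
  next
    case False
    then have "c > 0" using \<open>0 \<le> c\<close> by simp
    then show ?thesis using q[of "- b / c"] by (simp add: field_simps power2_eq_square)
  qed
  then show ?thesis by (simp add: a_def b_def c_def)
qed

text \<open>The real version, applied after rotating \<open>y\<close> by the phase that makes the inner product real.\<close>

lemma psd_op_cinner_Cauchy_Schwarz:
  fixes T :: "'a::chilbert_space \<Rightarrow>\<^sub>L 'a"
  assumes T: "psd_op T"
  shows "(cmod (cinner (T x) y))\<^sup>2 \<le> inner x (T x) * inner y (T y)"
proof (cases "cinner (T x) y = 0")
  case True
  then show ?thesis using psd_opD[OF T] by simp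
next
  case False
  note sa = psd_op_self_adjoint[OF T]
  note TB = bounded_opsD[OF self_adjoint_in_bounded_ops[OF sa]]
  define z where "z = cinner (T x) y"
  define c where "c = cnj z / of_real (cmod z)"
  have z0: "cmod z \<noteq> 0" using False by (simp add: z_def)
  have "c * z = of_real (cmod z)"
    using z0 unfolding c_def by (simp add: field_simps complex_norm_square[symmetric] power2_eq_square)
  have cc: "cnj c * c = 1"
  proof -
    have "cmod c = 1" using z0 by (simp add: c_def norm_divide)
    then show ?thesis using complex_norm_square[of c] by (simp add: mult.commute)
  qed
  have "inner x (T (c *\<^sub>C y)) = Re (cinner (T x) (c *\<^sub>C y))"
    by (simp add: self_adjointD_cinner[OF sa] inner_eq_Re_cinner)
  also have "\<dots> = cmod z" using \<open>c * z = _\<close> by (simp add: cinner_scaleC_right z_def)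
  finally have "(cmod z)\<^sup>2 \<le> inner x (T x) * inner (c *\<^sub>C y) (T (c *\<^sub>C y))"
    using psd_op_Cauchy_Schwarz[OF T, of x "c *\<^sub>C y"] by simp
  moreover have "cinner (c *\<^sub>C y) (T (c *\<^sub>C y)) = cinner y (T y)"
    by (simp add: TB cinner_scaleC_left cinner_scaleC_right cc mult.commute[of c] flip: mult.assoc)
  ultimately show ?thesis by (simp add: z_def inner_eq_Re_cinner)
qed

lemma psd_op_kernel:
  fixes T :: "'a::chilbert_space \<Rightarrow>\<^sub>L 'a"
  assumes "psd_op T" "inner x (T x) = 0"
  shows "T x = 0"
  using psd_op_Cauchy_Schwarz[OF assms(1), of "T x" x] assms(2) by simp

lemma self_adjoint_eqI_quadratic:
  fixes T :: "'a::chilbert_space \<Rightarrow>\<^sub>L 'a"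
  assumes "self_adjoint S" "self_adjoint T"
    and q: "\<And>x. inner x (S x) = inner x (T x)"
  shows "S = T"
proof -
  have "psd_op (S - T)" using assms by (simp add: psd_op_iff blinfun.diff_left inner_diff_right)
  then have "(S - T) x = 0" for x
    by (rule psd_op_kernel) (simp add: q blinfun.diff_left inner_diff_right)
  then show ?thesis by (metis blinfun_eqI eq_iff_diff_eq_0 blinfun.diff_left)
qed

definition form_bounds :: "('a::complex_inner \<Rightarrow>\<^sub>L 'a) \<Rightarrow> real \<Rightarrow> real \<Rightarrow> bool" where
  "form_bounds T a b \<longleftrightarrow> (\<forall>x. a * (norm x)\<^sup>2 \<le> inner x (T x) \<and>
     inner x (T x) \<le> b * (norm x)\<^sup>2)"

lemma inner_blinfun_le:
  fixes T :: "'a::complex_inner \<Rightarrow>\<^sub>L 'a"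
  shows "\<bar>inner x (T x)\<bar> \<le> norm T * (norm x)\<^sup>2"
proof -
  have "\<bar>inner x (T x)\<bar> \<le> norm x * norm (T x)" by (rule Cauchy_Schwarz_ineq2)
  also have "\<dots> \<le> norm x * (norm T * norm x)" by (intro mult_left_mono norm_blinfun) simp
  finally show ?thesis by (simp add: power2_eq_square mult_ac)
qed

lemma form_bounds_norm: "form_bounds (T::'a::complex_inner \<Rightarrow>\<^sub>L 'a) (- norm T) (norm T)"
  unfolding form_bounds_def using inner_blinfun_le[of _ T] by (auto simp: abs_le_iff minus_le_iff)

lemma form_bounds_psd: "psd_op (T::'a::chilbert_space \<Rightarrow>\<^sub>L 'a) \<Longrightarrow> form_bounds T 0 (norm T)"
  using form_bounds_norm[of T] by (simp add: form_bounds_def psd_op_iff)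

lemma projection_op_idem: "projection_op p \<Longrightarrow> p (p x) = p x"
  by (metis blinfun_apply_blinfun_compose projection_op_def)

lemma projection_op_self_adjoint: "projection_op p \<Longrightarrow> self_adjoint p"
  by (simp add: projection_op_def)

lemma projection_op_psd: "projection_op (p :: 'a::chilbert_space \<Rightarrow>\<^sub>L 'a) \<Longrightarrow> psd_op p"
  unfolding psd_op_iff
  by (metis inner_ge_zero projection_op_idem projection_op_self_adjoint self_adjointD)

lemma projection_op_complement:
  "projection_op (p :: 'a::chilbert_space \<Rightarrow>\<^sub>L 'a) \<Longrightarrow> projection_op (id_blinfun - p)"
  by (auto simp: projection_op_idem blinfun_linear projection_op_self_adjoint
      intro!: blinfun_eqI projection_op_def[THEN iffD2])

lemma projection_op_simps [simp]:
  "projection_op (0 :: 'a::chilbert_space \<Rightarrow>\<^sub>L 'a)" "projection_op (id_blinfun :: 'a::chilbert_space \<Rightarrow>\<^sub>L 'a)"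
  by (auto simp: projection_op_def intro!: blinfun_eqI)

lemma norm_projection_le:
  fixes p :: "'a::chilbert_space \<Rightarrow>\<^sub>L 'a"
  assumes p: "projection_op p"
  shows "norm (p x) \<le> norm x"
proof (cases "p x = 0")
  case False
  have "norm (p x) * norm (p x) = inner x (p x)"
    by (metis p power2_eq_square power2_norm_eq_inner projection_op_idem projection_op_self_adjoint self_adjointD)
  also have "\<dots> \<le> norm x * norm (p x)" by (rule norm_cauchy_schwarz)
  finally show ?thesis using False by simp
qed simp

lemma norm_projection_op: "projection_op (p::'a::chilbert_space \<Rightarrow>\<^sub>L 'a) \<Longrightarrow> norm p \<le> 1"
  by (rule norm_blinfun_bound) (simp_all add: norm_projection_le)

lemma minus_twice: "v - 2 *\<^sub>R v = - (v::'a::real_vector)"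
  by (simp add: scaleR_2)

text \<open>The unitaries through which the invariance of \<open>F\<close> enters the argument.\<close>

lemma reflection_unitary:
  fixes p :: "'a::chilbert_space \<Rightarrow>\<^sub>L 'a"
  assumes p: "projection_op p"
  defines "u \<equiv> id_blinfun - 2 *\<^sub>R p"
  shows "unitary_op u" "adj_op u = u" "self_adjoint u" "u o\<^sub>L u = id_blinfun"
proof -
  show s: "self_adjoint u" unfolding u_def using projection_op_self_adjoint[OF p] by simp
  then show a: "adj_op u = u" by (simp add: self_adjoint_def)
  have v: "2 *\<^sub>R (v - 2 *\<^sub>R v) = - (2 *\<^sub>R v)" for v :: 'a
  proof -
    have "v - 2 *\<^sub>R v = (1 - 2) *\<^sub>R v" unfolding scaleR_left_diff_distrib by simp
    then show ?thesis by simp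
  qed
  show i: "u o\<^sub>L u = id_blinfun"
    by (rule blinfun_eqI) (simp add: u_def blinfun_linear projection_op_idem[OF p] v)
  show "unitary_op u" using self_adjoint_in_bounded_ops[OF s] by (simp add: unitary_op_def a i)
qed

section \<open>Finite orthonormal families\<close>

definition rank_one :: "'a::complex_inner \<Rightarrow> 'a \<Rightarrow>\<^sub>L 'a" where
  "rank_one e = Blinfun (\<lambda>x. cinner e x *\<^sub>C e)"

definition orthonormal :: "(nat \<Rightarrow> 'a::complex_inner) \<Rightarrow> nat \<Rightarrow> bool" where
  "orthonormal e n \<longleftrightarrow> (\<forall>i<n. \<forall>j<n. cinner (e i) (e j) = (if i = j then 1 else 0))"

text \<open>For orthonormal \<open>e\<close> this is diagonal on the span of the family, with eigenvalues \<open>l i\<close>, and zero on the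
  orthogonal complement.\<close>

definition diag_op :: "(nat \<Rightarrow> 'a::complex_inner) \<Rightarrow> (nat \<Rightarrow> real) \<Rightarrow> nat \<Rightarrow> 'a \<Rightarrow>\<^sub>L 'a" where
  "diag_op e l n = (\<Sum>i<n. l i *\<^sub>R rank_one (e i))"

abbreviation span_proj :: "(nat \<Rightarrow> 'a::complex_inner) \<Rightarrow> nat \<Rightarrow> 'a \<Rightarrow>\<^sub>L 'a" where
  "span_proj e n \<equiv> diag_op e (\<lambda>_. 1) n"

lemma rank_one_apply: "rank_one e x = cinner e x *\<^sub>C e"
proof -
  have "bounded_linear (\<lambda>x. cinner e x *\<^sub>C e)"
  proof (rule bounded_linear_intro)
    show "cinner e (x + y) *\<^sub>C e = cinner e x *\<^sub>C e + cinner e y *\<^sub>C e" for x y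
      by (simp add: cinner_add_right scaleC_add_left)
    show "cinner e (r *\<^sub>R x) *\<^sub>C e = r *\<^sub>R cinner e x *\<^sub>C e" for r x
      by (metis cinner_scaleR_right scaleC_of_real scaleC_scaleC)
    show "norm (cinner e x *\<^sub>C e) \<le> norm x * (norm e * norm e)" for x
      using mult_right_mono[OF cmod_cinner_le[of e x] norm_ge_zero[of e]]
      by (simp add: norm_scaleC mult_ac)
  qed
  then show ?thesis by (simp add: rank_one_def bounded_linear_Blinfun_apply)
qed

lemma inner_rank_one: "inner x (rank_one e x) = (cmod (cinner e x))\<^sup>2"
proof -
  have "cinner x (rank_one e x) = cinner e x * cnj (cinner e x)"
    by (simp add: rank_one_apply cinner_scaleC_right cinner_commute[of x e])
  then show ?thesis by (simp add: inner_eq_Re_cinner complex_norm_square[symmetric] flip: of_real_power)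
qed

lemma rank_one_self_adjoint: "self_adjoint (rank_one (e::'a::chilbert_space))"
  unfolding self_adjoint_iff
proof (intro conjI allI)
  show "rank_one e \<in> \<B>" by (simp add: bounded_ops_def rank_one_apply cinner_scaleC_right scaleC_scaleC)
  fix x y
  have "cinner (rank_one e x) y = cinner x (rank_one e y)"
    by (simp add: rank_one_apply cinner_scaleC_right cinner_scaleC_left cinner_commute[of x e])
  then show "inner (rank_one e x) y = inner x (rank_one e y)"
    by (simp add: inner_eq_Re_cinner)
qed

lemma rank_one_psd: "psd_op (rank_one (e::'a::chilbert_space))"
  by (simp add: psd_op_iff rank_one_self_adjoint inner_rank_one)

lemma rank_one_projection: "norm (e::'a::chilbert_space) = 1 \<Longrightarrow> projection_op (rank_one e)"
  by (auto simp: projection_op_def rank_one_self_adjoint rank_one_apply cinner_scaleC_right cinner_self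
      intro!: blinfun_eqI)

lemma rank_one_scaleR: "rank_one (r *\<^sub>R v) = (r * r) *\<^sub>R rank_one v"
proof (rule blinfun_eqI)
  fix x
  have "rank_one (r *\<^sub>R v) x = cinner (of_real r *\<^sub>C v) x *\<^sub>C of_real r *\<^sub>C v"
    by (simp add: rank_one_apply scaleC_of_real)
  also have "\<dots> = of_real (r * r) *\<^sub>C cinner v x *\<^sub>C v"
    by (simp add: cinner_scaleC_left scaleC_scaleC mult_ac)
  also have "\<dots> = ((r * r) *\<^sub>R rank_one v) x"
    by (simp only: scaleC_of_real blinfun.scaleR_left rank_one_apply)
  finally show "rank_one (r *\<^sub>R v) x = ((r * r) *\<^sub>R rank_one v) x" .
qed

lemma rank_one_sandwich:
  fixes S :: "'a::chilbert_space \<Rightarrow>\<^sub>L 'a"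
  assumes "self_adjoint S"
  shows "S o\<^sub>L rank_one v o\<^sub>L S = rank_one (S v)"
  by (rule blinfun_eqI)
     (simp add: rank_one_apply self_adjointD_cinner[OF assms] bounded_opsD[OF self_adjoint_in_bounded_ops[OF assms]])

lemma orthonormalD: "orthonormal e n \<Longrightarrow> i < n \<Longrightarrow> j < n \<Longrightarrow> cinner (e i) (e j) = (if i = j then 1 else 0)"
  by (simp add: orthonormal_def)

lemma orthonormal_norm: "orthonormal e n \<Longrightarrow> i < n \<Longrightarrow> norm (e i) = 1"
  using orthonormalD[of e n i i] cinner_self[of "e i"]
  by (metis norm_eq_1 inner_eq_Re_cinner one_complex.sel(1))

lemma orthonormal_mono: "orthonormal e n \<Longrightarrow> m \<le> n \<Longrightarrow> orthonormal e m"
  by (auto simp: orthonormal_def)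

lemma diag_op_cong:
  "(\<And>i. i < n \<Longrightarrow> e i = e' i) \<Longrightarrow> (\<And>i. i < n \<Longrightarrow> l i = l' i) \<Longrightarrow> diag_op e l n = diag_op e' l' n"
  by (simp add: diag_op_def)

lemma diag_op_0 [simp]: "diag_op e l 0 = 0"
  by (simp add: diag_op_def)

lemma diag_op_Suc: "diag_op e l (Suc n) = diag_op e l n + l n *\<^sub>R rank_one (e n)"
  by (simp add: diag_op_def)

lemma diag_op_apply: "diag_op e l n x = (\<Sum>i<n. (of_real (l i) * cinner (e i) x) *\<^sub>C e i)"
  by (simp add: diag_op_def blinfun.sum_left blinfun.scaleR_left rank_one_apply scaleC_of_real flip: scaleC_scaleC)

lemma diag_op_scaleR: "r *\<^sub>R diag_op e l n = diag_op e (\<lambda>i. r * l i) n"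
  by (simp add: diag_op_def scaleR_sum_right)

lemma diag_op_sum:
  "(\<Sum>k\<in>K. c k *\<^sub>R diag_op e (m k) n) = diag_op e (\<lambda>i. \<Sum>k\<in>K. c k * m k i) n"
  unfolding diag_op_def scaleR_sum_right
  by (subst sum.swap) (simp add: scaleR_sum_left)

lemma diag_op_self_adjoint: "self_adjoint (diag_op (e::nat \<Rightarrow> 'a::chilbert_space) l n)"
  unfolding diag_op_def by (rule self_adjoint_sum) (simp add: rank_one_self_adjoint)

lemma diag_op_psd: "(\<And>i. i < n \<Longrightarrow> 0 \<le> l i) \<Longrightarrow> psd_op (diag_op (e::nat \<Rightarrow> 'a::chilbert_space) l n)"
  unfolding diag_op_def by (rule psd_op_sum) (simp add: rank_one_psd)

lemma inner_diag_op: "inner x (diag_op e l n x) = (\<Sum>i<n. l i * (cmod (cinner (e i) x))\<^sup>2)"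
  by (simp add: diag_op_def blinfun.sum_left blinfun.scaleR_left inner_sum_right inner_rank_one)

lemma cinner_diag_op:
  assumes "orthonormal e n" "j < n"
  shows "cinner (e j) (diag_op e l n x) = of_real (l j) * cinner (e j) x"
proof -
  have "cinner (e j) (diag_op e l n x) = (\<Sum>i<n. if i = j then of_real (l j) * cinner (e j) x else 0)"
    unfolding diag_op_apply cinner_sum_right
    by (rule sum.cong) (use assms in \<open>auto simp: cinner_scaleC_right orthonormalD\<close>)
  then show ?thesis using assms(2) by simp
qed

lemma diag_op_basis:
  assumes "orthonormal e n" "j < n"
  shows "diag_op e l n (e j) = l j *\<^sub>R e j"
proof -
  have "diag_op e l n (e j) = (\<Sum>i<n. if i = j then l j *\<^sub>R e j else 0)"
    unfolding diag_op_apply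
    by (rule sum.cong) (use assms in \<open>auto simp: orthonormalD scaleC_of_real\<close>)
  then show ?thesis using assms(2) by simp
qed

lemma diag_op_compose:
  assumes "orthonormal e n"
  shows "diag_op e l n o\<^sub>L diag_op e m n = diag_op e (\<lambda>i. l i * m i) n"
proof (rule blinfun_eqI)
  fix x
  show "(diag_op e l n o\<^sub>L diag_op e m n) x = diag_op e (\<lambda>i. l i * m i) n x"
    unfolding blinfun_apply_blinfun_compose diag_op_apply[of _ _ _ "blinfun_apply _ _"]
    by (subst diag_op_apply) (auto simp: cinner_diag_op[OF assms] intro!: sum.cong)
qed

lemma span_proj_projection:
  "orthonormal (e::nat \<Rightarrow> 'a::chilbert_space) n \<Longrightarrow> projection_op (span_proj e n)"
  by (simp add: projection_op_def diag_op_self_adjoint diag_op_compose)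

lemma norm_diag_op_sq:
  fixes e :: "nat \<Rightarrow> 'a::chilbert_space"
  assumes "orthonormal e n"
  shows "(norm (diag_op e l n x))\<^sup>2 = (\<Sum>i<n. (l i)\<^sup>2 * (cmod (cinner (e i) x))\<^sup>2)"
proof -
  have "(norm (diag_op e l n x))\<^sup>2 = inner x ((diag_op e l n o\<^sub>L diag_op e l n) x)"
    by (simp add: power2_norm_eq_inner self_adjointD[OF diag_op_self_adjoint])
  then show ?thesis by (simp add: diag_op_compose[OF assms] inner_diag_op power2_eq_square)
qed

lemma norm_diag_op_le:
  fixes e :: "nat \<Rightarrow> 'a::chilbert_space"
  assumes "orthonormal e n" and M: "\<And>i. i < n \<Longrightarrow> \<bar>l i\<bar> \<le> M" and "0 \<le> M"
  shows "norm (diag_op e l n x) \<le> M * norm x"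
proof -
  have lM: "(l i)\<^sup>2 \<le> M\<^sup>2" if "i < n" for i
    using power_mono[OF M[OF that], of 2] by simp
  have "(norm (diag_op e l n x))\<^sup>2 \<le> (\<Sum>i<n. M\<^sup>2 * (cmod (cinner (e i) x))\<^sup>2)"
    unfolding norm_diag_op_sq[OF assms(1)]
    by (intro sum_mono mult_right_mono) (auto simp: lM)
  also have "\<dots> = M\<^sup>2 * (norm (span_proj e n x))\<^sup>2"
    by (simp add: norm_diag_op_sq[OF assms(1)] sum_distrib_left)
  also have "\<dots> \<le> M\<^sup>2 * (norm x)\<^sup>2"
    by (intro mult_left_mono power_mono norm_projection_le span_proj_projection assms(1)) auto
  finally have "(norm (diag_op e l n x))\<^sup>2 \<le> (M * norm x)\<^sup>2"
    by (simp add: power_mult_distrib)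
  then show ?thesis by (rule power2_le_imp_le) (simp add: \<open>0 \<le> M\<close>)
qed

lemma span_proj_fixes_iff_sum:
  "span_proj e n x = x \<longleftrightarrow> x = (\<Sum>i<n. cinner (e i) x *\<^sub>C e i)"
  by (auto simp: diag_op_apply)

lemma span_proj_combination:
  assumes "orthonormal (e::nat \<Rightarrow> 'a::chilbert_space) n"
  shows "span_proj e n (\<Sum>i<n. c i *\<^sub>C e i) = (\<Sum>i<n. c i *\<^sub>C e i)"
  using bounded_opsD[OF self_adjoint_in_bounded_ops[OF diag_op_self_adjoint], of e "\<lambda>_. 1" n]
  by (simp add: blinfun.sum_right diag_op_basis[OF assms])

lemma bounded_op_fixes_span:
  assumes "Q \<in> \<B>" "\<And>i. i < n \<Longrightarrow> Q (e i) = e i" "span_proj e n x = x"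
  shows "Q x = x"
proof -
  have "Q (\<Sum>i<n. cinner (e i) x *\<^sub>C e i) = (\<Sum>i<n. cinner (e i) x *\<^sub>C e i)"
    by (simp add: blinfun.sum_right bounded_opsD[OF assms(1)] assms(2))
  then show ?thesis using assms(3) span_proj_fixes_iff_sum by metis
qed

lemma span_proj_mono:
  assumes "orthonormal (e'::nat \<Rightarrow> 'a::chilbert_space) n'" "n \<le> n'" "\<And>i. i < n \<Longrightarrow> e' i = e i"
    "span_proj e n x = x"
  shows "span_proj e' n' x = x"
proof (rule bounded_op_fixes_span[OF _ _ assms(4)])
  show "span_proj e' n' \<in> \<B>" by (rule self_adjoint_in_bounded_ops[OF diag_op_self_adjoint])
  show "span_proj e' n' (e i) = e i" if "i < n" for i
    using diag_op_basis[OF assms(1), of i "\<lambda>_. 1"] that assms(2,3) by fastforce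
qed

lemma span_proj_eqI:
  fixes e e' :: "nat \<Rightarrow> 'a::chilbert_space"
  assumes o: "orthonormal e n" "orthonormal e' n'"
    and a: "\<And>i. i < n \<Longrightarrow> span_proj e' n' (e i) = e i"
    and b: "\<And>i. i < n' \<Longrightarrow> span_proj e n (e' i) = e' i"
  shows "span_proj e n = span_proj e' n'"
proof (rule blinfun_eqI)
  let ?P = "span_proj e n" and ?Q = "span_proj e' n'"
  have sa: "self_adjoint ?P" "self_adjoint ?Q" by (rule diag_op_self_adjoint)+
  have QP: "blinfun_apply ?Q (blinfun_apply ?P x) = blinfun_apply ?P x" for x
    by (rule bounded_op_fixes_span[OF self_adjoint_in_bounded_ops[OF sa(2)] a])
       (auto simp: projection_op_idem[OF span_proj_projection[OF o(1)]])
  have PQ: "blinfun_apply ?P (blinfun_apply ?Q x) = blinfun_apply ?Q x" for x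
    by (rule bounded_op_fixes_span[OF self_adjoint_in_bounded_ops[OF sa(1)] b])
       (auto simp: projection_op_idem[OF span_proj_projection[OF o(2)]])
  show "blinfun_apply ?P x = blinfun_apply ?Q x" for x
    by (metis PQ QP sa self_adjointD vector_eq_rdot)
qed

text \<open>Both numbers are the double sum of \<open>|\<langle>e i, e' j\<rangle>|\<^sup>2\<close>, that is, the trace of the common projection.\<close>

lemma orthonormal_dimension_unique:
  fixes e e' :: "nat \<Rightarrow> 'a::chilbert_space"
  assumes o: "orthonormal e n" "orthonormal e' n'" and eq: "span_proj e n = span_proj e' n'"
  shows "n = n'"
proof -
  have one: "inner (e i) (span_proj e n (e i)) = 1" if "i < n" "orthonormal e n" for i e n
    using that by (simp add: diag_op_basis power2_norm_eq_inner[symmetric] orthonormal_norm)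
  have "real n = (\<Sum>i<n. inner (e i) (span_proj e' n' (e i)))"
    using one[OF _ o(1)] by (simp add: eq)
  also have "\<dots> = (\<Sum>j<n'. \<Sum>i<n. (cmod (cinner (e' j) (e i)))\<^sup>2)"
    unfolding inner_diag_op by (simp, rule sum.swap)
  also have "\<dots> = (\<Sum>j<n'. inner (e' j) (span_proj e n (e' j)))"
    unfolding inner_diag_op by (intro sum.cong) (auto simp: cinner_commute[of "e' _" "e _"])
  also have "\<dots> = real n'" using one[OF _ o(2)] by (simp add: eq)
  finally show ?thesis by simp
qed

lemma orthonormal_extend:
  fixes e :: "nat \<Rightarrow> 'a::chilbert_space"
  assumes o: "orthonormal e n" and x: "span_proj e n x \<noteq> x"
  defines "v \<equiv> (1 / norm (x - span_proj e n x)) *\<^sub>R (x - span_proj e n x)"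
  shows "orthonormal (e(n := v)) (Suc n)" "span_proj (e(n := v)) (Suc n) x = x"
proof -
  let ?P = "span_proj e n"
  define z where "z = x - blinfun_apply ?P x"
  have "norm z > 0" using x by (simp add: z_def)
  have v: "v = (1 / norm z) *\<^sub>R z" by (simp add: v_def z_def)
  have ez: "cinner (e i) z = 0" if "i < n" for i
    using that by (simp add: z_def cinner_diff_right cinner_diag_op[OF o])
  have ev: "cinner (e i) v = 0" "cinner v (e i) = 0" if "i < n" for i
    using ez[OF that] cinner_commute[of v "e i"] by (simp_all add: v cinner_scaleR_right)
  have vv: "cinner v v = 1" using \<open>norm z > 0\<close> by (simp add: cinner_self v)
  show on: "orthonormal (e(n := v)) (Suc n)"
    using o by (auto simp: orthonormal_def less_Suc_eq ev vv)
  have vP: "cinner v (blinfun_apply ?P x) = 0"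
    by (simp add: diag_op_apply cinner_sum_right cinner_scaleC_right ev)
  have "cinner v x = cinner v z" by (simp add: z_def cinner_diff_right vP)
  also have "\<dots> = of_real (norm z)"
  proof -
    have "z = norm z *\<^sub>R v" using \<open>norm z > 0\<close> by (simp add: v)
    then have "cinner v z = of_real (norm z) * cinner v v" by (metis cinner_scaleR_right)
    then show ?thesis by (simp add: vv)
  qed
  finally have vx: "cinner v x *\<^sub>C v = z" using \<open>norm z > 0\<close> by (simp add: scaleC_of_real v)
  have "span_proj (e(n := v)) (Suc n) = ?P + rank_one v"
    by (simp add: diag_op_Suc diag_op_cong[of n "e(n := v)" e])
  then show "span_proj (e(n := v)) (Suc n) x = x"
    by (simp add: blinfun.add_left rank_one_apply vx z_def)
qed

text \<open>The last conjunct says that the new vectors lie in the span of the old family and \<open>Y\<close>: an operator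
  that fixes all of these fixes the new vectors as well.\<close>

lemma gram_schmidt:
  fixes e :: "nat \<Rightarrow> 'a::chilbert_space"
  assumes "finite Y" and "orthonormal e n"
  shows "\<exists>e' n'. n \<le> n' \<and> (\<forall>i<n. e' i = e i) \<and> orthonormal e' n' \<and>
    (\<forall>y\<in>Y. span_proj e' n' y = y) \<and>
    (\<forall>Q\<in>\<B>. (\<forall>i<n. Q (e i) = e i) \<and> (\<forall>y\<in>Y. Q y = y) \<longrightarrow>
       (\<forall>i<n'. Q (e' i) = e' i))"
  using assms(1)
proof (induction Y rule: finite_induct)
  case empty
  then show ?case using assms(2) by auto
next
  case (insert x Y)
  then obtain e' n' where h: "n \<le> n'" "\<And>i. i < n \<Longrightarrow> e' i = e i" "orthonormal e' n'"
    "\<And>y. y \<in> Y \<Longrightarrow> span_proj e' n' y = y"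
    and Q: "\<And>Q i. Q \<in> \<B> \<Longrightarrow> (\<forall>i<n. Q (e i) = e i) \<Longrightarrow> (\<forall>y\<in>Y. Q y = y)
      \<Longrightarrow> i < n' \<Longrightarrow> Q (e' i) = e' i" by blast
  show ?case
  proof (cases "span_proj e' n' x = x")
    case True
    then show ?thesis using h Q by (intro exI[of _ e'] exI[of _ n']) auto
  next
    case False
    define v where "v = (1 / norm (x - span_proj e' n' x)) *\<^sub>R (x - span_proj e' n' x)"
    note ext = orthonormal_extend[OF h(3) False, folded v_def]
    have "span_proj (e'(n' := v)) (Suc n') y = y" if "y \<in> insert x Y" for y
    proof (cases "y = x")
      case f: False
      then show ?thesis using span_proj_mono[OF ext(1), of n' e' y] h(4) that by simp
    qed (simp add: ext(2))
    moreover have "Q ((e'(n' := v)) i) = (e'(n' := v)) i"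
      if q: "Q \<in> \<B>" "\<forall>i<n. Q (e i) = e i" "\<forall>y\<in>insert x Y. Q y = y" "i < Suc n'" for Q i
    proof (cases "i = n'")
      case True
      have "Q (span_proj e' n' x) = span_proj e' n' x"
        by (rule bounded_op_fixes_span[OF q(1), of n' e'])
          (use Q q projection_op_idem[OF span_proj_projection[OF h(3)]] in auto)
      then show ?thesis using True q(3)
        by (simp add: v_def blinfun_linear)
    next
      case False
      then show ?thesis using Q[OF q(1,2), of i] q by auto
    qed
    moreover have "(e'(n' := v)) i = e i" if "i < n" for i using h(1,2) that by simp
    ultimately show ?thesis
      using h(1) ext(1) by (intro exI[of _ "e'(n' := v)"] exI[of _ "Suc n'"]) (auto simp del: fun_upd_apply)
  qed
qed

lemma finite_set_in_span:
  assumes "finite (Y :: 'a::chilbert_space set)"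
  obtains e n where "orthonormal e n" "\<And>y. y \<in> Y \<Longrightarrow> span_proj e n y = y"
  using gram_schmidt[OF assms, of "\<lambda>_. 0" 0] by (auto simp: orthonormal_def)

text \<open>The span of finitely many vectors is not the whole space, so a further vector can be orthonormalized.\<close>

lemma infinite_dimensional_extend:
  fixes e :: "nat \<Rightarrow> 'a::chilbert_space"
  assumes inf: "infinite_dimensional TYPE('a)" and o: "orthonormal e n"
  shows "\<exists>e'. orthonormal e' (n + m) \<and> (\<forall>i<n. e' i = e i)"
proof (induction m)
  case 0
  then show ?case using o by auto
next
  case (Suc m)
  then obtain e' where e': "orthonormal e' (n + m)" "\<forall>i<n. e' i = e i" by blast
  have "complex_vector.span (e' ` {..<n + m}) \<noteq> UNIV"
    using inf unfolding infinite_dimensional_def by blast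
  then obtain x where x: "x \<notin> complex_vector.span (e' ` {..<n + m})" by blast
  have "span_proj e' (n + m) x \<in> complex_vector.span (e' ` {..<n + m})"
    unfolding diag_op_apply
    by (intro complex_vector.span_sum complex_vector.span_scale complex_vector.span_base) auto
  then have "span_proj e' (n + m) x \<noteq> x" using x by metis
  from orthonormal_extend(1)[OF e'(1) this] e'(2) show ?case
    by (intro exI) auto
qed

lemma infinite_dimensional_nontrivial:
  assumes "infinite_dimensional TYPE('a::chilbert_space)"
  shows "\<exists>x::'a. x \<noteq> 0"
proof -
  obtain e :: "nat \<Rightarrow> 'a" where "orthonormal e 1"
    using infinite_dimensional_extend[OF assms, of "\<lambda>_. 0" 0 1] by (auto simp: orthonormal_def)
  then have "norm (e 0) = 1" by (rule orthonormal_norm) simp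
  then show ?thesis by (intro exI[of _ "e 0"]) auto
qed

section \<open>The spectral theorem for finite-dimensional compressions\<close>

text \<open>The matrix of the compression has a complex eigenvalue; self-adjointness makes it real.\<close>

lemma compression_eigenvector:
  fixes e :: "nat \<Rightarrow> 'a::chilbert_space"
  assumes o: "orthonormal e n" and n: "0 < n" and T: "self_adjoint T"
  shows "\<exists>w r. norm w = 1 \<and> span_proj e n w = w \<and>
    span_proj e n (T w) = r *\<^sub>R w"
proof -
  define M where "M = mat n n (\<lambda>(i, j). cinner (e i) (T (e j)))"
  have M: "M \<in> carrier_mat n n" by (simp add: M_def)
  obtain k v where v: "v \<in> carrier_vec n" "v \<noteq> 0\<^sub>v n" "M *\<^sub>v v = k \<cdot>\<^sub>v v"
    using spectrum_non_empty[OF M n] M unfolding spectrum_def eigenvalue_def eigenvector_def by auto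
  have TB: "T \<in> \<B>" using T by (rule self_adjoint_in_bounded_ops)
  define w where "w = (\<Sum>j<n. v $ j *\<^sub>C e j)"
  have ew: "cinner (e i) w = v $ i" if "i < n" for i
  proof -
    have "cinner (e i) w = (\<Sum>j<n. if j = i then v $ i else 0)"
      unfolding w_def cinner_sum_right
      by (rule sum.cong) (use that in \<open>auto simp: cinner_scaleC_right orthonormalD[OF o]\<close>)
    then show ?thesis using that by simp
  qed
  obtain i0 where "i0 < n" "v $ i0 \<noteq> 0"
    using v(1,2) by (metis eq_vecI carrier_vecD index_zero_vec)
  then have "w \<noteq> 0" using ew by force
  have Pw: "span_proj e n w = w"
    unfolding w_def by (rule span_proj_combination[OF o])
  have eTw: "cinner (e i) (T w) = k * v $ i" if "i < n" for i
  proof -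
    have "cinner (e i) (T w) = (\<Sum>j<n. M $$ (i, j) * v $ j)"
      using that by (simp add: w_def blinfun.sum_right bounded_opsD[OF TB] cinner_sum_right cinner_scaleC_right M_def mult.commute)
    also have "\<dots> = (M *\<^sub>v v) $ i"
      using that M v(1) by (simp add: scalar_prod_def lessThan_atLeast0)
    also have "\<dots> = k * v $ i" using that v by simp
    finally show ?thesis .
  qed
  have PTw: "span_proj e n (T w) = k *\<^sub>C w"
  proof -
    have "span_proj e n (T w) = (\<Sum>i<n. (k * v $ i) *\<^sub>C e i)"
      by (simp add: diag_op_apply eTw)
    then show ?thesis by (simp add: w_def scaleC_sum_right scaleC_scaleC)
  qed
  have "k * cinner w w = cinner w (span_proj e n (T w))"
    by (simp add: PTw cinner_scaleC_right)
  also have "\<dots> = cinner w (T w)"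
    by (metis Pw diag_op_self_adjoint self_adjointD_cinner)
  finally have kw: "k * cinner w w = cinner w (T w)" .
  have "cnj (cinner w (T w)) = cinner w (T w)"
    by (metis T cinner_commute self_adjointD_cinner)
  then have "cnj k = k"
    using kw \<open>w \<noteq> 0\<close> unfolding cinner_self
    by (metis complex_cnj_complex_of_real complex_cnj_mult mult_cancel_right of_real_eq_0_iff norm_eq_zero power_eq_0_iff)
  then have k: "k = of_real (Re k)" by (simp add: complex_eq_iff)
  define u where "u = (1 / norm w) *\<^sub>R w"
  show ?thesis
  proof (intro exI conjI)
    show "norm u = 1" using \<open>w \<noteq> 0\<close> by (simp add: u_def)
    show "span_proj e n u = u" by (simp add: u_def blinfun.scaleR_right Pw)
    have "k *\<^sub>C w = Re k *\<^sub>R w" by (metis k scaleC_of_real)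
    then show "span_proj e n (T u) = Re k *\<^sub>R u"
      by (simp add: u_def blinfun.scaleR_right PTw)
  qed
qed

text \<open>By induction on the dimension: an eigenvector \<open>w\<close> of the compression is split off, and its
  orthogonal complement in the subspace is invariant under the compression.\<close>

lemma compression_diagonalize:
  fixes e :: "nat \<Rightarrow> 'a::chilbert_space"
  assumes T: "self_adjoint T" and o: "orthonormal e n"
  shows "\<exists>e' l. orthonormal e' n \<and> span_proj e' n = span_proj e n \<and>
    span_proj e n o\<^sub>L T o\<^sub>L span_proj e n = diag_op e' l n"
  using o
proof (induction n arbitrary: e)
  case 0
  then show ?case by (auto intro!: exI[of _ e] blinfun_eqI)
next
  case (Suc n)
  let ?P = "span_proj e (Suc n)"
  obtain w r where w: "norm w = 1" "blinfun_apply ?P w = w" "blinfun_apply ?P (T w) = r *\<^sub>R w"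
    using compression_eigenvector[OF Suc.prems _ T] by blast
  have ow: "orthonormal (\<lambda>_. w) 1" using w(1) by (simp add: orthonormal_def cinner_self)
  obtain g m where g: "1 \<le> m" "g 0 = w" "orthonormal g m"
    "\<And>i. i < Suc n \<Longrightarrow> span_proj g m (e i) = e i"
    and Q: "\<And>Q i. Q \<in> \<B> \<Longrightarrow> Q w = w \<Longrightarrow> (\<forall>i<Suc n. Q (e i) = e i)
      \<Longrightarrow> i < m \<Longrightarrow> Q (g i) = g i"
    using gram_schmidt[OF _ ow, of "e ` {..<Suc n}"] by auto
  have gP: "blinfun_apply ?P (g i) = g i" if "i < m" for i
    by (rule Q[OF self_adjoint_in_bounded_ops[OF diag_op_self_adjoint] w(2) _ that])
       (simp add: diag_op_basis[OF Suc.prems])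
  have Pg: "?P = span_proj g m" by (rule span_proj_eqI[OF Suc.prems g(3) g(4) gP])
  then have m: "m = Suc n" using orthonormal_dimension_unique[OF Suc.prems g(3)] by simp
  \<comment> \<open>\<open>h\<close> spans the orthogonal complement of \<open>w\<close> in the subspace\<close>
  define h where "h = (\<lambda>i. g (Suc i))"
  have oh: "orthonormal h n" using g(3) unfolding m h_def orthonormal_def by auto
  have Ph: "?P = span_proj h n + rank_one w"
  proof -
    have "span_proj g (Suc n) = rank_one (g 0) + span_proj h n"
      by (simp add: diag_op_def h_def sum.lessThan_Suc_shift del: sum.lessThan_Suc)
    then show ?thesis by (simp add: Pg m g(2))
  qed
  obtain f l where f: "orthonormal f n" "span_proj f n = span_proj h n"
    "span_proj h n o\<^sub>L T o\<^sub>L span_proj h n = diag_op f l n"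
    using Suc.IH[OF oh] by blast
  have hw: "span_proj h n w = 0"
    using w(1,2) by (simp add: Ph blinfun.add_left rank_one_apply cinner_self scaleC_of_real[of 1, simplified])
  have wf: "cinner w (f i) = 0" if "i < n" for i
  proof -
    have "cinner w (f i) = cinner w (span_proj h n (f i))"
      using diag_op_basis[OF f(1) that, of "\<lambda>_. 1"] f(2) by simp
    also have "\<dots> = 0" by (metis hw diag_op_self_adjoint self_adjointD_cinner cinner_zero_left)
    finally show ?thesis .
  qed
  then have fw: "cinner (f i) w = 0" if "i < n" for i
    using that by (metis cinner_commute complex_cnj_zero)
  have of: "orthonormal (f(n := w)) (Suc n)"
    using f(1) w(1) by (auto simp: orthonormal_def less_Suc_eq wf fw cinner_self)
  have Df: "diag_op (f(n := w)) (k(n := s)) (Suc n) = diag_op f k n + s *\<^sub>R rank_one w" for k s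
    by (simp add: diag_op_Suc diag_op_cong[of n "f(n := w)" f "k(n := s)" k])
  have Pf: "span_proj (f(n := w)) (Suc n) = ?P"
    using Df[of "\<lambda>_. 1" 1] by (simp add: Ph f(2) fun_upd_idem)
  have TB: "T \<in> \<B>" using T by (rule self_adjoint_in_bounded_ops)
  have PB: "?P \<in> \<B>" by (rule self_adjoint_in_bounded_ops[OF diag_op_self_adjoint])
  have "?P o\<^sub>L T o\<^sub>L ?P = diag_op (f(n := w)) (l(n := r)) (Suc n)"
  proof (rule blinfun_eqI)
    fix x
    define a where "a = span_proj h n x"
    define b where "b = cinner w x"
    have ha: "span_proj h n a = a"
      by (simp add: a_def projection_op_idem[OF span_proj_projection[OF oh]])
    have wa: "cinner w a = 0"
      by (metis a_def hw diag_op_self_adjoint self_adjointD_cinner cinner_zero_left)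
    have Pa: "blinfun_apply ?P a = a" by (simp add: Ph blinfun.add_left ha rank_one_apply wa)
    have "cinner w (T a) = cinner (blinfun_apply ?P (T w)) a"
      by (metis Pa T diag_op_self_adjoint self_adjointD_cinner)
    also have "\<dots> = 0" unfolding w(3) by (metis cinner_commute cinner_scaleR_right complex_cnj_zero mult_zero_right wa)
    finally have wTa: "cinner w (T a) = 0" .
    have Px: "blinfun_apply ?P x = a + b *\<^sub>C w" by (simp add: Ph blinfun.add_left rank_one_apply a_def b_def)
    have "blinfun_apply ?P (T (blinfun_apply ?P x)) =
        blinfun_apply ?P (T a) + b *\<^sub>C r *\<^sub>R w"
      unfolding Px by (simp add: blinfun.add_right bounded_opsD[OF TB] bounded_opsD[OF PB] w(3))
    also have "blinfun_apply ?P (T a) = span_proj h n (T a)"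
      by (simp add: Ph blinfun.add_left rank_one_apply wTa)
    also have "\<dots> = diag_op f l n x" by (simp add: f(3)[symmetric] a_def)
    finally show "(?P o\<^sub>L T o\<^sub>L ?P) x = diag_op (f(n := w)) (l(n := r)) (Suc n) x"
      by (simp add: Df blinfun_linear rank_one_apply b_def scaleR_scaleC)
  qed
  then show ?case using of Pf by blast
qed

lemma diag_op_coeff:
  fixes e :: "nat \<Rightarrow> 'a::chilbert_space"
  assumes "orthonormal e n" "i < n" "span_proj e n o\<^sub>L T o\<^sub>L span_proj e n = diag_op e l n"
  shows "l i = inner (e i) (T (e i))"
proof -
  have pe: "span_proj e n (e i) = e i" using diag_op_basis[OF assms(1,2), of "\<lambda>_. 1"] by simp
  have "l i = inner (e i) (diag_op e l n (e i))"
    using assms by (simp add: diag_op_basis power2_norm_eq_inner[symmetric] orthonormal_norm)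
  also have "\<dots> = inner (span_proj e n (e i)) (T (e i))"
    unfolding assms(3)[symmetric] by (simp add: pe self_adjointD[OF diag_op_self_adjoint, symmetric])
  finally show ?thesis by (simp add: pe)
qed

text \<open>The form in which the spectral theorem is used: the subspace contains prescribed vectors, and the
  eigenvalues lie between the bounds of the quadratic form of \<open>T\<close>.\<close>

lemma compression_diagonalize_bounds:
  fixes T :: "'a::chilbert_space \<Rightarrow>\<^sub>L 'a"
  assumes T: "self_adjoint T" and Y: "finite Y"
    and ab: "\<And>x. a * (norm x)\<^sup>2 \<le> inner x (T x)" "\<And>x. inner x (T x) \<le> b * (norm x)\<^sup>2"
  obtains e n l where "orthonormal e n" "\<And>y. y \<in> Y \<Longrightarrow> span_proj e n y = y"
    "span_proj e n o\<^sub>L T o\<^sub>L span_proj e n = diag_op e l n" "\<And>i. i < n \<Longrightarrow> l i \<in> {a..b}"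
proof -
  obtain e0 n where e0: "orthonormal e0 n" "\<And>y. y \<in> Y \<Longrightarrow> span_proj e0 n y = y"
    using finite_set_in_span[OF Y] by blast
  obtain e l where e: "orthonormal e n" "span_proj e n = span_proj e0 n"
    "span_proj e0 n o\<^sub>L T o\<^sub>L span_proj e0 n = diag_op e l n"
    using compression_diagonalize[OF T e0(1)] by blast
  show ?thesis
  proof (rule that[OF e(1)])
    show "l i \<in> {a..b}" if "i < n" for i
      using diag_op_coeff[OF e(1) that e(3)[folded e(2)]] ab[of "e i"] orthonormal_norm[OF e(1) that] by simp
  qed (use e e0 in auto)
qed

text \<open>The hypothesis on \<open>Q\<close> expresses that the range of \<open>Z\<close> lies in the span of the finite set \<open>V\<close>.\<close>

lemma psd_finite_rank_diagonal:
  fixes Z :: "'a::chilbert_space \<Rightarrow>\<^sub>L 'a"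
  assumes Z: "psd_op Z" and V: "finite V"
    and range: "\<And>Q x. Q \<in> \<B> \<Longrightarrow> (\<And>v. v \<in> V \<Longrightarrow> Q v = v) \<Longrightarrow>
      Q (Z x) = Z x"
  obtains e n l where "orthonormal e n" "Z = diag_op e l n" "\<And>i. i < n \<Longrightarrow> 0 \<le> l i"
proof -
  note sa = psd_op_self_adjoint[OF Z]
  obtain e n l where e: "orthonormal e n" "\<And>v. v \<in> V \<Longrightarrow> span_proj e n v = v"
    "span_proj e n o\<^sub>L Z o\<^sub>L span_proj e n = diag_op e l n" "\<And>i. i < n \<Longrightarrow> l i \<in> {0..norm Z}"
    by (rule compression_diagonalize_bounds[OF sa V, of 0 "norm Z"])
       (use form_bounds_psd[OF Z] in \<open>auto simp: form_bounds_def\<close>)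
  have Q: "span_proj e n (Z x) = Z x" for x
    by (rule range[OF self_adjoint_in_bounded_ops[OF diag_op_self_adjoint] e(2)])
  have Q': "Z (span_proj e n x) = Z x" for x
    by (metis Q diag_op_self_adjoint sa self_adjointD vector_eq_rdot)
  have "Z = diag_op e l n" unfolding e(3)[symmetric] by (rule blinfun_eqI) (simp add: Q Q')
  then show ?thesis using that e(1,4) by auto
qed

text \<open>Let \<open>g i\<close> be eigenvectors of the compression with eigenvalues \<open>k i\<close>, and let \<open>h i\<close> be an orthonormal
  family orthogonal to all of them, which exists in infinite dimension. In the plane of \<open>g i\<close> and \<open>h i\<close>,
  reflect along the unit vector \<open>w i\<close> with \<open>\<langle>g i, w i\<rangle>\<^sup>2 = (1 - k i) / 2\<close>. The corner of this reflection
  at \<open>g i\<close> is \<open>1 - 2 (1 - k i) / 2 = k i\<close>.\<close>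

lemma contraction_dilation:
  fixes E :: "'a::chilbert_space \<Rightarrow>\<^sub>L 'a"
  assumes inf: "infinite_dimensional TYPE('a)" and E: "self_adjoint E" "norm E \<le> 1" and e: "orthonormal e m"
  obtains R where "projection_op R"
    "span_proj e m o\<^sub>L (id_blinfun - 2 *\<^sub>R R) o\<^sub>L span_proj e m = span_proj e m o\<^sub>L E o\<^sub>L span_proj e m"
proof -
  obtain g k where g: "orthonormal g m" "span_proj g m = span_proj e m"
    "span_proj e m o\<^sub>L E o\<^sub>L span_proj e m = diag_op g k m"
    using compression_diagonalize[OF E(1) e] by blast
  have k: "\<bar>k i\<bar> \<le> 1" if "i < m" for i
  proof -
    have "\<bar>k i\<bar> \<le> norm E * (norm (g i))\<^sup>2"
      using diag_op_coeff[OF g(1) that g(3)[folded g(2)]] inner_blinfun_le[of "g i" E] by simp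
    then show ?thesis using orthonormal_norm[OF g(1) that] E(2) by simp
  qed
  obtain g' where g': "orthonormal g' (m + m)" "\<And>i. i < m \<Longrightarrow> g' i = g i"
    using infinite_dimensional_extend[OF inf g(1), of m] by auto
  define \<alpha> \<beta> where "\<alpha> i = sqrt ((1 - k i) / 2)" and "\<beta> i = sqrt ((1 + k i) / 2)" for i
  define w where "w i = \<alpha> i *\<^sub>R g i - \<beta> i *\<^sub>R g' (m + i)" for i
  have ab: "\<alpha> i * \<alpha> i = (1 - k i) / 2" "\<alpha> i * \<alpha> i + \<beta> i * \<beta> i = 1" if "i < m" for i
    using k[OF that] by (auto simp: \<alpha>_def \<beta>_def abs_le_iff add_divide_distrib[symmetric])
  have gg: "cinner (g i) (g j) = (if i = j then 1 else 0)" "cinner (g' (m + i)) (g' (m + j)) = (if i = j then 1 else 0)"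
    "cinner (g i) (g' (m + j)) = 0" "cinner (g' (m + i)) (g j) = 0" if "i < m" "j < m" for i j
    using orthonormalD[OF g'(1), of i j] orthonormalD[OF g'(1), of "m + i" "m + j"]
      orthonormalD[OF g'(1), of i "m + j"] orthonormalD[OF g'(1), of "m + i" j] g'(2) that by auto
  have w: "orthonormal w m"
    unfolding orthonormal_def
  proof (intro allI impI)
    fix i j assume ij: "i < m" "j < m"
    have "cinner (w i) (w j) = (if i = j then of_real (\<alpha> i * \<alpha> i + \<beta> i * \<beta> i) else 0)"
      by (simp add: w_def cinner_diff_left cinner_diff_right cinner_scaleR_left cinner_scaleR_right gg ij)
    then show "cinner (w i) (w j) = (if i = j then 1 else 0)" using ab ij by simp
  qed
  define R where "R = span_proj w m"
  let ?L = "span_proj g m"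
  have Lw: "blinfun_apply ?L (w i) = \<alpha> i *\<^sub>R g i" if i: "i < m" for i
  proof -
    have "blinfun_apply ?L (g' (m + i)) = 0"
      unfolding diag_op_apply using gg(3) i by (intro sum.neutral) auto
    then show ?thesis
      using diag_op_basis[OF g(1) i, of "\<lambda>_. 1"] by (simp add: w_def blinfun_linear)
  qed
  have "?L o\<^sub>L R o\<^sub>L ?L = (\<Sum>i<m. ?L o\<^sub>L rank_one (w i) o\<^sub>L ?L)"
    by (rule blinfun_eqI) (simp add: R_def diag_op_def[of w] blinfun.sum_left blinfun.sum_right)
  also have "\<dots> = (\<Sum>i<m. ((1 - k i) / 2) *\<^sub>R rank_one (g i))"
  proof (rule sum.cong)
    fix i assume "i \<in> {..<m}"
    then have "?L o\<^sub>L rank_one (w i) o\<^sub>L ?L = rank_one (\<alpha> i *\<^sub>R g i)"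
      by (simp add: rank_one_sandwich[OF diag_op_self_adjoint] Lw)
    also have "\<dots> = (\<alpha> i * \<alpha> i) *\<^sub>R rank_one (g i)"
      by (rule rank_one_scaleR)
    finally show "?L o\<^sub>L rank_one (w i) o\<^sub>L ?L = ((1 - k i) / 2) *\<^sub>R rank_one (g i)"
      using ab(1) \<open>i \<in> _\<close> by simp
  qed simp
  finally have LRL: "?L o\<^sub>L R o\<^sub>L ?L = diag_op g (\<lambda>i. (1 - k i) / 2) m" by (simp add: diag_op_def)
  have "?L o\<^sub>L (id_blinfun - 2 *\<^sub>R R) o\<^sub>L ?L = (?L o\<^sub>L ?L) - 2 *\<^sub>R (?L o\<^sub>L R o\<^sub>L ?L)"
    by (rule blinfun_eqI) (simp add: blinfun_linear)
  also have "\<dots> = diag_op g k m"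
  proof -
    have "(?L o\<^sub>L ?L) - 2 *\<^sub>R (?L o\<^sub>L R o\<^sub>L ?L) = diag_op g (\<lambda>i. 1 * 1 - 2 * ((1 - k i) / 2)) m"
      unfolding LRL diag_op_compose[OF g(1)] diag_op_scaleR
      by (simp only: diag_op_def scaleR_left_diff_distrib sum_subtractf)
    also have "\<dots> = diag_op g k m" by (rule diag_op_cong) (auto simp: field_simps)
    finally show ?thesis .
  qed
  finally show ?thesis
    using that[of R] span_proj_projection[OF w] by (simp add: R_def g(2,3))
qed

section \<open>Polynomials of self-adjoint operators\<close>

lemma power_op_apply:
  fixes T :: "'a::complex_inner \<Rightarrow>\<^sub>L 'a"
  shows "((((o\<^sub>L) T) ^^ i) id_blinfun) x = (blinfun_apply T ^^ i) x"
  by (induction i) auto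

lemma poly_op_degree_le:
  assumes "degree p \<le> n"
  shows "poly_op p T = (\<Sum>i\<le>n. coeff p i *\<^sub>R (((o\<^sub>L) T) ^^ i) id_blinfun)"
  unfolding poly_op_def
  by (rule sum.mono_neutral_left) (use assms in \<open>auto simp: coeff_eq_0\<close>)

lemma poly_op_add: "poly_op (p + q) T = poly_op p T + poly_op q T"
  by (simp add: poly_op_degree_le[of _ "max (degree p) (degree q)"] degree_add_le
      scaleR_left_distrib sum.distrib)

lemma poly_op_smult: "poly_op (Polynomial.smult c p) T = c *\<^sub>R poly_op p T"
  by (simp add: poly_op_degree_le[of "Polynomial.smult c p" "degree p"] poly_op_def[of p] scaleR_sum_right)

lemma poly_op_0 [simp]: "poly_op 0 T = 0"
  by (simp add: poly_op_def)

lemma poly_op_diff: "poly_op (p - q) T = poly_op p T - poly_op q T"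
  using poly_op_add[of "p - q" q T] by (simp add: algebra_simps)

lemma poly_op_pCons: "poly_op (pCons a p) T = a *\<^sub>R id_blinfun + (T o\<^sub>L poly_op p T)"
proof -
  have "poly_op (pCons a p) T = (\<Sum>i\<le>Suc (degree p). coeff (pCons a p) i *\<^sub>R (((o\<^sub>L) T) ^^ i) id_blinfun)"
    by (rule poly_op_degree_le) (rule degree_pCons_le)
  also have "\<dots> = a *\<^sub>R id_blinfun + (\<Sum>i\<le>degree p. coeff p i *\<^sub>R (T o\<^sub>L ((((o\<^sub>L) T) ^^ i) id_blinfun)))"
    by (simp add: sum.atMost_Suc_shift del: sum.atMost_Suc)
  also have "(\<Sum>i\<le>degree p. coeff p i *\<^sub>R (T o\<^sub>L ((((o\<^sub>L) T) ^^ i) id_blinfun))) = T o\<^sub>L poly_op p T"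
    unfolding poly_op_def
    by (rule blinfun_eqI) (simp add: blinfun.sum_left blinfun.sum_right blinfun_linear)
  finally show ?thesis .
qed

lemma poly_op_mult: "poly_op (p * q) T = poly_op p T o\<^sub>L poly_op q T"
proof (induction p)
  case 0
  show ?case by (rule blinfun_eqI) simp
next
  case (pCons a p)
  have "poly_op (pCons a p * q) T = a *\<^sub>R poly_op q T + (T o\<^sub>L (poly_op p T o\<^sub>L poly_op q T))"
    by (simp add: mult_pCons_left poly_op_add poly_op_smult poly_op_pCons pCons.IH)
  then show ?case
    by (intro blinfun_eqI) (simp add: poly_op_pCons blinfun_linear)
qed

lemma poly_op_const: "poly_op [:c:] T = c *\<^sub>R id_blinfun"
  by (rule blinfun_eqI) (simp add: poly_op_pCons blinfun.add_left)

lemma poly_op_ident: "poly_op [:0, 1:] T = T"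
  by (rule blinfun_eqI) (simp add: poly_op_pCons blinfun_linear)

lemma poly_op_commute: "T o\<^sub>L poly_op p T = poly_op p T o\<^sub>L T"
  using poly_op_mult[of p "[:0,1:]" T] poly_op_mult[of "[:0,1:]" p T] by (simp add: poly_op_ident mult.commute)

lemma poly_op_pcompose_square: "poly_op (pcompose p [:0, 0, 1:]) T = poly_op p (T o\<^sub>L T)"
proof (induction p)
  case 0
  show ?case by simp
next
  case (pCons a p)
  have "poly_op [:0, 0, 1:] T = T o\<^sub>L T"
    by (rule blinfun_eqI) (simp add: poly_op_pCons blinfun_linear)
  then show ?case by (simp add: pcompose_pCons poly_op_add poly_op_const poly_op_mult poly_op_pCons pCons.IH
      flip: blinfun_compose_assoc)
qed

lemma poly_op_self_adjoint:
  fixes T :: "'a::chilbert_space \<Rightarrow>\<^sub>L 'a"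
  assumes "self_adjoint T"
  shows "self_adjoint (poly_op p T)"
proof (induction p)
  case (pCons a p)
  have "self_adjoint (T o\<^sub>L poly_op p T)"
    unfolding self_adjoint_iff
  proof (intro conjI allI)
    show "T o\<^sub>L poly_op p T \<in> \<B>" using assms pCons.IH by (simp add: self_adjoint_in_bounded_ops)
    show "inner ((T o\<^sub>L poly_op p T) x) y = inner x ((T o\<^sub>L poly_op p T) y)" for x y
      by (subst (2) poly_op_commute) (simp add: self_adjointD[OF assms] self_adjointD[OF pCons.IH])
  qed
  then show ?case by (simp add: poly_op_pCons)
qed simp

text \<open>If the subspace contains \<open>x, T x, \<dots>, T\<^sup>d x\<close> with \<open>d\<close> the degree of \<open>p\<close>, then the powers of the
  compression and the powers of \<open>T\<close> agree at \<open>x\<close>.\<close>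

lemma poly_op_diagonal:
  fixes T :: "'a::chilbert_space \<Rightarrow>\<^sub>L 'a"
  assumes o: "orthonormal e n" and T: "span_proj e n o\<^sub>L T o\<^sub>L span_proj e n = diag_op e l n"
    and x: "\<And>k. k \<le> degree p \<Longrightarrow> span_proj e n ((blinfun_apply T ^^ k) x) = (blinfun_apply T ^^ k) x"
  shows "poly_op p T x = diag_op e (\<lambda>i. poly p (l i)) n x"
proof -
  have pow: "(blinfun_apply T ^^ k) x = diag_op e (\<lambda>i. l i ^ k) n x" if "k \<le> degree p" for k
    using that
  proof (induction k)
    case 0
    then show ?case using x[of 0] by simp
  next
    case (Suc k)
    have "(blinfun_apply T ^^ Suc k) x = span_proj e n (T (span_proj e n ((blinfun_apply T ^^ k) x)))"
      using x[of k] x[of "Suc k"] Suc.prems by simp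
    also have "\<dots> = diag_op e l n ((blinfun_apply T ^^ k) x)"
      by (simp flip: T)
    also have "\<dots> = (diag_op e l n o\<^sub>L diag_op e (\<lambda>i. l i ^ k) n) x"
      using Suc by simp
    finally show ?case by (simp add: diag_op_compose[OF o])
  qed
  have "poly_op p T x = (\<Sum>k\<le>degree p. coeff p k *\<^sub>R (blinfun_apply T ^^ k) x)"
    by (simp add: poly_op_def blinfun.sum_left blinfun.scaleR_left power_op_apply)
  also have "\<dots> = (\<Sum>k\<le>degree p. coeff p k *\<^sub>R diag_op e (\<lambda>i. l i ^ k) n) x"
    by (simp add: blinfun.sum_left blinfun.scaleR_left pow)
  finally show ?thesis by (simp add: diag_op_sum poly_altdef)
qed

text \<open>The family depends on \<open>x\<close> and \<open>p\<close>. Estimates for \<open>p(T)\<close> that are tested on one vector at a time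
  thereby reduce to estimates for the numbers \<open>p(l i)\<close>.\<close>

lemma poly_op_local_diagonal:
  fixes T :: "'a::chilbert_space \<Rightarrow>\<^sub>L 'a"
  assumes T: "self_adjoint T" "form_bounds T a b"
  obtains e n l where "orthonormal e n" "\<And>i. i < n \<Longrightarrow> l i \<in> {a..b}" "span_proj e n x = x"
    "poly_op p T x = diag_op e (\<lambda>i. poly p (l i)) n x"
proof -
  obtain e n l where o: "orthonormal e n"
    "\<And>y. y \<in> (\<lambda>k. (blinfun_apply T ^^ k) x) ` {..degree p} \<Longrightarrow> span_proj e n y = y"
    "span_proj e n o\<^sub>L T o\<^sub>L span_proj e n = diag_op e l n" "\<And>i. i < n \<Longrightarrow> l i \<in> {a..b}"
    by (rule compression_diagonalize_bounds[OF T(1), of "(\<lambda>k. (blinfun_apply T ^^ k) x) ` {..degree p}" a b])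
       (use T(2) in \<open>auto simp: form_bounds_def\<close>)
  show ?thesis
  proof (rule that[OF o(1,4)])
    show "span_proj e n x = x" by (rule o(2)) (auto intro!: image_eqI[of _ _ 0])
    show "poly_op p T x = diag_op e (\<lambda>i. poly p (l i)) n x"
      by (rule poly_op_diagonal[OF o(1,3)]) (use o(2) in auto)
  qed
qed

lemma norm_poly_op_le:
  fixes T :: "'a::chilbert_space \<Rightarrow>\<^sub>L 'a"
  assumes T: "self_adjoint T" "form_bounds T a b" and p: "\<And>t. t \<in> {a..b} \<Longrightarrow> \<bar>poly p t\<bar> \<le> M" "0 \<le> M"
  shows "norm (poly_op p T) \<le> M"
proof (rule norm_blinfun_bound[OF p(2)])
  fix x
  obtain e n l where o: "orthonormal e n" "\<And>i. i < n \<Longrightarrow> l i \<in> {a..b}"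
    "poly_op p T x = diag_op e (\<lambda>i. poly p (l i)) n x"
    by (rule poly_op_local_diagonal[OF T, of x p]) blast
  show "norm (poly_op p T x) \<le> M * norm x"
    unfolding o(3) by (rule norm_diag_op_le[OF o(1) _ p(2)]) (use p(1) o(2) in blast)
qed

lemma poly_op_form_ge:
  fixes T :: "'a::chilbert_space \<Rightarrow>\<^sub>L 'a"
  assumes T: "self_adjoint T" "form_bounds T a b" and p: "\<And>t. t \<in> {a..b} \<Longrightarrow> m \<le> poly p t"
  shows "m * (norm x)\<^sup>2 \<le> inner x (poly_op p T x)"
proof -
  obtain e n l where o: "orthonormal e n" "\<And>i. i < n \<Longrightarrow> l i \<in> {a..b}" "span_proj e n x = x"
    "poly_op p T x = diag_op e (\<lambda>i. poly p (l i)) n x"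
    by (rule poly_op_local_diagonal[OF T, of x p]) blast
  have "m * (norm x)\<^sup>2 = m * inner x (span_proj e n x)"
    by (simp add: o(3) power2_norm_eq_inner)
  also have "\<dots> = (\<Sum>i<n. m * (cmod (cinner (e i) x))\<^sup>2)"
    unfolding inner_diag_op by (simp add: sum_distrib_left)
  also have "\<dots> \<le> inner x (poly_op p T x)"
    unfolding o(4) inner_diag_op by (intro sum_mono mult_right_mono p o(2)) auto
  finally show ?thesis .
qed

lemma uniform_polynomial_approximation:
  fixes f :: "real \<Rightarrow> real"
  assumes "continuous_on {a..b} f"
  obtains p :: "nat \<Rightarrow> real poly" where "uniform_limit {a..b} (\<lambda>n. poly (p n)) f sequentially"
proof -
  have "\<exists>p. \<forall>x\<in>{a..b}. \<bar>f x - poly p x\<bar> < 1 / Suc n" for n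
  proof -
    obtain g where g: "real_polynomial_function g" "\<And>x. x \<in> {a..b} \<Longrightarrow> \<bar>f x - g x\<bar> < 1 / Suc n"
      using Stone_Weierstrass_real_polynomial_function[OF compact_Icc assms, of "1 / Suc n"] by auto
    obtain c k where "g = (\<lambda>x. \<Sum>i\<le>k. c i * x ^ i)"
      using g(1) unfolding real_polynomial_function_iff_sum by blast
    then have "g = poly (\<Sum>i\<le>k. monom (c i) i)" by (auto simp: poly_sum poly_monom)
    then show ?thesis using g(2) by blast
  qed
  then obtain p where p: "\<And>n x. x \<in> {a..b} \<Longrightarrow> \<bar>f x - poly (p n) x\<bar> < 1 / Suc n" by metis
  have "uniform_limit {a..b} (\<lambda>n. poly (p n)) f sequentially"
  proof (rule uniform_limitI)
    fix e :: real assume "0 < e"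
    then obtain N where N: "1 / Suc N < e" using nat_approx_posE by blast
    show "\<forall>\<^sub>F n in sequentially. \<forall>x\<in>{a..b}. dist (poly (p n) x) (f x) < e"
    proof (rule eventually_sequentiallyI[of N], intro ballI)
      fix n x assume "N \<le> n" "x \<in> {a..b}"
      then have "\<bar>f x - poly (p n) x\<bar> < 1 / Suc n" using p by blast
      also have "\<dots> \<le> 1 / Suc N" using \<open>N \<le> n\<close> by (intro divide_left_mono) auto
      finally show "dist (poly (p n) x) (f x) < e" using N by (simp add: dist_real_def abs_minus_commute)
    qed
  qed
  then show ?thesis by (rule that)
qed

text \<open>Suprema over \<open>K\<close> dominate the norms of polynomials of \<open>T\<close>. This holds both for an interval that bounds
  the quadratic form and for the spectrum, and it is all that the convergence arguments need.\<close>

definition spectral_bound :: "('a::complex_inner \<Rightarrow>\<^sub>L 'a) \<Rightarrow> real set \<Rightarrow> bool" where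
  "spectral_bound T K \<longleftrightarrow> (\<forall>p M. 0 \<le> M \<and> (\<forall>t\<in>K. \<bar>poly p t\<bar> \<le> M) \<longrightarrow> norm (poly_op p T) \<le> M)"

lemma poly_op_close:
  assumes K: "spectral_bound T K" and "0 < e"
    and "\<forall>t\<in>K. dist (poly p t) (f t) < e / 4" "\<forall>t\<in>K. dist (poly q t) (f t) < e / 4"
  shows "norm (poly_op p T - poly_op q T) < e"
proof -
  have "\<bar>poly (p - q) t\<bar> \<le> e / 2" if "t \<in> K" for t
    using assms(3,4)[THEN bspec, OF that] unfolding dist_real_def poly_diff by argo
  then have "norm (poly_op (p - q) T) \<le> e / 2"
    using K \<open>0 < e\<close> unfolding spectral_bound_def by (metis half_gt_zero less_imp_le)
  then show ?thesis using \<open>0 < e\<close> by (simp add: poly_op_diff)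
qed

lemma poly_op_limit_unique:
  fixes T :: "'a::complex_inner \<Rightarrow>\<^sub>L 'a"
  assumes K: "spectral_bound T K" and p: "uniform_limit K (\<lambda>n. poly (p n)) f sequentially"
    and q: "uniform_limit K (\<lambda>n. poly (q n)) f sequentially" "(\<lambda>n. poly_op (q n) T) \<longlonglongrightarrow> S"
  shows "(\<lambda>n. poly_op (p n) T) \<longlonglongrightarrow> S"
proof -
  have "(\<lambda>n. poly_op (p n) T - poly_op (q n) T) \<longlonglongrightarrow> 0"
  proof (rule tendstoI)
    fix e :: real assume "0 < e"
    then have "\<forall>\<^sub>F n in sequentially. \<forall>x\<in>K. dist (poly (p n) x) (f x) < e / 4"
      "\<forall>\<^sub>F n in sequentially. \<forall>x\<in>K. dist (poly (q n) x) (f x) < e / 4"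
      using uniform_limitD[OF p, of "e/4"] uniform_limitD[OF q(1), of "e/4"] by simp_all
    then show "\<forall>\<^sub>F n in sequentially. dist (poly_op (p n) T - poly_op (q n) T) 0 < e"
      by eventually_elim (simp add: poly_op_close[OF K \<open>0 < e\<close>])
  qed
  from tendsto_add[OF this q(2)] show ?thesis by simp
qed

lemma poly_op_convergent:
  fixes T :: "'a::chilbert_space \<Rightarrow>\<^sub>L 'a"
  assumes K: "spectral_bound T K" and p: "uniform_limit K (\<lambda>n. poly (p n)) f sequentially"
  shows "convergent (\<lambda>n. poly_op (p n) T)"
proof -
  have "Cauchy (\<lambda>n. poly_op (p n) T)"
  proof (rule CauchyI)
    fix e :: real assume "0 < e"
    then have "\<forall>\<^sub>F n in sequentially. \<forall>x\<in>K. dist (poly (p n) x) (f x) < e / 4"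
      using uniform_limitD[OF p, of "e/4"] by simp
    then obtain N where "\<forall>x\<in>K. dist (poly (p n) x) (f x) < e / 4" if "n \<ge> N" for n
      unfolding eventually_sequentially by blast
    then have "norm (poly_op (p m) T - poly_op (p n) T) < e" if "m \<ge> N" "n \<ge> N" for m n
      using poly_op_close[OF K \<open>0 < e\<close>] that by blast
    then show "\<exists>M. \<forall>m\<ge>M. \<forall>n\<ge>M. norm (poly_op (p m) T - poly_op (p n) T) < e" by blast
  qed
  then show ?thesis by (simp add: Cauchy_convergent_iff)
qed

lemma spectral_bound_interval:
  fixes T :: "'a::chilbert_space \<Rightarrow>\<^sub>L 'a"
  assumes "self_adjoint T" "form_bounds T a b"
  shows "spectral_bound T {a..b}"
  unfolding spectral_bound_def using norm_poly_op_le[OF assms] by blast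

lemma uniform_limit_poly_mult:
  assumes "uniform_limit {a..b} (\<lambda>n. poly (p n)) f sequentially" "uniform_limit {a..b} (\<lambda>n. poly (q n)) g sequentially"
    and "continuous_on {a..b} f" "continuous_on {a..b} g"
  shows "uniform_limit {a..b} (\<lambda>n. poly (p n * q n :: real poly)) (\<lambda>t. f t * g t) sequentially"
proof -
  have "bounded (f ` {a..b})" "bounded (g ` {a..b})"
    using assms(3,4) by (auto intro!: compact_imp_bounded compact_continuous_image)
  from uniform_lim_mult[OF assms(1,2) this] show ?thesis unfolding poly_mult .
qed

section \<open>Square roots and inverses\<close>

text \<open>The approximants are \<open>p\<^sub>n (S\<^sup>2) = (p\<^sub>n \<circ> t\<^sup>2) (S)\<close>, and \<open>p\<^sub>n (t\<^sup>2)\<close> tends to \<open>t\<close> uniformly on \<open>[0, \<parallel>S\<parallel>]\<close>.\<close>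

lemma sqrt_limit_unique:
  fixes S :: "'a::chilbert_space \<Rightarrow>\<^sub>L 'a"
  assumes S: "psd_op S" and p: "uniform_limit {0..c} (\<lambda>n. poly (p n)) sqrt sequentially" and c: "(norm S)\<^sup>2 \<le> c"
  shows "(\<lambda>n. poly_op (p n) (S o\<^sub>L S)) \<longlonglongrightarrow> S"
proof -
  have "(\<lambda>n. poly_op (pcompose (p n) [:0, 0, 1:]) S) \<longlonglongrightarrow> S"
  proof (rule poly_op_limit_unique[OF spectral_bound_interval[OF psd_op_self_adjoint[OF S] form_bounds_psd[OF S]]])
    show "uniform_limit {0..norm S} (\<lambda>n. poly [:0, 1:]) (\<lambda>t. t) sequentially"
      by (rule uniform_limitI) simp
    show "(\<lambda>n. poly_op [:0, 1:] S) \<longlonglongrightarrow> S" by (simp add: poly_op_ident)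
    show "uniform_limit {0..norm S} (\<lambda>n. poly (pcompose (p n) [:0, 0, 1:])) (\<lambda>t. t) sequentially"
    proof (rule uniform_limitI)
      fix e :: real assume "0 < e"
      from uniform_limitD[OF p this]
      show "\<forall>\<^sub>F n in sequentially. \<forall>x\<in>{0..norm S}. dist (poly (pcompose (p n) [:0, 0, 1:]) x) x < e"
      proof eventually_elim
        case (elim n)
        show ?case
        proof
          fix x assume x: "x \<in> {0..norm S}"
          then have "x\<^sup>2 \<le> (norm S)\<^sup>2" by (intro power_mono) auto
          then have "x\<^sup>2 \<in> {0..c}" using c by simp
          then have "dist (poly (p n) (x\<^sup>2)) (sqrt (x\<^sup>2)) < e" using elim by blast
          then show "dist (poly (pcompose (p n) [:0, 0, 1:]) x) x < e"
            using x by (simp add: poly_pcompose power2_eq_square)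
        qed
      qed
    qed
  qed
  then show ?thesis by (simp add: poly_op_pcompose_square)
qed

text \<open>The norm limit of \<open>p\<^sub>n (A)\<close> for polynomials \<open>p\<^sub>n\<close> that approximate the square root uniformly.\<close>

lemma psd_sqrt_exists:
  fixes A :: "'a::chilbert_space \<Rightarrow>\<^sub>L 'a"
  assumes A: "psd_op A"
  shows "\<exists>S. psd_op S \<and> S o\<^sub>L S = A"
proof -
  note sa = psd_op_self_adjoint[OF A] and fb = form_bounds_psd[OF A]
  have cont: "continuous_on {0..norm A} sqrt" by (intro continuous_intros)
  obtain p where p: "uniform_limit {0..norm A} (\<lambda>n. poly (p n)) sqrt sequentially"
    using uniform_polynomial_approximation[OF cont] by blast
  note sb = spectral_bound_interval[OF sa fb]
  obtain S where S: "(\<lambda>n. poly_op (p n) A) \<longlonglongrightarrow> S"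
    using poly_op_convergent[OF sb p] by (auto simp: convergent_def)
  have "self_adjoint S" by (rule self_adjoint_limit[OF _ S]) (rule poly_op_self_adjoint[OF sa])
  moreover have "0 \<le> inner x (S x)" for x
  proof (rule field_le_epsilon)
    fix e :: real assume "0 < e"
    define d where "d = e / ((norm x)\<^sup>2 + 1)"
    have "0 < d" using \<open>0 < e\<close> by (simp add: d_def add_nonneg_pos)
    have de: "d * (norm x)\<^sup>2 \<le> e"
    proof -
      have "e * N / (N + 1) \<le> e" if "0 \<le> N" for N using that \<open>0 < e\<close> by (simp add: field_simps)
      then show ?thesis by (simp add: d_def)
    qed
    have "\<forall>\<^sub>F n in sequentially. - e \<le> inner x (poly_op (p n) A x)"
      using uniform_limitD[OF p \<open>0 < d\<close>]
    proof eventually_elim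
      case (elim n)
      have "- d \<le> poly (p n) t" if t: "t \<in> {0..norm A}" for t
      proof -
        have "\<bar>poly (p n) t - sqrt t\<bar> < d" using elim t by (auto simp: dist_real_def)
        moreover have "0 \<le> sqrt t" using t by simp
        ultimately show ?thesis by linarith
      qed
      then have "- d * (norm x)\<^sup>2 \<le> inner x (poly_op (p n) A x)"
        by (rule poly_op_form_ge[OF sa fb])
      then show ?case using de by simp
    qed
    moreover have "(\<lambda>n. inner x (poly_op (p n) A x)) \<longlonglongrightarrow> inner x (S x)"
      by (intro tendsto_intros S)
    ultimately have "- e \<le> inner x (S x)"
      by (intro tendsto_lowerbound[of _ _ sequentially]) auto
    then show "0 \<le> inner x (S x) + e" by simp
  qed
  moreover have "S o\<^sub>L S = A"
  proof (rule LIMSEQ_unique)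
    show "(\<lambda>n. poly_op (p n * p n) A) \<longlonglongrightarrow> (S o\<^sub>L S)"
      unfolding poly_op_mult by (rule bounded_bilinear.tendsto[OF bounded_bilinear_blinfun_compose S S])
    show "(\<lambda>n. poly_op (p n * p n) A) \<longlonglongrightarrow> A"
    proof (rule poly_op_limit_unique[OF sb uniform_limit_poly_mult[OF p p cont cont]])
      show "uniform_limit {0..norm A} (\<lambda>n. poly [:0, 1:]) (\<lambda>t. sqrt t * sqrt t) sequentially"
        by (rule uniform_limitI) simp
      show "(\<lambda>n. poly_op [:0, 1:] A) \<longlonglongrightarrow> A" by (simp add: poly_op_ident)
    qed
  qed
  ultimately show ?thesis by (auto simp: psd_op_iff)
qed

text \<open>Both roots are the limit of the same polynomials of their common square.\<close>

lemma psd_sqrt_unique: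
  fixes S R :: "'a::chilbert_space \<Rightarrow>\<^sub>L 'a"
  assumes "psd_op S" "psd_op R" "S o\<^sub>L S = R o\<^sub>L R"
  shows "S = R"
proof -
  define c where "c = max ((norm S)\<^sup>2) ((norm R)\<^sup>2)"
  have cont: "continuous_on {0..c} sqrt" by (intro continuous_intros)
  obtain p where p: "uniform_limit {0..c} (\<lambda>n. poly (p n)) sqrt sequentially"
    using uniform_polynomial_approximation[OF cont] by blast
  have "(\<lambda>n. poly_op (p n) (S o\<^sub>L S)) \<longlonglongrightarrow> S" "(\<lambda>n. poly_op (p n) (R o\<^sub>L R)) \<longlonglongrightarrow> R"
    using assms(1,2) by (auto intro!: sqrt_limit_unique[OF _ p] simp: c_def)
  then show ?thesis unfolding assms(3) by (rule LIMSEQ_unique)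
qed

lemma sqrt_op:
  fixes A :: "'a::chilbert_space \<Rightarrow>\<^sub>L 'a"
  assumes "psd_op A"
  shows "psd_op (sqrt_op A)" "sqrt_op A o\<^sub>L sqrt_op A = A"
proof -
  have "\<exists>!S. psd_op S \<and> S o\<^sub>L S = A"
    using psd_sqrt_exists[OF assms] psd_sqrt_unique by blast
  from theI'[OF this] show "psd_op (sqrt_op A)" "sqrt_op A o\<^sub>L sqrt_op A = A"
    by (auto simp: sqrt_op_def)
qed

lemma is_inverse_op_apply:
  assumes "is_inverse_op T S"
  shows "T (S x) = x" "S (T x) = x"
  using assms unfolding is_inverse_op_def
  by (metis blinfun_apply_blinfun_compose blinfun_apply_id_blinfun)+

lemma inverse_op_eqI: "is_inverse_op T S \<Longrightarrow> inverse_op T = S"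
  unfolding inverse_op_def is_inverse_op_def
  by (rule the_equality) (auto, metis blinfun_compose_assoc blinfun_compose_id)

lemma is_inverse_inverse_op: "invertible_op T \<Longrightarrow> is_inverse_op T (inverse_op T)"
  unfolding invertible_op_def using inverse_op_eqI by metis

lemma inverse_self_adjoint:
  fixes T :: "'a::chilbert_space \<Rightarrow>\<^sub>L 'a"
  assumes T: "self_adjoint T" and S: "is_inverse_op T S"
  shows "self_adjoint S"
  unfolding self_adjoint_iff
proof (intro conjI allI)
  show "S \<in> \<B>" using S by (simp add: is_inverse_op_def)
  have TS: "T (S x) = x" for x
    using is_inverse_op_apply[OF S] by simp_all
  fix x y
  show "inner (S x) y = inner x (S y)"
    by (metis TS T self_adjointD)
qed

lemma invertible_op_compose:
  assumes "invertible_op S" "invertible_op T"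
  shows "invertible_op (S o\<^sub>L T)"
proof -
  obtain S' T' where h: "is_inverse_op S S'" "is_inverse_op T T'" using assms by (auto simp: invertible_op_def)
  have S: "S (S' x) = x" "S' (S x) = x" for x
    using is_inverse_op_apply[OF h(1)] by simp_all
  have T: "T (T' x) = x" "T' (T x) = x" for x
    using is_inverse_op_apply[OF h(2)] by simp_all
  have "is_inverse_op (S o\<^sub>L T) (T' o\<^sub>L S')"
    unfolding is_inverse_op_def using h by (auto simp: is_inverse_op_def S T intro!: blinfun_eqI)
  then show ?thesis using assms by (auto simp: invertible_op_def)
qed

lemma invertible_op_scaleR:
  assumes "invertible_op T" "c \<noteq> 0"
  shows "invertible_op (c *\<^sub>R T)"
proof -
  obtain S where S: "is_inverse_op T S" using assms(1) by (auto simp: invertible_op_def)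
  have a: "T (S x) = x" "S (T x) = x" for x
    using is_inverse_op_apply[OF S] by simp_all
  have "is_inverse_op (c *\<^sub>R T) ((1 / c) *\<^sub>R S)"
    using S assms(2)
    by (auto simp: is_inverse_op_def blinfun_linear a intro!: blinfun_eqI)
  then show ?thesis using assms(1) by (auto simp: invertible_op_def)
qed

lemma invertible_op_square_root:
  assumes "invertible_op (S o\<^sub>L S)" "S \<in> \<B>"
  shows "invertible_op S"
proof -
  obtain R where R: "is_inverse_op (S o\<^sub>L S) R" using assms by (auto simp: invertible_op_def)
  have a: "S (S (R x)) = x"
    "R (S (S x)) = x" for x
    using is_inverse_op_apply[OF R] by simp_all
  have b: "R (S x) = S (R x)" for x
    by (metis a)
  have "is_inverse_op S (S o\<^sub>L R)"
    using assms(2) R by (auto simp: is_inverse_op_def a b intro!: blinfun_eqI)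
  then show ?thesis using assms(2) by (auto simp: invertible_op_def)
qed

text \<open>The inverse is the norm limit of \<open>p\<^sub>n (T)\<close> for polynomials \<open>p\<^sub>n\<close> approximating \<open>1 / t\<close> on an interval
  bounded away from zero.\<close>

lemma invertible_op_coercive:
  fixes T :: "'a::chilbert_space \<Rightarrow>\<^sub>L 'a"
  assumes T: "self_adjoint T" and m: "0 < m" "\<And>x. m * (norm x)\<^sup>2 \<le> inner x (T x)"
  shows "invertible_op T"
proof -
  have fb: "form_bounds T m (norm T)"
    using form_bounds_norm[of T] m(2) by (simp add: form_bounds_def)
  note sb = spectral_bound_interval[OF T fb]
  have cont: "continuous_on {m..norm T} (\<lambda>t. 1 / t)" "continuous_on {m..norm T} (\<lambda>t. t)"
    using m(1) by (auto intro!: continuous_intros)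
  obtain p where p: "uniform_limit {m..norm T} (\<lambda>n. poly (p n)) (\<lambda>t. 1 / t) sequentially"
    using uniform_polynomial_approximation[OF cont(1)] by blast
  obtain S where S: "(\<lambda>n. poly_op (p n) T) \<longlonglongrightarrow> S"
    using poly_op_convergent[OF sb p] by (auto simp: convergent_def)
  have SB: "S \<in> \<B>" by (rule bounded_ops_limit[OF _ S]) (rule self_adjoint_in_bounded_ops[OF poly_op_self_adjoint[OF T]])
  have ident: "uniform_limit {m..norm T} (\<lambda>n. poly [:0, 1:]) (\<lambda>t. t) sequentially"
    by (rule uniform_limitI) simp
  have lim: "(\<lambda>n. poly_op (p n * [:0, 1:]) T) \<longlonglongrightarrow> id_blinfun"
  proof (rule poly_op_limit_unique[OF sb uniform_limit_poly_mult[OF p ident cont]])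
    show "uniform_limit {m..norm T} (\<lambda>n. poly [:1:]) (\<lambda>t. 1 / t * t) sequentially"
      by (rule uniform_limitI) (use m(1) in simp)
    show "(\<lambda>n. poly_op [:1:] T) \<longlonglongrightarrow> id_blinfun" by (simp add: poly_op_const)
  qed
  have "(\<lambda>n. poly_op (p n) T o\<^sub>L T) \<longlonglongrightarrow> (S o\<^sub>L T)" "(\<lambda>n. T o\<^sub>L poly_op (p n) T) \<longlonglongrightarrow> (T o\<^sub>L S)"
    by (intro bounded_bilinear.tendsto[OF bounded_bilinear_blinfun_compose] S tendsto_const)+
  moreover have "poly_op (p n * [:0, 1:]) T = poly_op (p n) T o\<^sub>L T" for n
    by (simp only: poly_op_mult poly_op_ident)
  ultimately have "S o\<^sub>L T = id_blinfun" "T o\<^sub>L S = id_blinfun"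
    using lim by (auto simp: poly_op_commute intro: LIMSEQ_unique)
  then show ?thesis using SB self_adjoint_in_bounded_ops[OF T] by (auto simp: invertible_op_def is_inverse_op_def)
qed

section \<open>The real spectrum and the continuous functional calculus\<close>

lemma real_spectrum_subset:
  fixes T :: "'a::chilbert_space \<Rightarrow>\<^sub>L 'a"
  assumes T: "self_adjoint T" and fb: "form_bounds T a b"
  shows "real_spectrum T \<subseteq> {a..b}"
proof
  fix r assume r: "r \<in> real_spectrum T"
  show "r \<in> {a..b}"
  proof (rule ccontr)
    assume "r \<notin> {a..b}"
    then consider "r < a" | "b < r" by force
    then have "invertible_op (T - r *\<^sub>R id_blinfun)"
    proof cases
      case 1
      show ?thesis
        by (rule invertible_op_coercive[of _ "a - r"])
          (use T 1 fb in \<open>auto simp: form_bounds_def blinfun_linear inner_diff_right power2_norm_eq_inner left_diff_distrib\<close>)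
    next
      case 2
      have "invertible_op (r *\<^sub>R id_blinfun - T)"
        by (rule invertible_op_coercive[of _ "r - b"])
          (use T 2 fb in \<open>auto simp: form_bounds_def blinfun_linear inner_diff_right power2_norm_eq_inner left_diff_distrib\<close>)
      from invertible_op_scaleR[OF this, of "-1"] show ?thesis by simp
    qed
    then show False using r by (simp add: real_spectrum_def)
  qed
qed

lemma poly_op_invertible_pos:
  fixes T :: "'a::chilbert_space \<Rightarrow>\<^sub>L 'a"
  assumes T: "self_adjoint T" and p: "\<And>t. 0 < poly p t"
  shows "invertible_op (poly_op p T)"
proof -
  have "continuous_on {-norm T..norm T} (poly p)" by (intro continuous_intros)
  then obtain t0 where t0: "\<And>t. t \<in> {-norm T..norm T} \<Longrightarrow> poly p t0 \<le> poly p t"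
    using continuous_attains_inf[of "{-norm T..norm T}" "poly p"] by fastforce
  show ?thesis
    by (rule invertible_op_coercive[OF poly_op_self_adjoint[OF T] p[of t0]])
       (rule poly_op_form_ge[OF T form_bounds_norm t0])
qed

text \<open>Real roots are divided out one at a time, each factor being invertible because its root is not in
  the spectrum. A polynomial without real roots has constant sign, and then \<open>p(T)\<close> or its negative is
  coercive.\<close>

lemma poly_op_invertible:
  fixes T :: "'a::chilbert_space \<Rightarrow>\<^sub>L 'a"
  assumes T: "self_adjoint T" and "p \<noteq> 0" and "\<And>t. t \<in> real_spectrum T \<Longrightarrow> poly p t \<noteq> 0"
  shows "invertible_op (poly_op p T)"
  using assms(2,3)
proof (induction "degree p" arbitrary: p rule: less_induct)
  case less
  show ?case
  proof (cases "\<exists>r. poly p r = 0")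
    case True
    then obtain r q where r: "p = [:- r, 1:] * q" by (auto simp: poly_eq_0_iff_dvd)
    have q0: "q \<noteq> 0" using less.prems(1) r by auto
    have "degree p = degree [:- r, 1:] + degree q"
      unfolding r by (rule degree_mult_eq) (use q0 in auto)
    then have "invertible_op (poly_op q T)"
      by (intro less.hyps) (use q0 less.prems(2) r in auto)
    moreover have "invertible_op (T - r *\<^sub>R id_blinfun)"
      using less.prems(2)[of r] r by (auto simp: real_spectrum_def)
    moreover have "poly_op [:- r, 1:] T = T - r *\<^sub>R id_blinfun"
      by (rule blinfun_eqI) (simp add: poly_op_pCons blinfun_linear)
    ultimately show ?thesis unfolding r poly_op_mult by (simp add: invertible_op_compose)
  next
    case False
    consider "\<And>t. 0 < poly p t" | "\<And>t. 0 < poly (- p) t"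
    proof (cases "\<exists>s t. poly p s < 0 \<and> 0 < poly p t")
      case True
      then obtain s t where st: "poly p s < 0" "0 < poly p t" by blast
      then consider "s < t" | "t < s" by (metis less_asym linorder_less_linear)
      then show ?thesis using poly_IVT_pos[of s t p] poly_IVT_neg[of t s p] st False by cases blast+
    next
      case f: False
      then show ?thesis using False that by (metis linorder_less_linear neg_0_less_iff_less poly_minus)
    qed
    then show ?thesis
    proof cases
      case 1
      then show ?thesis by (rule poly_op_invertible_pos[OF T])
    next
      case 2
      have "poly_op p T = (-1) *\<^sub>R poly_op (- p) T"
        using poly_op_smult[of "-1" "-p" T] by simp
      moreover have "invertible_op ((-1) *\<^sub>R poly_op (- p) T)"
        by (rule invertible_op_scaleR[OF poly_op_invertible_pos[OF T 2]]) simp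
      ultimately show ?thesis by simp
    qed
  qed
qed

text \<open>If \<open>\<parallel>S\<parallel>\<^sup>2 - S\<^sup>2\<close> had a bounded inverse, then \<open>\<parallel>S x\<parallel>\<^sup>2\<close> would stay below \<open>\<parallel>S\<parallel>\<^sup>2 \<parallel>x\<parallel>\<^sup>2\<close> by a fixed
  proportion of \<open>\<parallel>x\<parallel>\<^sup>2\<close>.\<close>

lemma norm_square_not_invertible:
  fixes S :: "'a::chilbert_space \<Rightarrow>\<^sub>L 'a"
  assumes S: "self_adjoint S" and pos: "0 < norm S"
  shows "\<not> invertible_op ((norm S)\<^sup>2 *\<^sub>R id_blinfun - (S o\<^sub>L S))"
proof
  define m where "m = norm S"
  define W where "W = m\<^sup>2 *\<^sub>R id_blinfun - (S o\<^sub>L S)"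
  assume "invertible_op ((norm S)\<^sup>2 *\<^sub>R id_blinfun - (S o\<^sub>L S))"
  then obtain R where "is_inverse_op W R" by (auto simp: invertible_op_def W_def m_def)
  then have RW: "R (W x) = x" for x
    by (rule is_inverse_op_apply(2))
  define K where "K = norm R + 1"
  have "K > 0" by (simp add: K_def add_nonneg_pos)
  have "m > 0" using pos by (simp add: m_def)
  have W: "(norm (W x))\<^sup>2 \<le> m\<^sup>2 * (m\<^sup>2 * (norm x)\<^sup>2 - (norm (S x))\<^sup>2)" for x
  proof -
    have "(norm (W x))\<^sup>2 = m\<^sup>2 * m\<^sup>2 * (norm x)\<^sup>2 - 2 * m\<^sup>2 * (norm (S x))\<^sup>2
        + (norm (S (S x)))\<^sup>2"
      by (simp add: W_def blinfun_linear power2_norm_eq_inner inner_diff_left inner_diff_right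
          self_adjointD[OF S] inner_commute algebra_simps)
    moreover have "(norm (S (S x)))\<^sup>2 \<le> m\<^sup>2 * (norm (S x))\<^sup>2"
      unfolding m_def power_mult_distrib[symmetric] by (intro power_mono norm_blinfun) simp
    ultimately show ?thesis by (simp add: algebra_simps)
  qed
  define c where "c = 1 / (K\<^sup>2 * m\<^sup>2)"
  have "c > 0" using \<open>K > 0\<close> \<open>m > 0\<close> by (simp add: c_def)
  have Sx: "(norm (S x))\<^sup>2 \<le> (m\<^sup>2 - c) * (norm x)\<^sup>2" for x
  proof -
    have "norm x \<le> norm R * norm (W x)" using norm_blinfun[of R "W x"] by (simp add: RW)
    also have "\<dots> \<le> K * norm (W x)" by (simp add: K_def mult_right_mono)
    finally have "(norm x)\<^sup>2 \<le> K\<^sup>2 * (norm (W x))\<^sup>2"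
      unfolding power_mult_distrib[symmetric] by (intro power_mono) auto
    also have "\<dots> \<le> K\<^sup>2 * (m\<^sup>2 * (m\<^sup>2 * (norm x)\<^sup>2 - (norm (S x))\<^sup>2))"
      by (intro mult_left_mono W) simp
    finally have "c * (norm x)\<^sup>2 \<le> m\<^sup>2 * (norm x)\<^sup>2 - (norm (S x))\<^sup>2"
      using \<open>K > 0\<close> \<open>m > 0\<close> by (simp add: c_def field_simps)
    then show ?thesis by (simp add: algebra_simps)
  qed
  show False
  proof (cases "m\<^sup>2 - c \<ge> 0")
    case True
    have "norm S \<le> sqrt (m\<^sup>2 - c)"
    proof (rule norm_blinfun_bound)
      show "norm (S x) \<le> sqrt (m\<^sup>2 - c) * norm x" for x
        using real_le_rsqrt[OF Sx[of x]] by (simp add: real_sqrt_mult)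
    qed (use True in simp)
    then have "m\<^sup>2 \<le> (sqrt (m\<^sup>2 - c))\<^sup>2"
      unfolding m_def[symmetric] using \<open>m > 0\<close> by (intro power_mono) auto
    then have "m\<^sup>2 \<le> m\<^sup>2 - c" using True by simp
    then show False using \<open>c > 0\<close> by simp
  next
    case False
    have "norm (S x) \<le> 0 * norm x" for x
    proof -
      have "(m\<^sup>2 - c) * (norm x)\<^sup>2 \<le> 0" using False by (simp add: mult_nonpos_nonneg)
      then have "(norm (S x))\<^sup>2 \<le> 0" using Sx[of x] by linarith
      then show ?thesis by simp
    qed
    then have "norm S \<le> 0" by (intro norm_blinfun_bound) auto
    then show False using pos by simp
  qed
qed

text \<open>Over an empty spectrum every nonzero polynomial of \<open>T\<close> would be invertible, in particular
  \<open>\<parallel>T\<parallel>\<^sup>2 - T\<^sup>2\<close> if \<open>T \<noteq> 0\<close>.\<close>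

lemma real_spectrum_nonempty:
  fixes T :: "'a::chilbert_space \<Rightarrow>\<^sub>L 'a"
  assumes T: "self_adjoint T" and nontriv: "\<exists>x::'a. x \<noteq> 0"
  shows "real_spectrum T \<noteq> {}"
proof
  assume empty: "real_spectrum T = {}"
  show False
  proof (cases "T = 0")
    case True
    have "\<not> invertible_op (0 :: 'a \<Rightarrow>\<^sub>L 'a)"
    proof
      assume "invertible_op (0 :: 'a \<Rightarrow>\<^sub>L 'a)"
      then obtain S :: "'a \<Rightarrow>\<^sub>L 'a" where "0 o\<^sub>L S = id_blinfun" by (auto simp: invertible_op_def is_inverse_op_def)
      then have "x = 0" for x :: 'a
        by (metis blinfun.zero_left blinfun_apply_blinfun_compose blinfun_apply_id_blinfun id_apply)
      then show False using nontriv by blast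
    qed
    then have "0 \<in> real_spectrum T" using True by (simp add: real_spectrum_def)
    then show False using empty by simp
  next
    case False
    have "poly_op [:(norm T)\<^sup>2, 0, -1:] T = (norm T)\<^sup>2 *\<^sub>R id_blinfun - (T o\<^sub>L T)"
      by (rule blinfun_eqI) (simp add: poly_op_pCons blinfun_linear blinfun.minus_right blinfun.minus_left)
    moreover have "invertible_op (poly_op [:(norm T)\<^sup>2, 0, -1:] T)"
      by (rule poly_op_invertible[OF T]) (auto simp: empty)
    ultimately show False using norm_square_not_invertible[OF T] False by simp
  qed
qed

text \<open>If \<open>\<parallel>p(T)\<parallel>\<close> exceeded \<open>|p|\<close> on the whole spectrum, the polynomial \<open>\<parallel>p(T)\<parallel>\<^sup>2 - p\<^sup>2\<close> would have no root
  there, and its value at \<open>T\<close> would be invertible, which \<open>norm_square_not_invertible\<close> excludes.\<close>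

lemma spectral_bound_real_spectrum:
  fixes T :: "'a::chilbert_space \<Rightarrow>\<^sub>L 'a"
  assumes T: "self_adjoint T"
  shows "spectral_bound T (real_spectrum T)"
  unfolding spectral_bound_def
proof (intro allI impI, elim conjE, rule ccontr)
  fix p M assume M: "0 \<le> M" "\<forall>t\<in>real_spectrum T. \<bar>poly p t\<bar> \<le> M"
  define S where "S = poly_op p T"
  assume "\<not> norm (poly_op p T) \<le> M"
  then have SM: "M < norm S" by (simp add: S_def)
  have sa: "self_adjoint S" unfolding S_def by (rule poly_op_self_adjoint[OF T])
  define q where "q = [:(norm S)\<^sup>2:] - p * p"
  have q: "poly q t \<noteq> 0" if "t \<in> real_spectrum T" for t
  proof -
    have "(poly p t)\<^sup>2 \<le> M\<^sup>2" using M that power_mono[of "\<bar>poly p t\<bar>" M 2] by auto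
    also have "\<dots> < (norm S)\<^sup>2" using SM M(1) by (intro power_strict_mono) auto
    finally show ?thesis by (simp add: q_def power2_eq_square)
  qed
  have "\<exists>x::'a. x \<noteq> 0"
  proof (rule ccontr)
    assume "\<nexists>x::'a. x \<noteq> 0"
    then have "S = 0" by (intro blinfun_eqI) auto
    then show False using SM M(1) by simp
  qed
  then have "q \<noteq> 0" using real_spectrum_nonempty[OF T] q by fastforce
  then have "invertible_op (poly_op q T)" using poly_op_invertible[OF T] q by blast
  then have "invertible_op ((norm S)\<^sup>2 *\<^sub>R id_blinfun - (S o\<^sub>L S))"
    by (simp add: q_def poly_op_diff poly_op_const poly_op_mult S_def)
  moreover have "0 < norm S" using SM M(1) by linarith
  ultimately show False using norm_square_not_invertible[OF sa] by blast
qed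

text \<open>One approximating sequence on an interval decides the value of \<open>fun_op\<close>: on the spectrum, any two
  approximating sequences have the same limit.\<close>

lemma fun_op_eqI:
  fixes T :: "'a::chilbert_space \<Rightarrow>\<^sub>L 'a"
  assumes T: "self_adjoint T" "form_bounds T a b"
    and r: "uniform_limit {a..b} (\<lambda>n. poly (r n)) f sequentially" "(\<lambda>n. poly_op (r n) T) \<longlonglongrightarrow> S"
  shows "fun_op f T = S"
proof -
  have r': "uniform_limit (real_spectrum T) (\<lambda>n. poly (r n)) f sequentially"
    by (rule uniform_limit_on_subset[OF r(1) real_spectrum_subset[OF T]])
  show ?thesis
    unfolding fun_op_def
  proof (rule the_equality)
    show "\<forall>p. uniform_limit (real_spectrum T) (\<lambda>n. poly (p n)) f sequentially \<longrightarrow> (\<lambda>n. poly_op (p n) T) \<longlonglongrightarrow> S"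
      using poly_op_limit_unique[OF spectral_bound_real_spectrum[OF T(1)] _ r' r(2)] by blast
    show "S' = S" if "\<forall>p. uniform_limit (real_spectrum T) (\<lambda>n. poly (p n)) f sequentially \<longrightarrow> (\<lambda>n. poly_op (p n) T) \<longlonglongrightarrow> S'" for S'
      using that r' r(2) LIMSEQ_unique by blast
  qed
qed

section \<open>Matrices as finite-rank operators\<close>

lemma mat_adjoint_carrier: "X \<in> carrier_mat n n \<Longrightarrow> mat_adjoint X \<in> carrier_mat n n"
  by (simp add: mat_adjoint_def mat_of_rows_def)

lemma mat_adjoint_index:
  fixes X :: "complex mat"
  assumes "X \<in> carrier_mat n n" "i < n" "j < n"
  shows "mat_adjoint X $$ (i, j) = cnj (X $$ (j, i))"
  using assms by (simp add: mat_adjoint_def mat_of_rows_def)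

lemma psd_mat_iff:
  "psd_mat n X \<longleftrightarrow> X \<in> carrier_mat n n \<and> (\<forall>i<n. \<forall>j<n. X $$ (i, j) = cnj (X $$ (j, i))) \<and>
    (\<forall>v. 0 \<le> Re (\<Sum>i<n. \<Sum>j<n. cnj (v i) * X $$ (i, j) * v j))"
proof (cases "X \<in> carrier_mat n n")
  case X: True
  have adj: "mat_adjoint X = X \<longleftrightarrow> (\<forall>i<n. \<forall>j<n. X $$ (i, j) = cnj (X $$ (j, i)))"
  proof
    assume "mat_adjoint X = X"
    then show "\<forall>i<n. \<forall>j<n. X $$ (i, j) = cnj (X $$ (j, i))" using mat_adjoint_index[OF X] by metis
  next
    assume h: "\<forall>i<n. \<forall>j<n. X $$ (i, j) = cnj (X $$ (j, i))"
    show "mat_adjoint X = X"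
    proof (rule eq_matI)
      fix i j assume "i < dim_row X" "j < dim_col X"
      then have "i < n" "j < n" using X by auto
      then show "mat_adjoint X $$ (i, j) = X $$ (i, j)" using h mat_adjoint_index[OF X] by metis
    qed (use X mat_adjoint_carrier[OF X] in auto)
  qed
  have q: "(X *\<^sub>v v) \<bullet>c v = (\<Sum>i<n. \<Sum>j<n. cnj (v $ i) * X $$ (i, j) * v $ j)" if "v \<in> carrier_vec n" for v
    using X that by (simp add: scalar_prod_def lessThan_atLeast0 sum_distrib_left sum_distrib_right mult_ac)
  have "(\<forall>v\<in>carrier_vec n. 0 \<le> Re ((X *\<^sub>v v) \<bullet>c v)) \<longleftrightarrow>
      (\<forall>v. 0 \<le> Re (\<Sum>i<n. \<Sum>j<n. cnj (v i) * X $$ (i, j) * v j))"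
  proof (intro iffI allI ballI)
    fix v :: "nat \<Rightarrow> complex" assume h: "\<forall>v\<in>carrier_vec n. 0 \<le> Re ((X *\<^sub>v v) \<bullet>c v)"
    then have "0 \<le> Re ((X *\<^sub>v vec n v) \<bullet>c vec n v)" by simp
    then show "0 \<le> Re (\<Sum>i<n. \<Sum>j<n. cnj (v i) * X $$ (i, j) * v j)" by (simp add: q)
  qed (use q in simp)
  then show ?thesis unfolding psd_mat_def adj using X by simp
qed (simp add: psd_mat_def)

lemma pd_mat_imp_psd_mat: "pd_mat n X \<Longrightarrow> psd_mat n X"
  unfolding pd_mat_def psd_mat_def
proof (elim conjE, intro conjI ballI)
  fix v :: "complex Matrix.vec"
  assume X: "X \<in> carrier_mat n n" and h: "\<forall>v\<in>carrier_vec n. v \<noteq> 0\<^sub>v n \<longrightarrow> 0 < Re ((X *\<^sub>v v) \<bullet>c v)" and v: "v \<in> carrier_vec n"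
  show "0 \<le> Re ((X *\<^sub>v v) \<bullet>c v)"
  proof (cases "v = 0\<^sub>v n")
    case True
    then show ?thesis using X by simp
  qed (use h v in \<open>simp add: less_imp_le\<close>)
qed

text \<open>For orthonormal \<open>g\<close>, this is \<open>X\<close> acting on the span of \<open>g\<close>, extended by zero on the orthogonal
  complement.\<close>

definition mat_op :: "(nat \<Rightarrow> 'a::complex_inner) \<Rightarrow> nat \<Rightarrow> complex mat \<Rightarrow> 'a \<Rightarrow>\<^sub>L 'a" where
  "mat_op g n X = Blinfun (\<lambda>x. \<Sum>i<n. \<Sum>j<n. (X $$ (i, j) * cinner (g j) x) *\<^sub>C g i)"

lemma mat_op_apply: "mat_op g n X x = (\<Sum>i<n. \<Sum>j<n. (X $$ (i, j) * cinner (g j) x) *\<^sub>C g i)"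
proof -
  have "bounded_linear (\<lambda>x. (c * cinner a x) *\<^sub>C b)" for c and a b :: 'a
  proof (rule bounded_linear_intro)
    show "(c * cinner a (x + y)) *\<^sub>C b = (c * cinner a x) *\<^sub>C b + (c * cinner a y) *\<^sub>C b" for x y
      by (simp add: cinner_add_right distrib_left scaleC_add_left)
    show "(c * cinner a (r *\<^sub>R x)) *\<^sub>C b = r *\<^sub>R (c * cinner a x) *\<^sub>C b" for r x
    proof -
      have "(c * cinner a (r *\<^sub>R x)) *\<^sub>C b = (of_real r * (c * cinner a x)) *\<^sub>C b"
        by (simp add: cinner_scaleR_right mult_ac)
      then show ?thesis by (simp only: scaleC_scaleC[symmetric] scaleC_of_real)
    qed
    show "norm ((c * cinner a x) *\<^sub>C b) \<le> norm x * (cmod c * norm a * norm b)" for x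
      using mult_left_mono[OF mult_right_mono[OF cmod_cinner_le[of a x] norm_ge_zero[of b]] norm_ge_zero[of c]]
      by (simp add: norm_scaleC norm_mult mult_ac)
  qed
  then have "bounded_linear (\<lambda>x. \<Sum>i<n. \<Sum>j<n. (X $$ (i, j) * cinner (g j) x) *\<^sub>C g i)"
    by (intro bounded_linear_sum)
  then show ?thesis by (simp add: mat_op_def bounded_linear_Blinfun_apply)
qed

lemma cinner_mat_op: "cinner x (mat_op g n X y) =
    (\<Sum>i<n. \<Sum>j<n. X $$ (i, j) * cinner (g j) y * cinner x (g i))"
  by (simp add: mat_op_apply cinner_sum_right cinner_scaleC_right)

lemma mat_op_entry:
  assumes "orthonormal g n" "i < n" "j < n"
  shows "cinner (g i) (mat_op g n X (g j)) = X $$ (i, j)"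
proof -
  have "cinner (g i) (mat_op g n X (g j)) = (\<Sum>k<n. \<Sum>l<n. if k = i \<and> l = j then X $$ (i, j) else 0)"
    unfolding cinner_mat_op by (intro sum.cong) (use assms in \<open>auto simp: orthonormalD\<close>)
  also have "\<dots> = (\<Sum>k<n. if k = i then X $$ (i, j) else 0)"
    by (intro sum.cong) (use assms in auto)
  finally show ?thesis using assms by simp
qed

lemma mat_op_psd:
  fixes g :: "nat \<Rightarrow> 'a::chilbert_space"
  assumes X: "psd_mat n X"
  shows "psd_op (mat_op g n X)"
proof -
  have herm: "cnj (X $$ (i, j)) = X $$ (j, i)" if "i < n" "j < n" for i j
    using X that unfolding psd_mat_iff by metis
  have "mat_op g n X \<in> \<B>"
    by (simp add: bounded_ops_def mat_op_apply cinner_scaleC_right scaleC_sum_right scaleC_scaleC mult_ac)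
  moreover have "inner (mat_op g n X x) y = inner x (mat_op g n X y)" for x y
  proof -
    have "cnj (cinner y (mat_op g n X x)) = (\<Sum>i<n. \<Sum>j<n. X $$ (j, i) * cinner x (g j) * cinner (g i) y)"
      unfolding cinner_mat_op cnj_sum
      by (intro sum.cong refl) (simp add: herm cinner_commute[of x] cinner_commute[of "g _" y])
    also have "\<dots> = cinner x (mat_op g n X y)"
      unfolding cinner_mat_op by (subst sum.swap) (simp add: mult_ac)
    finally have "cinner (mat_op g n X x) y = cinner x (mat_op g n X y)"
      by (metis cinner_commute)
    then show ?thesis by (simp add: inner_eq_Re_cinner)
  qed
  moreover have "0 \<le> inner x (mat_op g n X x)" for x
  proof -
    have "cinner x (mat_op g n X x) =
        (\<Sum>i<n. \<Sum>j<n. cnj (cinner (g i) x) * X $$ (i, j) * cinner (g j) x)"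
      unfolding cinner_mat_op by (intro sum.cong refl) (simp add: cinner_commute[of x] mult_ac)
    moreover have "0 \<le> Re (\<Sum>i<n. \<Sum>j<n. cnj (v i) * X $$ (i, j) * v j)" for v
      using X unfolding psd_mat_iff by blast
    ultimately show ?thesis unfolding inner_eq_Re_cinner by simp
  qed
  ultimately show ?thesis by (simp add: psd_op_iff self_adjoint_iff)
qed

lemma mat_op_combination:
  assumes "X \<in> carrier_mat n n" "Y \<in> carrier_mat n n"
  shows "mat_op g n (complex_of_real a \<cdot>\<^sub>m X + complex_of_real b \<cdot>\<^sub>m Y) = a *\<^sub>R mat_op g n X + b *\<^sub>R mat_op g n Y"
proof (rule blinfun_eqI)
  fix x
  have "(\<Sum>i<n. \<Sum>j<n. ((complex_of_real a \<cdot>\<^sub>m X + complex_of_real b \<cdot>\<^sub>m Y) $$ (i, j) * cinner (g j) x) *\<^sub>C g i) =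
      (\<Sum>i<n. \<Sum>j<n. a *\<^sub>R (X $$ (i, j) * cinner (g j) x) *\<^sub>C g i + b *\<^sub>R (Y $$ (i, j) * cinner (g j) x) *\<^sub>C g i)"
    by (intro sum.cong refl)
       (use assms in \<open>simp add: distrib_right scaleC_add_left mult.assoc scaleC_of_real_mult\<close>)
  then show "mat_op g n (complex_of_real a \<cdot>\<^sub>m X + complex_of_real b \<cdot>\<^sub>m Y) x =
      (a *\<^sub>R mat_op g n X + b *\<^sub>R mat_op g n Y) x"
    by (simp add: mat_op_apply blinfun_linear sum.distrib scaleR_sum_right)
qed

lemma unitary_conjugate_index:
  assumes "unitary_mat n U" "i < n" "j < n"
  shows "(U * mat_diag n (\<lambda>i. complex_of_real (d i)) * mat_adjoint U) $$ (i, j) =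
    (\<Sum>k<n. U $$ (i, k) * of_real (d k) * cnj (U $$ (j, k)))"
proof -
  have U: "U \<in> carrier_mat n n" using assms(1) by (simp add: unitary_mat_def)
  then show ?thesis using assms mat_adjoint_carrier[OF U]
    by (simp add: mat_diag_mult_right[OF U] scalar_prod_def lessThan_atLeast0 mat_adjoint_index[OF U])
qed

text \<open>The columns of \<open>U\<close> are the coordinates of a second orthonormal family \<open>e\<close> with the same span, and
  conjugation of a diagonal matrix by \<open>U\<close> becomes an operator that is diagonal in \<open>e\<close>.\<close>

lemma unitary_frame:
  fixes g :: "nat \<Rightarrow> 'a::chilbert_space"
  assumes U: "unitary_mat n U" and g: "orthonormal g n"
  defines "e \<equiv> \<lambda>k. \<Sum>i<n. U $$ (i, k) *\<^sub>C g i"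
  shows "orthonormal e n"
    and "mat_op g n (U * mat_diag n (\<lambda>i. complex_of_real (d i)) * mat_adjoint U) = diag_op e d n"
    and "span_proj e n = span_proj g n"
proof -
  have Uc: "U \<in> carrier_mat n n" using U by (simp add: unitary_mat_def)
  show "orthonormal e n"
    unfolding orthonormal_def
  proof (intro allI impI)
    fix k l assume kl: "k < n" "l < n"
    have gsum: "cinner (\<Sum>i<n. c i *\<^sub>C g i) (\<Sum>j<n. d j *\<^sub>C g j) = (\<Sum>i<n. cnj (c i) * d i)" for c d
    proof -
      have "cinner (\<Sum>i<n. c i *\<^sub>C g i) (\<Sum>j<n. d j *\<^sub>C g j) = (\<Sum>i<n. \<Sum>j<n. if j = i then cnj (c i) * d i else 0)"
        unfolding cinner_sum_left cinner_sum_right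
        by (intro sum.cong refl) (auto simp: cinner_scaleC_left cinner_scaleC_right orthonormalD[OF g])
      then show ?thesis by simp
    qed
    have "cinner (e k) (e l) = (\<Sum>i<n. cnj (U $$ (i, k)) * U $$ (i, l))" unfolding e_def by (rule gsum)
    also have "\<dots> = (mat_adjoint U * U) $$ (k, l)"
      using kl Uc mat_adjoint_carrier[OF Uc] by (simp add: scalar_prod_def lessThan_atLeast0 mat_adjoint_index[OF Uc])
    also have "\<dots> = (if k = l then 1 else 0)" using U kl by (simp add: unitary_mat_def)
    finally show "cinner (e k) (e l) = (if k = l then 1 else 0)" .
  qed
  have D: "mat_op g n (U * mat_diag n (\<lambda>i. complex_of_real (d i)) * mat_adjoint U) = diag_op e d n" for d
  proof (rule blinfun_eqI)
    fix x
    have ex: "cinner (e k) x = (\<Sum>j<n. cnj (U $$ (j, k)) * cinner (g j) x)" for k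
      by (simp add: e_def cinner_sum_left cinner_scaleC_left)
    have "diag_op e d n x =
        (\<Sum>k<n. \<Sum>i<n. \<Sum>j<n. (U $$ (i, k) * of_real (d k) * cnj (U $$ (j, k)) * cinner (g j) x) *\<^sub>C g i)"
      unfolding diag_op_apply ex
      by (simp add: e_def scaleC_sum_right scaleC_scaleC sum_distrib_left sum_distrib_right
          complex_vector.scale_sum_left mult_ac)
    also have "\<dots> = (\<Sum>i<n. \<Sum>j<n. \<Sum>k<n. (U $$ (i, k) * of_real (d k) * cnj (U $$ (j, k)) * cinner (g j) x) *\<^sub>C g i)"
      by (subst sum.swap, rule sum.cong[OF refl], rule sum.swap)
    also have "\<dots> = (mat_op g n (U * mat_diag n (\<lambda>i. complex_of_real (d i)) * mat_adjoint U)) x"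
      unfolding mat_op_apply
      by (intro sum.cong refl) (simp add: unitary_conjugate_index[OF U] sum_distrib_right complex_vector.scale_sum_left)
    finally show "(mat_op g n (U * mat_diag n (\<lambda>i. complex_of_real (d i)) * mat_adjoint U)) x =
        diag_op e d n x" ..
  qed
  show "mat_op g n (U * mat_diag n (\<lambda>i. complex_of_real (d i)) * mat_adjoint U) = diag_op e d n" by (rule D)
  have "U * mat_diag n (\<lambda>i. complex_of_real 1) * mat_adjoint U = 1\<^sub>m n"
    using U Uc by (simp add: unitary_mat_def)
  then have "span_proj e n = mat_op g n (1\<^sub>m n)" using D[of "\<lambda>_. 1"] by simp
  also have "\<dots> = span_proj g n"
  proof (rule blinfun_eqI)
    fix x
    have "(\<Sum>j<n. ((1\<^sub>m n :: complex mat) $$ (i, j) * cinner (g j) x) *\<^sub>C g i) = cinner (g i) x *\<^sub>C g i" if "i < n" for i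
    proof -
      have "(\<Sum>j<n. ((1\<^sub>m n :: complex mat) $$ (i, j) * cinner (g j) x) *\<^sub>C g i) =
          (\<Sum>j<n. if j = i then cinner (g i) x *\<^sub>C g i else 0)"
        by (intro sum.cong refl) (use that in auto)
      then show ?thesis using that by simp
    qed
    then show "mat_op g n (1\<^sub>m n) x = span_proj g n x"
      by (simp add: mat_op_apply diag_op_apply)
  qed
  finally show "span_proj e n = span_proj g n" .
qed

lemma psd_mat_diagonalize:
  fixes g :: "nat \<Rightarrow> 'a::chilbert_space"
  assumes X: "psd_mat n X" and g: "orthonormal g n"
  obtains U d where "unitary_mat n U" "X = U * mat_diag n (\<lambda>i. complex_of_real (d i)) * mat_adjoint U"
proof -
  have Xc: "X \<in> carrier_mat n n" using X by (simp add: psd_mat_def)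
  obtain e d where e: "orthonormal e n" "span_proj e n = span_proj g n"
    "span_proj g n o\<^sub>L mat_op g n X o\<^sub>L span_proj g n = diag_op e d n"
    using compression_diagonalize[OF psd_op_self_adjoint[OF mat_op_psd[OF X]] g] by blast
  define U where "U = Matrix.mat n n (\<lambda>(i, k). cinner (g i) (e k))"
  have Uc: "U \<in> carrier_mat n n" by (simp add: U_def)
  have Pg: "span_proj g n (g j) = g j" "span_proj g n (e j) = e j" if "j < n" for j
    using diag_op_basis[OF g that, of "\<lambda>_. 1"] diag_op_basis[OF e(1) that, of "\<lambda>_. 1"] e(2) by simp_all
  have expand: "cinner x (diag_op f k n y) = (\<Sum>i<n. of_real (k i) * cinner (f i) y * cnj (cinner (f i) x))"
    for x y k and f :: "nat \<Rightarrow> 'a"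
    by (simp add: diag_op_apply cinner_sum_right cinner_scaleC_right cinner_commute[of x])
  have "mat_adjoint U * U = 1\<^sub>m n"
  proof (rule eq_matI)
    fix k l assume "k < dim_row (1\<^sub>m n :: complex mat)" "l < dim_col (1\<^sub>m n :: complex mat)"
    then have kl: "k < n" "l < n" by simp_all
    have "(mat_adjoint U * U) $$ (k, l) = (\<Sum>i<n. cnj (cinner (g i) (e k)) * cinner (g i) (e l))"
      using kl Uc mat_adjoint_carrier[OF Uc]
      by (simp add: scalar_prod_def lessThan_atLeast0 mat_adjoint_index[OF Uc]) (simp add: U_def)
    also have "\<dots> = cinner (e k) (span_proj g n (e l))" by (simp add: expand mult_ac)
    finally show "(mat_adjoint U * U) $$ (k, l) = 1\<^sub>m n $$ (k, l)"
      using kl by (simp add: Pg orthonormalD[OF e(1)])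
  qed (use Uc mat_adjoint_carrier[OF Uc] in auto)
  moreover have "U * mat_adjoint U = 1\<^sub>m n"
  proof (rule eq_matI)
    fix i j assume "i < dim_row (1\<^sub>m n :: complex mat)" "j < dim_col (1\<^sub>m n :: complex mat)"
    then have ij: "i < n" "j < n" by simp_all
    have "(U * mat_adjoint U) $$ (i, j) = (\<Sum>k<n. cinner (g i) (e k) * cnj (cinner (g j) (e k)))"
      using ij Uc mat_adjoint_carrier[OF Uc]
      by (simp add: scalar_prod_def lessThan_atLeast0 mat_adjoint_index[OF Uc]) (simp add: U_def)
    also have "\<dots> = cinner (g i) (span_proj e n (g j))"
      by (simp add: expand cinner_commute[of "e _"] mult_ac)
    finally show "(U * mat_adjoint U) $$ (i, j) = 1\<^sub>m n $$ (i, j)"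
      using ij by (simp add: e(2) Pg orthonormalD[OF g])
  qed (use Uc mat_adjoint_carrier[OF Uc] in auto)
  ultimately have U: "unitary_mat n U" using Uc by (simp add: unitary_mat_def)
  have "X = U * mat_diag n (\<lambda>i. complex_of_real (d i)) * mat_adjoint U"
  proof (rule eq_matI)
    fix i j assume "i < dim_row (U * mat_diag n (\<lambda>i. complex_of_real (d i)) * mat_adjoint U)"
      "j < dim_col (U * mat_diag n (\<lambda>i. complex_of_real (d i)) * mat_adjoint U)"
    then have ij: "i < n" "j < n" using Uc mat_adjoint_carrier[OF Uc] by auto
    have "X $$ (i, j) = cinner (span_proj g n (g i)) (mat_op g n X (span_proj g n (g j)))"
      by (simp add: Pg ij mat_op_entry[OF g])
    also have "\<dots> = cinner (g i) (diag_op e d n (g j))"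
      by (simp add: self_adjointD_cinner[OF diag_op_self_adjoint] flip: e(3))
    also have "\<dots> = (\<Sum>k<n. U $$ (i, k) * of_real (d k) * cnj (U $$ (j, k)))"
      unfolding expand by (intro sum.cong refl) (use ij in \<open>simp add: U_def cinner_commute[of "e _"] mult_ac\<close>)
    finally show "X $$ (i, j) = (U * mat_diag n (\<lambda>i. complex_of_real (d i)) * mat_adjoint U) $$ (i, j)"
      by (simp add: unitary_conjugate_index[OF U ij])
  qed (use Uc Xc mat_adjoint_carrier[OF Uc] in auto)
  with U show ?thesis by (rule that)
qed

section \<open>Strong neighbourhoods, scalar operators and midpoint convexity\<close>

text \<open>A strong neighbourhood of \<open>X\<close> restricts only finitely many vectors, so it contains every operator that
  agrees with \<open>X\<close> on them.\<close>

lemma strong_operator_topology_neighbourhood: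
  fixes X :: "'a::real_normed_vector \<Rightarrow>\<^sub>L 'b::real_normed_vector"
  assumes "openin strong_operator_topology U" "X \<in> U"
  obtains Y where "finite Y" "\<And>B. (\<And>y. y \<in> Y \<Longrightarrow> blinfun_apply B y = blinfun_apply X y) \<Longrightarrow> B \<in> U"
proof -
  obtain V where V: "openin euclidean V" "U = blinfun_apply -` V \<inter> UNIV"
    using assms(1) unfolding strong_operator_topology_def openin_pullback_topology by (elim exE conjE)
  have "openin (product_topology (\<lambda>i. euclidean) UNIV) V"
    unfolding euclidean_product_topology by (rule V(1))
  moreover have "blinfun_apply X \<in> V" using V(2) assms(2) by simp
  ultimately have "\<exists>W. blinfun_apply X \<in> (\<Pi>\<^sub>E i\<in>UNIV. W i) \<and> (\<forall>i. openin euclidean (W i)) \<and>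
      finite {i. W i \<noteq> topspace euclidean} \<and> (\<Pi>\<^sub>E i\<in>UNIV. W i) \<subseteq> V"
    by (rule product_topology_open_contains_basis)
  then obtain W where W: "blinfun_apply X \<in> (\<Pi>\<^sub>E i\<in>UNIV. W i)" "finite {i. W i \<noteq> topspace euclidean}"
    "(\<Pi>\<^sub>E i\<in>UNIV. W i) \<subseteq> V"
    by (elim exE conjE)
  show ?thesis
  proof (rule that[OF W(2)])
    fix B assume B: "\<And>y. y \<in> {i. W i \<noteq> topspace euclidean} \<Longrightarrow> blinfun_apply B y = blinfun_apply X y"
    have "blinfun_apply B i \<in> W i" for i
      using W(1) B[of i] by (cases "W i = UNIV") (auto simp: PiE_iff)
    then have "blinfun_apply B \<in> V" using W(3) by (auto simp: PiE_iff)
    then show "B \<in> U" using V(2) by simp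
  qed
qed

text \<open>For independent \<open>x\<close> and \<open>y\<close>, the eigenvalue of \<open>x + y\<close> equals those of \<open>x\<close> and \<open>y\<close>.\<close>

lemma all_vectors_eigenvectors:
  fixes T :: "'a::real_normed_vector \<Rightarrow>\<^sub>L 'a"
  assumes "\<And>x. \<exists>k. T x = k *\<^sub>R x"
  shows "\<exists>k. T = k *\<^sub>R id_blinfun"
proof -
  obtain g where g: "\<And>x. T x = g x *\<^sub>R x" using assms by metis
  have eq: "g x = g y" if "x \<noteq> 0" "y \<noteq> 0" for x y
  proof -
    have "g (x + y) *\<^sub>R (x + y) = g x *\<^sub>R x + g y *\<^sub>R y"
      by (metis blinfun.add_right g)
    then have e: "(g (x + y) - g x) *\<^sub>R x = (g y - g (x + y)) *\<^sub>R y"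
      by (simp add: algebra_simps)
    show ?thesis
    proof (cases "g (x + y) = g x")
      case True
      then show ?thesis using e that by simp
    next
      case False
      define r where "r = (g y - g (x + y)) / (g (x + y) - g x)"
      have "x = (1 / (g (x + y) - g x)) *\<^sub>R ((g (x + y) - g x) *\<^sub>R x)" using False by simp
      then have "x = r *\<^sub>R y" unfolding e by (simp add: r_def)
      then have "g x *\<^sub>R x = g y *\<^sub>R x"
        by (metis blinfun.scaleR_right g scaleR_left_commute)
      then show ?thesis using that by simp
    qed
  qed
  show ?thesis
  proof (cases "\<exists>v::'a. v \<noteq> 0")
    case True
    then obtain v :: 'a where "v \<noteq> 0" by blast
    then have "T x = g v *\<^sub>R x" for x using eq[of x v] g[of x] by (cases "x = 0") auto
    then show ?thesis by (intro exI[of _ "g v"] blinfun_eqI) (simp add: blinfun.scaleR_left)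
  next
    case False
    then show ?thesis by (intro exI[of _ 0] blinfun_eqI) simp
  qed
qed

text \<open>Subtract the chord. If the difference had a positive maximum, take the leftmost point where it is
  attained: midpoint convexity fails around that point.\<close>

lemma midpoint_convex_imp_convex:
  fixes g :: "real \<Rightarrow> real"
  assumes cont: "continuous_on {0..1} g"
    and mid: "\<And>s t. s \<in> {0..1} \<Longrightarrow> t \<in> {0..1} \<Longrightarrow> g ((s + t) / 2) \<le> (g s + g t) / 2"
    and l: "l \<in> {0..1}"
  shows "g l \<le> l * g 1 + (1 - l) * g 0"
proof -
  define h where "h s = g s - (s * g 1 + (1 - s) * g 0)" for s
  have hc: "continuous_on {0..1} h" unfolding h_def by (intro continuous_intros cont)
  have hmid: "h ((s + t) / 2) \<le> (h s + h t) / 2" if "s \<in> {0..1}" "t \<in> {0..1}" for s t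
    using mid[OF that] by (simp add: h_def field_simps)
  have h01: "h 0 = 0" "h 1 = 0" by (simp_all add: h_def)
  obtain m where m: "m \<in> {0..1}" "\<And>s. s \<in> {0..1} \<Longrightarrow> h s \<le> h m"
    using continuous_attains_sup[OF _ _ hc] by fastforce
  have "h m \<le> 0"
  proof (rule ccontr)
    assume "\<not> h m \<le> 0"
    \<comment> \<open>the points where the maximum is attained\<close>
    define K where "K = {s \<in> {0..1}. h s = h m}"
    have "closed K" unfolding K_def
      using continuous_closed_preimage_constant[OF hc closed_atLeastAtMost] by simp
    then have "compact ({0..1} \<inter> K)" by (rule compact_Int_closed[OF compact_Icc])
    also have "{0..1} \<inter> K = K" by (auto simp: K_def)
    finally have "compact K" .
    then obtain s where s: "s \<in> K" "\<And>t. t \<in> K \<Longrightarrow> s \<le> t"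
      using continuous_attains_inf[of K "\<lambda>x. x"] m(1) by (force simp: K_def)
    have hs: "h s = h m" "s \<in> {0..1}" using s(1) by (auto simp: K_def)
    have "s \<noteq> 0" "s \<noteq> 1" using hs(1) h01 \<open>\<not> h m \<le> 0\<close> by auto
    define d where "d = min s (1 - s)"
    have d: "0 < d" "s - d \<in> {0..1}" "s + d \<in> {0..1}"
      using hs(2) \<open>s \<noteq> 0\<close> \<open>s \<noteq> 1\<close> by (auto simp: d_def)
    have "s - d \<notin> K" using s(2)[of "s - d"] d(1) by auto
    then have "h (s - d) < h m" using m(2)[OF d(2)] d(2) by (auto simp: K_def)
    moreover have "h s \<le> (h (s - d) + h (s + d)) / 2" using hmid[OF d(2,3)] by simp
    ultimately show False using m(2)[OF d(3)] hs(1) by simp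
  qed
  then show ?thesis using m(2)[OF l] by (simp add: h_def)
qed

section \<open>Convex regular maps\<close>

locale convex_regular_map =
  fixes F :: "('h::chilbert_space \<Rightarrow>\<^sub>L 'h) \<times> ('h \<Rightarrow>\<^sub>L 'h) \<Rightarrow> 'h \<Rightarrow>\<^sub>L 'h"
  assumes F_self_adjoint: "\<lbrakk>psd_op A; psd_op B\<rbrakk> \<Longrightarrow> self_adjoint (F (A, B))"
    and F_unitary: "\<lbrakk>unitary_op u; psd_op A; psd_op B\<rbrakk> \<Longrightarrow>
      F (adj_op u o\<^sub>L A o\<^sub>L u, adj_op u o\<^sub>L B o\<^sub>L u) = adj_op u o\<^sub>L F (A, B) o\<^sub>L u"
    and F_direct_sum: "\<lbrakk>projection_op p; projection_op q; p o\<^sub>L q = 0; psd_op A; psd_op B\<rbrakk> \<Longrightarrow>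
      F ((p o\<^sub>L A o\<^sub>L p) + (q o\<^sub>L A o\<^sub>L q), (p o\<^sub>L B o\<^sub>L p) + (q o\<^sub>L B o\<^sub>L q)) =
        (p o\<^sub>L F (p o\<^sub>L A o\<^sub>L p, p o\<^sub>L B o\<^sub>L p) o\<^sub>L p) +
        (q o\<^sub>L F (q o\<^sub>L A o\<^sub>L q, q o\<^sub>L B o\<^sub>L q) o\<^sub>L q)"
    and F_homogeneous: "\<lbrakk>0 < t; psd_op A; psd_op B\<rbrakk> \<Longrightarrow> F (t *\<^sub>R A, t *\<^sub>R B) = t *\<^sub>R F (A, B)"
    and F_midpoint: "\<lbrakk>psd_op A\<^sub>1; psd_op B\<^sub>1; psd_op A\<^sub>2; psd_op B\<^sub>2\<rbrakk> \<Longrightarrow>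
      F ((1/2) *\<^sub>R (A\<^sub>1 + A\<^sub>2), (1/2) *\<^sub>R (B\<^sub>1 + B\<^sub>2)) \<preceq> (1/2) *\<^sub>R (F (A\<^sub>1, B\<^sub>1) + F (A\<^sub>2, B\<^sub>2))"
    and F_zero: "F (0, 0) = 0"
    and F_strongly_continuous: "\<lbrakk>S \<subseteq> {B. psd_op B}; bounded S\<rbrakk> \<Longrightarrow>
      continuous_map (subtopology strong_operator_topology S) strong_operator_topology
        (\<lambda>B. F (id_blinfun, B))"
begin

abbreviation form :: "('h \<Rightarrow>\<^sub>L 'h) \<Rightarrow> ('h \<Rightarrow>\<^sub>L 'h) \<Rightarrow> 'h \<Rightarrow> real" where
  "form A B x \<equiv> inner x (F (A, B) x)"

lemma F_subadditive:
  assumes "psd_op A\<^sub>1" "psd_op B\<^sub>1" "psd_op A\<^sub>2" "psd_op B\<^sub>2"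
  shows "form (A\<^sub>1 + A\<^sub>2) (B\<^sub>1 + B\<^sub>2) x \<le> form A\<^sub>1 B\<^sub>1 x + form A\<^sub>2 B\<^sub>2 x"
  using op_leD[OF F_midpoint[OF assms], of x] assms
  by (simp add: F_homogeneous blinfun_linear inner_add_right del: scaleR_add_right)

lemma F_subadditive_sum:
  assumes "finite I" "\<And>i. i \<in> I \<Longrightarrow> psd_op (A i)" "\<And>i. i \<in> I \<Longrightarrow> psd_op (B i)"
  shows "form (sum A I) (sum B I) x \<le> (\<Sum>i\<in>I. form (A i) (B i) x)"
  using assms
proof (induction I rule: finite_induct)
  case (insert i I)
  have "form (A i + sum A I) (B i + sum B I) x \<le> form (A i) (B i) x + form (sum A I) (sum B I) x"
    by (rule F_subadditive) (use insert.prems in \<open>auto intro!: psd_op_sum\<close>)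
  then show ?case using insert by fastforce
qed (simp add: F_zero)

lemma F_corner:
  assumes p: "projection_op p" and AB: "psd_op A" "psd_op B"
  shows "F (p o\<^sub>L A o\<^sub>L p, p o\<^sub>L B o\<^sub>L p) = p o\<^sub>L F (p o\<^sub>L A o\<^sub>L p, p o\<^sub>L B o\<^sub>L p) o\<^sub>L p"
  using F_direct_sum[OF p projection_op_simps(1) _ AB] by (simp add: F_zero)

text \<open>The pair is supported on the orthogonal complement of \<open>x\<close>, and by \<open>F_corner\<close> so is its value.\<close>

lemma F_annihilates:
  assumes AB: "psd_op A" "psd_op B" and z: "A x = 0" "B x = 0"
  shows "F (A, B) x = 0"
proof (cases "x = 0")
  case False
  define v where "v = (1 / norm x) *\<^sub>R x"
  define p where "p = id_blinfun - rank_one v"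
  have v: "norm v = 1" using False by (simp add: v_def)
  have p: "projection_op p" unfolding p_def by (rule projection_op_complement[OF rank_one_projection[OF v]])
  have px: "p x = 0"
  proof -
    have x: "x = norm x *\<^sub>R v" using False by (simp add: v_def)
    have "p v = 0" using v by (simp add: p_def blinfun.diff_left rank_one_apply cinner_self)
    then show ?thesis using x by (metis blinfun.scaleR_right scaleR_zero_right)
  qed
  have pT: "p o\<^sub>L T o\<^sub>L p = T" if T: "psd_op T" "T x = 0" for T
  proof (rule blinfun_eqI)
    note sa = psd_op_self_adjoint[OF T(1)]
    have Tv: "T v = 0" using T(2) by (simp add: v_def blinfun.scaleR_right)
    have Tp: "T (p y) = T y" for y
      by (simp add: p_def blinfun_linear rank_one_apply Tv
          bounded_opsD[OF self_adjoint_in_bounded_ops[OF sa]] complex_vector.scale_zero_right)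
    have "cinner v (T y) = 0" for y
      by (metis Tv cinner_zero_left sa self_adjointD_cinner)
    then have "p (T y) = T y" for y
      by (simp add: p_def blinfun.diff_left rank_one_apply)
    then show "(p o\<^sub>L T o\<^sub>L p) y = T y" for y by (simp add: Tp)
  qed
  have "F (A, B) = p o\<^sub>L F (A, B) o\<^sub>L p"
    using F_corner[OF p AB] by (simp add: pT AB z)
  then show ?thesis using px by (metis blinfun.zero_right blinfun_apply_blinfun_compose)
qed simp

lemma F_reflection:
  assumes p: "projection_op p" and AB: "psd_op A" "psd_op B"
  defines "u \<equiv> id_blinfun - 2 *\<^sub>R p"
  shows "F (u o\<^sub>L A o\<^sub>L u, u o\<^sub>L B o\<^sub>L u) = u o\<^sub>L F (A, B) o\<^sub>L u"
  using F_unitary[OF reflection_unitary(1)[OF p] AB] by (simp add: u_def reflection_unitary(2)[OF p])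

text \<open>The average of \<open>T\<close> and \<open>u T u\<close> for \<open>u = 1 - 2 p\<close> is the block diagonal part of \<open>T\<close>. So midpoint convexity
  and invariance bound the value at the block diagonal part, whose corner is the value at the compressed
  pair.\<close>

lemma F_compression:
  assumes p: "projection_op p" and AB: "psd_op A" "psd_op B"
  shows "form (p o\<^sub>L A o\<^sub>L p) (p o\<^sub>L B o\<^sub>L p) (p x) \<le> form A B (p x)"
proof -
  define q where "q = id_blinfun - p"
  define u where "u = id_blinfun - 2 *\<^sub>R p"
  define z where "z = p x"
  have q: "projection_op q" unfolding q_def by (rule projection_op_complement[OF p])
  have pq: "p o\<^sub>L q = 0"
    by (rule blinfun_eqI) (simp add: q_def blinfun_linear projection_op_idem[OF p])
  have sau: "self_adjoint u" unfolding u_def by (rule reflection_unitary(3)[OF p])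
  have pinch: "(1/2) *\<^sub>R (T + (u o\<^sub>L T o\<^sub>L u)) = (p o\<^sub>L T o\<^sub>L p) + (q o\<^sub>L T o\<^sub>L q)" for T
  proof (rule blinfun_eqI)
    fix y
    have "((1/2) *\<^sub>R (T + (u o\<^sub>L T o\<^sub>L u)) - ((p o\<^sub>L T o\<^sub>L p) + (q o\<^sub>L T o\<^sub>L q))) y = 0"
      by (simp add: u_def q_def blinfun_linear algebra_simps) (simp add: scaleR_2[symmetric] algebra_simps)
    then show "((1/2) *\<^sub>R (T + (u o\<^sub>L T o\<^sub>L u))) y = ((p o\<^sub>L T o\<^sub>L p) + (q o\<^sub>L T o\<^sub>L q)) y"
      by (simp add: blinfun.diff_left)
  qed
  have pz: "p z = z" by (simp add: z_def projection_op_idem[OF p])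
  have qz: "q z = 0" by (simp add: q_def blinfun.diff_left pz)
  have uz: "u z = - z"
    by (simp add: u_def blinfun_linear pz minus_twice)
  have psd: "psd_op (u o\<^sub>L A o\<^sub>L u)" "psd_op (u o\<^sub>L B o\<^sub>L u)" using AB sau by simp_all
  have "form ((p o\<^sub>L A o\<^sub>L p) + (q o\<^sub>L A o\<^sub>L q)) ((p o\<^sub>L B o\<^sub>L p) + (q o\<^sub>L B o\<^sub>L q)) z
      \<le> inner z (((1/2) *\<^sub>R (F (A, B) + (u o\<^sub>L F (A, B) o\<^sub>L u))) z)"
    using op_leD[OF F_midpoint[OF AB psd], of z] F_reflection[OF p AB, folded u_def] by (simp only: pinch)
  also have "\<dots> = form A B z"
  proof -
    have "inner z (u (F (A, B) (u z))) = form A B z"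
      unfolding self_adjointD[OF sau, symmetric] by (simp add: uz blinfun.minus_right)
    then show ?thesis by (simp add: blinfun_linear inner_add_right)
  qed
  also have "form ((p o\<^sub>L A o\<^sub>L p) + (q o\<^sub>L A o\<^sub>L q)) ((p o\<^sub>L B o\<^sub>L p) + (q o\<^sub>L B o\<^sub>L q)) z =
      form (p o\<^sub>L A o\<^sub>L p) (p o\<^sub>L B o\<^sub>L p) z"
    unfolding F_direct_sum[OF p q pq AB]
    by (simp add: blinfun.add_left pz qz self_adjointD[OF projection_op_self_adjoint[OF p], symmetric])
  finally show ?thesis by (simp add: z_def)
qed

section \<open>Values at scalar and diagonal pairs\<close>

text \<open>The value commutes with \<open>1 - 2 |v\<rangle>\<langle>v|\<close> for every unit vector \<open>v\<close>, so every vector is an eigenvector.\<close>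

lemma F_scalar_exists:
  assumes "0 \<le> a" "0 \<le> b"
  shows "\<exists>c. F (a *\<^sub>R id_blinfun, b *\<^sub>R id_blinfun) = c *\<^sub>R id_blinfun"
proof (rule all_vectors_eigenvectors)
  define T where "T = F (a *\<^sub>R id_blinfun, b *\<^sub>R id_blinfun)"
  have sa: "self_adjoint T" unfolding T_def using assms by (intro F_self_adjoint) auto
  fix x
  show "\<exists>k. T x = k *\<^sub>R x"
  proof (cases "x = 0")
    case False
    define v where "v = (1 / norm x) *\<^sub>R x"
    have v: "norm v = 1" using False by (simp add: v_def)
    define p where "p = rank_one v"
    define u where "u = id_blinfun - 2 *\<^sub>R p"
    have p: "projection_op p" unfolding p_def by (rule rank_one_projection[OF v])
    note r = reflection_unitary[OF p, folded u_def]
    have u_scalar: "u o\<^sub>L (s *\<^sub>R id_blinfun) o\<^sub>L u = s *\<^sub>R id_blinfun" for s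
    proof (rule blinfun_eqI)
      have "u (u y) = y" for y
        using r(4) by (metis blinfun_apply_blinfun_compose blinfun_apply_id_blinfun)
      then show "(u o\<^sub>L (s *\<^sub>R id_blinfun) o\<^sub>L u) y = (s *\<^sub>R id_blinfun) y" for y
        by (simp add: blinfun_linear)
    qed
    have T: "T = u o\<^sub>L T o\<^sub>L u"
      using F_reflection[OF p, of "a *\<^sub>R id_blinfun" "b *\<^sub>R id_blinfun"] assms
      by (simp add: T_def u_scalar flip: u_def)
    have pv: "p v = v" unfolding p_def
      using v by (simp add: rank_one_apply cinner_self)
    have "T v = u (T (u v))"
      using T by (metis blinfun_apply_blinfun_compose)
    also have "u v = - v"
      by (simp add: u_def blinfun_linear pv minus_twice)
    finally have "T v = - u (T v)" by (simp add: blinfun.minus_right)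
    then have "2 *\<^sub>R T v = 2 *\<^sub>R p (T v)"
      by (simp add: u_def blinfun_linear eq_diff_eq flip: scaleR_2)
    then have Tv: "T v = cinner v (T v) *\<^sub>C v"
      by (simp add: p_def rank_one_apply)
    have "cinner v (T v) = cnj (cinner v (T v))"
      by (metis cinner_commute sa self_adjointD_cinner)
    then have "cinner v (T v) = of_real (Re (cinner v (T v)))"
      by (simp add: complex_eq_iff)
    then have "T v = Re (cinner v (T v)) *\<^sub>R v"
      using Tv by (metis scaleC_of_real)
    moreover have "x = norm x *\<^sub>R v" using False by (simp add: v_def)
    ultimately have "T x = Re (cinner v (T v)) *\<^sub>R x"
      by (metis blinfun.scaleR_right scaleR_left_commute)
    then show ?thesis by blast
  qed simp
qed

text \<open>The function of the theorem is \<open>f(t) = scalar_value 1 t\<close>.\<close>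

definition scalar_value :: "real \<Rightarrow> real \<Rightarrow> real" where
  "scalar_value a b = (SOME c. F (a *\<^sub>R id_blinfun, b *\<^sub>R id_blinfun) = c *\<^sub>R id_blinfun)"

lemma F_scalar:
  assumes "0 \<le> a" "0 \<le> b"
  shows "F (a *\<^sub>R id_blinfun, b *\<^sub>R id_blinfun) = scalar_value a b *\<^sub>R id_blinfun"
  unfolding scalar_value_def by (rule someI_ex[OF F_scalar_exists[OF assms]])

text \<open>The corner at \<open>p\<close> of the value at the scalar pair \<open>(a 1, b 1)\<close>.\<close>

lemma F_projection:
  assumes p: "projection_op p" and ab: "0 \<le> a" "0 \<le> b"
  shows "F (a *\<^sub>R p, b *\<^sub>R p) = scalar_value a b *\<^sub>R p"
proof -
  define q where "q = id_blinfun - p"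
  have q: "projection_op q" unfolding q_def by (rule projection_op_complement[OF p])
  have pq: "p o\<^sub>L q = 0"
    by (rule blinfun_eqI) (simp add: q_def blinfun_linear projection_op_idem[OF p])
  have sand: "r o\<^sub>L (s *\<^sub>R id_blinfun) o\<^sub>L r = s *\<^sub>R r" if "projection_op r" for r s
    by (rule blinfun_eqI) (simp add: blinfun_linear projection_op_idem[OF that])
  have sum: "s *\<^sub>R p + s *\<^sub>R q = s *\<^sub>R id_blinfun" for s
    by (simp add: q_def flip: scaleR_add_right)
  have psd: "psd_op (a *\<^sub>R id_blinfun :: 'h \<Rightarrow>\<^sub>L 'h)" "psd_op (b *\<^sub>R id_blinfun :: 'h \<Rightarrow>\<^sub>L 'h)" using ab by auto
  have corner: "p o\<^sub>L F (a *\<^sub>R p, b *\<^sub>R p) o\<^sub>L p = F (a *\<^sub>R p, b *\<^sub>R p)"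
    using F_corner[OF p psd] by (simp add: sand p)
  have "scalar_value a b *\<^sub>R id_blinfun = F (a *\<^sub>R p, b *\<^sub>R p) + (q o\<^sub>L F (a *\<^sub>R q, b *\<^sub>R q) o\<^sub>L q)"
    using F_direct_sum[OF p q pq psd] by (simp add: sand p q sum F_scalar ab corner)
  then have "p o\<^sub>L (scalar_value a b *\<^sub>R id_blinfun) = p o\<^sub>L (F (a *\<^sub>R p, b *\<^sub>R p) + (q o\<^sub>L F (a *\<^sub>R q, b *\<^sub>R q) o\<^sub>L q))"
    by simp
  also have "\<dots> = p o\<^sub>L F (a *\<^sub>R p, b *\<^sub>R p)"
    using pq by (intro blinfun_eqI) (metis (no_types, lifting) add.right_neutral blinfun.add_right blinfun.zero_left blinfun_compose_assoc blinfun_apply_blinfun_compose blinfun.add_left)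
  also have "\<dots> = F (a *\<^sub>R p, b *\<^sub>R p)"
    by (subst (1 2) corner[symmetric]) (rule blinfun_eqI, simp add: projection_op_idem[OF p])
  finally show ?thesis by (metis (no_types, lifting) blinfun_compose_id(2) blinfun_eqI blinfun_apply_blinfun_compose blinfun_linear)
qed

lemma F_diag_op:
  assumes "orthonormal e n" "\<And>i. i < n \<Longrightarrow> 0 \<le> l i" "\<And>i. i < n \<Longrightarrow> 0 \<le> m i"
  shows "F (diag_op e l n, diag_op e m n) = diag_op e (\<lambda>i. scalar_value (l i) (m i)) n"
  using assms
proof (induction n)
  case 0
  then show ?case by (simp add: F_zero)
next
  case (Suc n)
  note o = Suc.prems(1)
  have on: "orthonormal e n" by (rule orthonormal_mono[OF o]) simp
  define p q where "p = span_proj e n" and "q = rank_one (e n)"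
  have init: "diag_op e k n = diag_op e (\<lambda>i. if i < n then k i else 0) (Suc n)" for k
    by (simp add: diag_op_Suc) (rule diag_op_cong, auto)
  have last: "r *\<^sub>R q = diag_op e (\<lambda>i. if i < n then 0 else r) (Suc n)" for r
    by (simp add: q_def diag_op_Suc) (simp add: diag_op_def)
  note last1 = last[of 1, simplified]
  have p: "projection_op p" unfolding p_def by (rule span_proj_projection[OF on])
  have q: "projection_op q" unfolding q_def by (rule rank_one_projection) (simp add: orthonormal_norm[OF o])
  have pq: "p o\<^sub>L q = 0" unfolding p_def init last1
    by (simp add: diag_op_compose[OF o]) (simp add: diag_op_def cong: if_cong)
  have pk: "p o\<^sub>L diag_op e k (Suc n) o\<^sub>L p = diag_op e k n" for k
    unfolding p_def init by (simp add: diag_op_compose[OF o]) (rule diag_op_cong, auto)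
  have pk': "p o\<^sub>L diag_op e k n o\<^sub>L p = diag_op e k n" for k
    unfolding p_def by (simp add: diag_op_compose[OF on])
  have qk: "q o\<^sub>L diag_op e k (Suc n) o\<^sub>L q = k n *\<^sub>R q" for k
    unfolding last1 by (simp add: diag_op_compose[OF o] diag_op_scaleR) (rule diag_op_cong, auto simp: less_Suc_eq)
  have qk': "q o\<^sub>L (r *\<^sub>R q) o\<^sub>L q = r *\<^sub>R q" for r
    by (rule blinfun_eqI) (simp add: blinfun_linear projection_op_idem[OF q])
  have psd: "psd_op (diag_op e l (Suc n))" "psd_op (diag_op e m (Suc n))"
    using Suc.prems(2,3) by (auto intro!: diag_op_psd)
  have split: "diag_op e k (Suc n) = diag_op e k n + k n *\<^sub>R q" for k by (simp add: diag_op_Suc q_def)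
  have "F (diag_op e l (Suc n), diag_op e m (Suc n)) =
      diag_op e (\<lambda>i. scalar_value (l i) (m i)) n + scalar_value (l n) (m n) *\<^sub>R q"
    using F_direct_sum[OF p q pq psd] Suc.IH[OF on] Suc.prems(2,3)
    by (simp add: pk qk pk' qk' F_projection[OF q] flip: split)
  then show ?case by (simp add: split)
qed

lemma F_diag_op_full:
  assumes o: "orthonormal e n" and l: "\<And>i. i < n \<Longrightarrow> 0 \<le> l i" "\<And>i. i < n \<Longrightarrow> 0 \<le> m i" and ab: "0 \<le> a" "0 \<le> b"
  shows "F (diag_op e l n + a *\<^sub>R (id_blinfun - span_proj e n), diag_op e m n + b *\<^sub>R (id_blinfun - span_proj e n)) =
    diag_op e (\<lambda>i. scalar_value (l i) (m i)) n + scalar_value a b *\<^sub>R (id_blinfun - span_proj e n)"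
proof -
  define p q where "p = span_proj e n" and "q = id_blinfun - p"
  have p: "projection_op p" unfolding p_def by (rule span_proj_projection[OF o])
  have q: "projection_op q" unfolding q_def by (rule projection_op_complement[OF p])
  have pq: "p o\<^sub>L q = 0" "q o\<^sub>L p = 0"
    by (rule blinfun_eqI, simp add: q_def blinfun_linear projection_op_idem[OF p])+
  have pd: "p o\<^sub>L diag_op e k n = diag_op e k n" "diag_op e k n o\<^sub>L p = diag_op e k n" for k
    by (simp_all add: p_def diag_op_compose[OF o])
  have app: "p (q x) = 0" "q (p x) = 0"
    "p (diag_op e k n x) = diag_op e k n x"
    "diag_op e k n (p x) = diag_op e k n x" for k x
    using pq pd by (metis blinfun.zero_left blinfun_apply_blinfun_compose)+
  have app2: "q (diag_op e k n x) = 0" for k x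
    by (metis app(2,3))
  have pk: "p o\<^sub>L (diag_op e k n + s *\<^sub>R q) o\<^sub>L p = diag_op e k n" "q o\<^sub>L (diag_op e k n + s *\<^sub>R q) o\<^sub>L q = s *\<^sub>R q" for k s
    by (rule blinfun_eqI, simp add: blinfun_linear app app2
        projection_op_idem[OF q])+
  have pk': "p o\<^sub>L diag_op e k n o\<^sub>L p = diag_op e k n" "q o\<^sub>L (s *\<^sub>R q) o\<^sub>L q = s *\<^sub>R q" for k s
    using pk(1)[of k 0] by (auto intro!: blinfun_eqI simp: blinfun_linear projection_op_idem[OF q])
  have psd: "psd_op (diag_op e l n + a *\<^sub>R q)" "psd_op (diag_op e m n + b *\<^sub>R q)"
    using l ab projection_op_psd[OF q] by (auto intro!: diag_op_psd psd_op_simps)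
  show ?thesis
    using F_direct_sum[OF p q pq(1) psd] unfolding p_def[symmetric] q_def[symmetric]
    by (simp add: pk pk' F_diag_op[OF o l] F_projection[OF q ab])
qed

lemma F_one_diag_op:
  assumes "orthonormal e n" "\<And>i. i < n \<Longrightarrow> 0 \<le> l i"
  shows "F (id_blinfun, diag_op e l n) =
    diag_op e (\<lambda>i. scalar_value 1 (l i)) n + scalar_value 1 0 *\<^sub>R (id_blinfun - span_proj e n)"
  using F_diag_op_full[OF assms(1), of "\<lambda>_. 1" l 1 0] assms(2) by simp

lemma F_rank_one:
  assumes "0 \<le> a" "0 \<le> b"
  shows "F (a *\<^sub>R rank_one v, b *\<^sub>R rank_one v) = scalar_value a b *\<^sub>R rank_one v"
proof (cases "v = 0")
  case True
  have "rank_one (0::'h) = 0" by (rule blinfun_eqI) (simp add: rank_one_apply)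
  then show ?thesis by (simp add: True F_zero)
next
  case False
  define w where "w = (1 / norm v) *\<^sub>R v"
  have w: "norm w = 1" using False by (simp add: w_def)
  have v: "rank_one v = (norm v)\<^sup>2 *\<^sub>R rank_one w"
    using rank_one_scaleR[of "norm v" w] False by (simp add: w_def power2_eq_square)
  have "F ((norm v)\<^sup>2 *\<^sub>R (a *\<^sub>R rank_one w), (norm v)\<^sup>2 *\<^sub>R (b *\<^sub>R rank_one w)) =
      (norm v)\<^sup>2 *\<^sub>R F (a *\<^sub>R rank_one w, b *\<^sub>R rank_one w)"
    by (rule F_homogeneous) (use False assms in \<open>auto intro!: psd_op_simps(4) rank_one_psd\<close>)
  also have "F (a *\<^sub>R rank_one w, b *\<^sub>R rank_one w) = scalar_value a b *\<^sub>R rank_one w"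
    by (rule F_projection[OF rank_one_projection[OF w] assms])
  finally show ?thesis by (simp add: v mult_ac)
qed

text \<open>Fix \<open>x\<close> and let \<open>T1 = |T x\<rangle>\<langle>T x| / \<langle>x, T x\<rangle>\<close>. By Cauchy-Schwarz \<open>T1 \<le> T\<close>, and \<open>T2 = T - T1\<close>
  annihilates \<open>x\<close>. By subadditivity, \<open>F\<close> at the multiples of \<open>T\<close> is at most the sum of the values for
  \<open>T1\<close> and \<open>T2\<close>. The first is \<open>c(a, b) T1\<close> and the second vanishes at \<open>x\<close>.\<close>

lemma F_multiple_le:
  assumes T: "psd_op T" and ab: "0 \<le> a" "0 \<le> b"
  shows "form (a *\<^sub>R T) (b *\<^sub>R T) x \<le> scalar_value a b * inner x (T x)"
proof -
  \<comment> \<open>If \<open>s = 0\<close>, then \<open>T x = 0\<close>; as \<open>1 / 0 = 0\<close>, the definitions below give \<open>T1 = 0\<close> and \<open>T2 = T\<close>.\<close>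
  define s where "s = inner x (T x)"
  define T1 where "T1 = (1 / s) *\<^sub>R rank_one (T x)"
  define T2 where "T2 = T - T1"
  note sa = psd_op_self_adjoint[OF T]
  have "0 \<le> s" unfolding s_def by (rule psd_opD[OF T])
  have T1: "psd_op T1" unfolding T1_def using \<open>0 \<le> s\<close> by (intro psd_op_simps(4) rank_one_psd) simp
  have T2: "psd_op T2"
    unfolding psd_op_iff
  proof (intro conjI allI)
    show "self_adjoint T2" unfolding T2_def using sa psd_op_self_adjoint[OF T1] by simp
    fix y
    have "(cmod (cinner (T x) y))\<^sup>2 / s \<le> inner y (T y)"
    proof (cases "s = 0")
      case True
      then show ?thesis using psd_opD[OF T] by simp
    next
      case False
      then show ?thesis using psd_op_cinner_Cauchy_Schwarz[OF T, of x y] \<open>0 \<le> s\<close>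
        by (simp add: s_def[symmetric] divide_le_eq mult.commute)
    qed
    then show "0 \<le> inner y (T2 y)"
      by (simp add: T2_def T1_def blinfun_linear inner_diff_right inner_rank_one)
  qed
  have T2x: "T2 x = 0"
  proof (cases "s = 0")
    case True
    then have "T x = 0" using psd_op_kernel[OF T] by (simp add: s_def)
    then show ?thesis by (simp add: T2_def T1_def True)
  next
    case False
    have "cnj (cinner (T x) x) = cinner (T x) x"
      by (metis cinner_commute sa self_adjointD_cinner)
    then have "cinner (T x) x = of_real s"
      by (simp add: s_def complex_eq_iff Re_cinner inner_commute)
    then show ?thesis using False
      by (simp add: T2_def T1_def blinfun_linear rank_one_apply scaleC_of_real)
  qed
  have psd: "psd_op (c *\<^sub>R T1)" "psd_op (c *\<^sub>R T2)" if "0 \<le> c" for c using T1 T2 that by auto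
  have sum: "c *\<^sub>R T = c *\<^sub>R T1 + c *\<^sub>R T2" for c by (simp add: T2_def flip: scaleR_add_right)
  have "form (a *\<^sub>R T) (b *\<^sub>R T) x \<le> form (a *\<^sub>R T1) (b *\<^sub>R T1) x + form (a *\<^sub>R T2) (b *\<^sub>R T2) x"
    unfolding sum using ab by (intro F_subadditive psd)
  also have "form (a *\<^sub>R T2) (b *\<^sub>R T2) x = 0"
    using ab by (subst F_annihilates) (auto intro: psd simp: blinfun.scaleR_left T2x)
  also have "form (a *\<^sub>R T1) (b *\<^sub>R T1) x = scalar_value a b * inner x (T1 x)"
  proof (cases "s = 0")
    case True
    then show ?thesis by (simp add: T1_def F_zero)
  next
    case False
    then have "F ((1 / s) *\<^sub>R (a *\<^sub>R rank_one (T x)), (1 / s) *\<^sub>R (b *\<^sub>R rank_one (T x))) =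
        (1 / s) *\<^sub>R F (a *\<^sub>R rank_one (T x), b *\<^sub>R rank_one (T x))"
      using \<open>0 \<le> s\<close> ab by (intro F_homogeneous psd_op_simps(4) rank_one_psd) auto
    then have "F (a *\<^sub>R T1, b *\<^sub>R T1) = scalar_value a b *\<^sub>R T1"
      unfolding F_rank_one[OF ab] by (simp add: T1_def mult_ac)
    then show ?thesis by (simp add: blinfun.scaleR_left)
  qed
  also have "T1 x = T x" using T2x by (simp add: T2_def blinfun.diff_left)
  finally show ?thesis by simp
qed

section \<open>The map at the unit operator is the functional calculus\<close>

lemma F_strong_neighbourhood:
  assumes S: "S \<subseteq> {B. psd_op B}" "bounded S" and X: "X \<in> S" and "0 < \<epsilon>"
  obtains Y where "finite Y" "\<And>B. B \<in> S \<Longrightarrow> (\<And>y. y \<in> Y \<Longrightarrow> B y = X y) \<Longrightarrow>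
    norm (F (id_blinfun, B) x - F (id_blinfun, X) x) < \<epsilon>"
proof -
  define V where "V = ball (F (id_blinfun, X) x) \<epsilon>"
  have "continuous_map (subtopology strong_operator_topology S) euclidean (\<lambda>B. F (id_blinfun, B) x)"
    using F_strongly_continuous[OF S] by (simp add: continuous_on_strong_operator_topo_iff_coordinatewise)
  then have "openin (subtopology strong_operator_topology S)
      {B \<in> topspace (subtopology strong_operator_topology S). F (id_blinfun, B) x \<in> V}"
    by (rule openin_continuous_map_preimage) (simp add: V_def)
  then obtain U where U: "openin strong_operator_topology U" "{B \<in> S. F (id_blinfun, B) x \<in> V} = U \<inter> S"
    unfolding openin_subtopology topspace_subtopology strong_operator_topology_topspace by auto
  have "X \<in> {B \<in> S. F (id_blinfun, B) x \<in> V}" using X \<open>0 < \<epsilon>\<close> by (simp add: V_def)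
  then have "X \<in> U" unfolding U(2) by blast
  then obtain Y where Y: "finite Y" "\<And>B. (\<And>y. y \<in> Y \<Longrightarrow> blinfun_apply B y = blinfun_apply X y) \<Longrightarrow> B \<in> U"
    using strong_operator_topology_neighbourhood[OF U(1)] by metis
  show ?thesis
  proof (rule that[OF Y(1)])
    fix B assume "B \<in> S" "\<And>y. y \<in> Y \<Longrightarrow> B y = X y"
    then have "B \<in> U \<inter> S" using Y(2) by blast
    then have "F (id_blinfun, B) x \<in> V" unfolding U(2)[symmetric] by blast
    then show "norm (F (id_blinfun, B) x - F (id_blinfun, X) x) < \<epsilon>"
      by (simp add: V_def dist_norm norm_minus_commute)
  qed
qed

lemma F_continuous_along:
  fixes G :: "real \<Rightarrow> 'h \<Rightarrow>\<^sub>L 'h"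
  assumes G: "continuous_on I G" "\<And>s. s \<in> I \<Longrightarrow> psd_op (G s)" and I: "compact I"
  shows "continuous_on I (\<lambda>s. F (id_blinfun, G s) x)"
proof -
  have "bounded (G ` I)" by (intro compact_imp_bounded compact_continuous_image G I)
  then have c: "continuous_map (subtopology strong_operator_topology (G ` I)) strong_operator_topology (\<lambda>B. F (id_blinfun, B))"
    using G(2) by (intro F_strongly_continuous) auto
  have "continuous_map (top_of_set I) strong_operator_topology G"
    unfolding continuous_on_strong_operator_topo_iff_coordinatewise
    by (auto intro!: continuous_intros G(1))
  then have "continuous_map (top_of_set I) (subtopology strong_operator_topology (G ` I)) G"
    by (intro continuous_map_into_subtopology) auto
  from continuous_map_compose[OF this c]
  show ?thesis by (simp add: continuous_on_strong_operator_topo_iff_coordinatewise o_def)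
qed

lemma scalar_value_continuous:
  assumes "\<exists>x::'h. x \<noteq> 0" "0 \<le> a"
  shows "continuous_on {a..b} (scalar_value 1)"
proof -
  obtain v :: 'h where v: "norm v = 1"
  proof -
    obtain x :: 'h where "x \<noteq> 0" using assms(1) by blast
    then show ?thesis using that[of "(1 / norm x) *\<^sub>R x"] by simp
  qed
  have "continuous_on {a..b} (\<lambda>s. inner v (F (id_blinfun, s *\<^sub>R id_blinfun) v))"
    using assms(2) by (intro continuous_intros F_continuous_along) auto
  moreover have "inner v (F (id_blinfun, s *\<^sub>R id_blinfun) v) = scalar_value 1 s" if "s \<in> {a..b}" for s
    using F_scalar[of 1 s] that assms(2) v by (simp add: blinfun.scaleR_left power2_norm_eq_inner[symmetric])
  ultimately show ?thesis using continuous_on_cong[OF refl] by (metis (no_types, lifting))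
qed

text \<open>The compression \<open>P X P\<close> agrees with \<open>X\<close> at \<open>y\<close> as soon as \<open>P\<close> fixes \<open>y\<close> and \<open>X y\<close>, and its norm is at most that
  of \<open>X\<close>, so the values at these compressions approach the value at \<open>X\<close>.\<close>

lemma F_one_finite_compression:
  assumes X: "psd_op X" "form_bounds X a b" and Y: "finite Y" and "0 < \<epsilon>"
  obtains e n l where "orthonormal e n" "\<And>y. y \<in> Y \<Longrightarrow> span_proj e n y = y"
    "span_proj e n o\<^sub>L X o\<^sub>L span_proj e n = diag_op e l n" "\<And>i. i < n \<Longrightarrow> l i \<in> {a..b}"
    "norm (F (id_blinfun, diag_op e l n) x - F (id_blinfun, X) x) < \<epsilon>"
proof -
  \<comment> \<open>strong continuity is available on bounded sets only\<close>
  define S where "S = {B :: 'h \<Rightarrow>\<^sub>L 'h. psd_op B \<and> norm B \<le> norm X}"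
  have S: "S \<subseteq> {B. psd_op B}" "bounded S" by (auto simp: S_def intro!: boundedI)
  obtain N where N: "finite N" "\<And>B. B \<in> S \<Longrightarrow> (\<And>y. y \<in> N \<Longrightarrow> B y = X y) \<Longrightarrow>
      norm (F (id_blinfun, B) x - F (id_blinfun, X) x) < \<epsilon>"
    using F_strong_neighbourhood[OF S, of X \<epsilon> x] X(1) \<open>0 < \<epsilon>\<close> by (auto simp: S_def)
  obtain e n l where e: "orthonormal e n"
    "\<And>y. y \<in> Y \<union> N \<union> blinfun_apply X ` N \<Longrightarrow> span_proj e n y = y"
    "span_proj e n o\<^sub>L X o\<^sub>L span_proj e n = diag_op e l n" "\<And>i. i < n \<Longrightarrow> l i \<in> {a..b}"
    by (rule compression_diagonalize_bounds[OF psd_op_self_adjoint[OF X(1)], of "Y \<union> N \<union> blinfun_apply X ` N" a b])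
       (use Y N(1) X(2) in \<open>auto simp: form_bounds_def\<close>)
  have P: "norm (span_proj e n) \<le> 1" by (rule norm_projection_op[OF span_proj_projection[OF e(1)]])
  have "norm (span_proj e n o\<^sub>L X o\<^sub>L span_proj e n) \<le> norm X"
  proof -
    have "norm (span_proj e n o\<^sub>L X o\<^sub>L span_proj e n) \<le> norm (span_proj e n) * norm X * norm (span_proj e n)"
      by (rule order_trans[OF norm_blinfun_compose mult_right_mono[OF norm_blinfun_compose]]) simp
    also have "\<dots> \<le> 1 * norm X * 1" by (intro mult_mono P) auto
    finally show ?thesis by simp
  qed
  then have "diag_op e l n \<in> S"
    using X(1) diag_op_self_adjoint[of e "\<lambda>_. 1" n] by (simp add: S_def flip: e(3))
  moreover have "diag_op e l n y = X y" if "y \<in> N" for y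
    unfolding e(3)[symmetric] using that by (simp add: e(2))
  ultimately have "norm (F (id_blinfun, diag_op e l n) x - F (id_blinfun, X) x) < \<epsilon>"
    by (rule N(2))
  with e show ?thesis by (intro that[OF e(1) _ e(3,4)]) auto
qed

text \<open>At a vector \<open>x\<close> both \<open>F (1, X)\<close> and \<open>p(X)\<close> are computed, up to \<open>\<epsilon>\<close>, in one finite-dimensional compression
  that contains the vectors \<open>X\<^sup>k x\<close>. There they are diagonal with entries \<open>f(l i)\<close> and \<open>p(l i)\<close>.\<close>

lemma F_one_poly_op_dist:
  assumes X: "psd_op X" "form_bounds X a b" "0 \<le> a"
    and p: "\<And>t. t \<in> {a..b} \<Longrightarrow> \<bar>scalar_value 1 t - poly p t\<bar> \<le> M" "0 \<le> M"
  shows "norm (F (id_blinfun, X) - poly_op p X) \<le> M"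
proof (rule norm_blinfun_bound[OF p(2)], rule field_le_epsilon)
  fix x and \<epsilon> :: real assume "0 < \<epsilon>"
  obtain e n l where e: "orthonormal e n"
    "\<And>y. y \<in> (\<lambda>k. (blinfun_apply X ^^ k) x) ` {..degree p} \<Longrightarrow> span_proj e n y = y"
    "span_proj e n o\<^sub>L X o\<^sub>L span_proj e n = diag_op e l n" "\<And>i. i < n \<Longrightarrow> l i \<in> {a..b}"
    "norm (F (id_blinfun, diag_op e l n) x - F (id_blinfun, X) x) < \<epsilon>"
    by (rule F_one_finite_compression[OF X(1,2) _ \<open>0 < \<epsilon>\<close>, of "(\<lambda>k. (blinfun_apply X ^^ k) x) ` {..degree p}" x]) auto
  have Px: "span_proj e n x = x" by (rule e(2)) (auto intro!: image_eqI[of _ _ 0])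
  have l0: "0 \<le> l i" if "i < n" for i using e(4)[OF that] X(3) by simp
  have pX: "poly_op p X x = diag_op e (\<lambda>i. poly p (l i)) n x"
    by (rule poly_op_diagonal[OF e(1,3)]) (use e(2) in auto)
  have FX: "F (id_blinfun, diag_op e l n) x = diag_op e (\<lambda>i. scalar_value 1 (l i)) n x"
    by (simp add: F_one_diag_op[OF e(1) l0] blinfun_linear Px)
  have diff: "diag_op e (\<lambda>i. scalar_value 1 (l i)) n - diag_op e (\<lambda>i. poly p (l i)) n =
      diag_op e (\<lambda>i. scalar_value 1 (l i) - poly p (l i)) n"
    by (simp add: diag_op_def sum_subtractf scaleR_left_diff_distrib)
  have "norm (diag_op e (\<lambda>i. scalar_value 1 (l i)) n x - poly_op p X x) \<le> M * norm x"
    unfolding pX blinfun.diff_left[symmetric] diff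
    by (rule norm_diag_op_le[OF e(1) _ p(2)]) (use p(1) e(4) in blast)
  then have "norm (F (id_blinfun, X) x - poly_op p X x) \<le> M * norm x + \<epsilon>"
    using e(5) unfolding FX
    using norm_triangle_ineq[of "F (id_blinfun, X) x - diag_op e (\<lambda>i. scalar_value 1 (l i)) n x"
        "diag_op e (\<lambda>i. scalar_value 1 (l i)) n x - poly_op p X x"]
    by (simp add: norm_minus_commute)
  then show "norm ((F (id_blinfun, X) - poly_op p X) x) \<le> M * norm x + \<epsilon>"
    by (simp add: blinfun.diff_left)
qed

text \<open>For polynomials \<open>r\<^sub>n\<close> approximating \<open>f\<close> uniformly on \<open>[0, \<parallel>X\<parallel>]\<close>, the previous lemma says that
  \<open>r\<^sub>n (X) \<longlonglongrightarrow> F (1, X)\<close> in norm.\<close>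

lemma fun_op_scalar_value:
  assumes nontriv: "\<exists>x::'h. x \<noteq> 0" and X: "psd_op X"
  shows "fun_op (scalar_value 1) X = F (id_blinfun, X)"
proof -
  note fb = form_bounds_psd[OF X]
  obtain r where r: "uniform_limit {0..norm X} (\<lambda>n. poly (r n)) (scalar_value 1) sequentially"
    using uniform_polynomial_approximation[OF scalar_value_continuous[OF nontriv]] by blast
  have "(\<lambda>n. poly_op (r n) X) \<longlonglongrightarrow> F (id_blinfun, X)"
  proof (rule tendstoI)
    fix \<epsilon> :: real assume "0 < \<epsilon>"
    then have "\<forall>\<^sub>F n in sequentially. \<forall>x\<in>{0..norm X}. dist (poly (r n) x) (scalar_value 1 x) < \<epsilon> / 2"
      using uniform_limitD[OF r, of "\<epsilon> / 2"] by simp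
    then show "\<forall>\<^sub>F n in sequentially. dist (poly_op (r n) X) (F (id_blinfun, X)) < \<epsilon>"
    proof eventually_elim
      case (elim n)
      have "norm (F (id_blinfun, X) - poly_op (r n) X) \<le> \<epsilon> / 2"
      proof (rule F_one_poly_op_dist[OF X fb])
        fix t assume "t \<in> {0..norm X}"
        then have "dist (poly (r n) t) (scalar_value 1 t) < \<epsilon> / 2" using elim by blast
        then show "\<bar>scalar_value 1 t - poly (r n) t\<bar> \<le> \<epsilon> / 2" unfolding dist_real_def by argo
      qed (use \<open>0 < \<epsilon>\<close> in auto)
      then show ?case using \<open>0 < \<epsilon>\<close> by (simp add: dist_norm norm_minus_commute)
    qed
  qed
  then show ?thesis by (rule fun_op_eqI[OF psd_op_self_adjoint[OF X] fb r])
qed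

section \<open>The perspective as an upper bound\<close>

lemma scale_divide_le: "0 \<le> x \<Longrightarrow> 0 < \<epsilon> \<Longrightarrow> x * (\<epsilon> / (x + 1)) \<le> (\<epsilon>::real)"
  by (simp add: field_simps)

text \<open>With \<open>q\<close> the projection onto the complement of the family, \<open>1 = \<Sum>i |e i\<rangle>\<langle>e i| + q\<close>. So the pair is the sum of
  \<open>(C |e i\<rangle>\<langle>e i| C, l i C |e i\<rangle>\<langle>e i| C)\<close>, \<open>(C q C, 0)\<close> and \<open>(0, C Z C)\<close>. To each of them \<open>F_multiple_le\<close>
  applies.\<close>

lemma F_congruence_diag_le:
  assumes C: "self_adjoint C" and e: "orthonormal e n" "\<And>i. i < n \<Longrightarrow> 0 \<le> l i" and Z: "psd_op Z"
  shows "form (C o\<^sub>L C) ((C o\<^sub>L diag_op e l n o\<^sub>L C) + (C o\<^sub>L Z o\<^sub>L C)) x \<le>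
    inner (C x) (F (id_blinfun, diag_op e l n) (C x)) +
    scalar_value 0 1 * inner (C x) (Z (C x))"
proof -
  define q where "q = id_blinfun - span_proj e n"
  define T where "T i = C o\<^sub>L rank_one (e i) o\<^sub>L C" for i
  define Tq TZ where "Tq = C o\<^sub>L q o\<^sub>L C" and "TZ = C o\<^sub>L Z o\<^sub>L C"
  have q: "psd_op q" unfolding q_def
    by (rule projection_op_psd[OF projection_op_complement[OF span_proj_projection[OF e(1)]]])
  have psd: "psd_op (T i)" "psd_op Tq" "psd_op TZ" for i
    unfolding T_def Tq_def TZ_def by (rule psd_op_sandwich[OF C], rule rank_one_psd q Z)+
  have F1: "F (id_blinfun, diag_op e l n) = diag_op e (\<lambda>i. scalar_value 1 (l i)) n + scalar_value 1 0 *\<^sub>R q"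
    unfolding q_def by (rule F_one_diag_op[OF e(1)]) (rule e(2))
  have diag: "C o\<^sub>L diag_op e k n o\<^sub>L C = (\<Sum>i<n. k i *\<^sub>R T i)" for k
    by (rule blinfun_eqI) (simp add: diag_op_def T_def blinfun.sum_left blinfun.sum_right blinfun_linear)
  have CC: "C o\<^sub>L C = (\<Sum>i<n. T i) + Tq"
  proof -
    have "C o\<^sub>L C = (C o\<^sub>L span_proj e n o\<^sub>L C) + (C o\<^sub>L q o\<^sub>L C)"
      by (rule blinfun_eqI) (simp add: q_def blinfun_linear)
    then show ?thesis by (simp add: diag Tq_def)
  qed
  have "form (C o\<^sub>L C) ((C o\<^sub>L diag_op e l n o\<^sub>L C) + (C o\<^sub>L Z o\<^sub>L C)) x =
      form (((\<Sum>i<n. T i) + Tq) + 0) (((\<Sum>i<n. l i *\<^sub>R T i) + 0) + TZ) x"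
    by (simp add: CC diag TZ_def)
  also have "\<dots> \<le> form ((\<Sum>i<n. T i) + Tq) ((\<Sum>i<n. l i *\<^sub>R T i) + 0) x + form 0 TZ x"
    using psd e(2) by (intro F_subadditive) (auto intro!: psd_op_simps(3,4) psd_op_sum)
  also have "form ((\<Sum>i<n. T i) + Tq) ((\<Sum>i<n. l i *\<^sub>R T i) + 0) x \<le>
      form (\<Sum>i<n. T i) (\<Sum>i<n. l i *\<^sub>R T i) x + form Tq 0 x"
    using psd e(2) by (intro F_subadditive) (auto intro!: psd_op_simps(3,4) psd_op_sum)
  also have "form (\<Sum>i<n. T i) (\<Sum>i<n. l i *\<^sub>R T i) x \<le> (\<Sum>i<n. form (T i) (l i *\<^sub>R T i) x)"
    using psd e(2) by (intro F_subadditive_sum) (auto intro!: psd_op_simps(4))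
  also have "\<dots> \<le> (\<Sum>i<n. scalar_value 1 (l i) * inner x (T i x))"
    using F_multiple_le[OF psd(1), of 1 "l _" x] e(2) by (intro sum_mono) auto
  also have "form Tq 0 x \<le> scalar_value 1 0 * inner x (Tq x)"
    using F_multiple_le[OF psd(2), of 1 0 x] by simp
  also have "form 0 TZ x \<le> scalar_value 0 1 * inner x (TZ x)"
    using F_multiple_le[OF psd(3), of 0 1 x] by simp
  also have "inner x (TZ x) = inner (C x) (Z (C x))"
    by (simp add: TZ_def self_adjointD[OF C])
  also have "(\<Sum>i<n. scalar_value 1 (l i) * inner x (T i x)) + scalar_value 1 0 * inner x (Tq x) =
      inner (C x) (F (id_blinfun, diag_op e l n) (C x))"
    unfolding F1
    by (simp add: T_def Tq_def self_adjointD[OF C, symmetric] blinfun_linear inner_add_right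
        inner_diag_op inner_rank_one)
  finally show ?thesis by simp
qed

text \<open>Apply the previous lemma to \<open>X' = R P R\<close> and \<open>Z = R (1 - P) R\<close> with \<open>R\<close> the square root of \<open>X\<close> and \<open>P\<close> a
  finite-dimensional projection. If \<open>P\<close> fixes \<open>R z\<close>, then \<open>X'\<close> agrees with \<open>X\<close> at \<open>z\<close> and \<open>Z\<close> vanishes
  there. Letting this happen at \<open>C x\<close> removes the last term, and at finitely many further vectors it
  brings \<open>F (1, X')\<close> close to \<open>F (1, X)\<close>.\<close>

lemma F_congruence_upper:
  assumes C: "self_adjoint C" and X: "psd_op X"
  shows "form (C o\<^sub>L C) (C o\<^sub>L X o\<^sub>L C) x \<le>
    inner (C x) (F (id_blinfun, X) (C x))"
proof (rule field_le_epsilon)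
  fix \<epsilon> :: real assume "0 < \<epsilon>"
  define y where "y = C x"
  define \<delta> where "\<delta> = \<epsilon> / (norm y + 1)"
  have "0 < \<delta>" using \<open>0 < \<epsilon>\<close> by (simp add: \<delta>_def add_nonneg_pos)
  define R where "R = sqrt_op X"
  have R: "psd_op R" "R o\<^sub>L R = X" unfolding R_def by (rule sqrt_op[OF X])+
  note saR = psd_op_self_adjoint[OF R(1)]
  have RR: "R (R z) = X z" for z
    using R(2) by (metis blinfun_apply_blinfun_compose)
  define S where "S = {B :: 'h \<Rightarrow>\<^sub>L 'h. psd_op B \<and> norm B \<le> norm R * norm R}"
  have S: "S \<subseteq> {B. psd_op B}" "bounded S" by (auto simp: S_def intro!: boundedI)
  have "norm X \<le> norm R * norm R" using norm_blinfun_compose[of R R] R(2) by simp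
  then obtain N where N: "finite N" "\<And>B. B \<in> S \<Longrightarrow> (\<And>y. y \<in> N \<Longrightarrow> B y = X y) \<Longrightarrow>
      norm (F (id_blinfun, B) y - F (id_blinfun, X) y) < \<delta>"
    using F_strong_neighbourhood[OF S, of X \<delta> y] X \<open>0 < \<delta>\<close> by (auto simp: S_def)
  obtain g m where g: "orthonormal g m"
    "\<And>z. z \<in> blinfun_apply R ` insert y N \<Longrightarrow> span_proj g m z = z"
    using finite_set_in_span[of "blinfun_apply R ` insert y N"] N(1) by auto
  define P where "P = span_proj g m"
  have P: "projection_op P" unfolding P_def by (rule span_proj_projection[OF g(1)])
  define X' where "X' = R o\<^sub>L P o\<^sub>L R"
  define Z where "Z = R o\<^sub>L (id_blinfun - P) o\<^sub>L R"
  have X': "psd_op X'" and Z: "psd_op Z"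
    unfolding X'_def Z_def using saR P projection_op_complement[OF P] by (simp_all add: projection_op_psd)
  have X'_eq: "X' z = X z" if "z \<in> insert y N" for z
    using g(2)[of "R z"] that by (auto simp: X'_def P_def RR)
  have "norm X' \<le> norm R * norm P * norm R" unfolding X'_def
    by (rule order_trans[OF norm_blinfun_compose mult_right_mono[OF norm_blinfun_compose]]) simp
  also have "\<dots> \<le> norm R * 1 * norm R" by (intro mult_mono norm_projection_op[OF P]) auto
  finally have "X' \<in> S" using X' by (simp add: S_def)
  then have close: "norm (F (id_blinfun, X') y - F (id_blinfun, X) y) < \<delta>"
    by (rule N(2)) (simp add: X'_eq)
  obtain e n l where e: "orthonormal e n" "X' = diag_op e l n" "\<And>i. i < n \<Longrightarrow> 0 \<le> l i"
  proof (rule psd_finite_rank_diagonal[OF X', of "(\<lambda>i. R (g i)) ` {..<m}"])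
    fix Q :: "'h \<Rightarrow>\<^sub>L 'h" and z
    assume Q: "Q \<in> \<B>" "\<And>v. v \<in> (\<lambda>i. R (g i)) ` {..<m} \<Longrightarrow> Q v = v"
    show "Q (X' z) = X' z"
      by (simp add: X'_def P_def diag_op_apply[of _ _ _ "R z"] blinfun.sum_right
          bounded_opsD[OF self_adjoint_in_bounded_ops[OF saR]] bounded_opsD[OF Q(1)] Q(2))
  qed auto
  have XZ: "X = X' + Z"
    by (rule blinfun_eqI) (simp add: X'_def Z_def blinfun_linear RR)
  then have CXC: "C o\<^sub>L X o\<^sub>L C = (C o\<^sub>L diag_op e l n o\<^sub>L C) + (C o\<^sub>L Z o\<^sub>L C)"
    by (intro blinfun_eqI) (simp add: blinfun_linear e(2))
  have Zy: "Z y = 0"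
    using XZ X'_eq[of y] by (metis add_cancel_left_right blinfun.add_left insertI1)
  have "form (C o\<^sub>L C) (C o\<^sub>L X o\<^sub>L C) x \<le> inner y (F (id_blinfun, X') y)"
    using F_congruence_diag_le[OF C e(1) _ Z, of l x] e(3) by (simp add: CXC Zy e(2) flip: y_def)
  also have "\<dots> = inner y (F (id_blinfun, X) y) +
      inner y (F (id_blinfun, X') y - F (id_blinfun, X) y)"
    by (simp add: inner_diff_right)
  also have "inner y (F (id_blinfun, X') y - F (id_blinfun, X) y) \<le> norm y * \<delta>"
    by (rule order_trans[OF norm_cauchy_schwarz mult_left_mono]) (use close in auto)
  also have "norm y * \<delta> \<le> \<epsilon>" unfolding \<delta>_def by (rule scale_divide_le) (use \<open>0 < \<epsilon>\<close> in auto)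
  finally show "form (C o\<^sub>L C) (C o\<^sub>L X o\<^sub>L C) x \<le>
    inner (C x) (F (id_blinfun, X) (C x)) + \<epsilon>"
    by (simp add: y_def)
qed

section \<open>The perspective as a lower bound\<close>

text \<open>Let \<open>q\<close> be a finite-dimensional projection that fixes \<open>y\<close>, let \<open>L\<close> be one whose range contains the ranges of
  \<open>q\<close> and \<open>E q\<close>, and let \<open>c > 0\<close> make \<open>c E\<close> a contraction. The dilation gives a symmetry \<open>U\<close> with
  \<open>L U q = c E q\<close>. Compressing by \<open>L\<close>, conjugating by \<open>U\<close> and compressing by \<open>q\<close> turns \<open>(A, B)\<close> into
  \<open>c\<^sup>2 (q, q X q)\<close>, and by \<open>F_compression\<close> each compression can only decrease the value.\<close>

lemma F_congruence_lower:
  assumes inf: "infinite_dimensional TYPE('h)" and AB: "psd_op A" "psd_op B"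
    and E: "self_adjoint E" "E o\<^sub>L A o\<^sub>L E = id_blinfun" and X: "X = E o\<^sub>L B o\<^sub>L E"
  shows "form id_blinfun X y \<le> form A B (E y)"
proof (rule field_le_epsilon)
  fix \<epsilon> :: real assume "0 < \<epsilon>"
  define \<delta> where "\<delta> = \<epsilon> / (norm y + 1)"
  have "0 < \<delta>" using \<open>0 < \<epsilon>\<close> by (simp add: \<delta>_def add_nonneg_pos)
  have psdX: "psd_op X" unfolding X using E(1) AB(2) by simp
  obtain e n l where e: "orthonormal e n" "\<And>z. z \<in> {y} \<Longrightarrow> span_proj e n z = z"
    "span_proj e n o\<^sub>L X o\<^sub>L span_proj e n = diag_op e l n" "\<And>i. i < n \<Longrightarrow> l i \<in> {0..norm X}"
    "norm (F (id_blinfun, diag_op e l n) y - F (id_blinfun, X) y) < \<delta>"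
    by (rule F_one_finite_compression[OF psdX form_bounds_psd[OF psdX] _ \<open>0 < \<delta>\<close>, of "{y}" y]) auto
  define q where "q = span_proj e n"
  have q: "projection_op q" unfolding q_def by (rule span_proj_projection[OF e(1)])
  have qy: "q y = y" using e(2) by (simp add: q_def)
  have l0: "0 \<le> l i" if "i < n" for i using e(4)[OF that] by simp
  \<comment> \<open>by homogeneity, \<open>E\<close> may be scaled down to a contraction\<close>
  define c where "c = 1 / (norm E + 1)"
  have c: "0 < c" by (simp add: c_def add_nonneg_pos)
  have cE: "self_adjoint (c *\<^sub>R E)" "norm (c *\<^sub>R E) \<le> 1" using E(1) by (auto simp: c_def divide_le_eq add_nonneg_pos)
  obtain f m where f: "orthonormal f m"
    "\<And>z. z \<in> e ` {..<n} \<union> (\<lambda>i. E (e i)) ` {..<n} \<Longrightarrow> span_proj f m z = z"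
    using finite_set_in_span[of "e ` {..<n} \<union> (\<lambda>i. E (e i)) ` {..<n}"] by auto
  define L where "L = span_proj f m"
  have L: "projection_op L" unfolding L_def by (rule span_proj_projection[OF f(1)])
  note LB = self_adjoint_in_bounded_ops[OF projection_op_self_adjoint[OF L]]
  note EB = self_adjoint_in_bounded_ops[OF E(1)]
  have Lq: "L (q z) = q z" for z
    unfolding q_def diag_op_apply using f(2)
    by (simp add: blinfun.sum_right bounded_opsD[OF LB]) (simp add: L_def)
  have LEq: "L (E (q z)) = E (q z)" for z
    unfolding q_def diag_op_apply using f(2)
    by (simp add: blinfun.sum_right bounded_opsD[OF LB] bounded_opsD[OF EB]) (simp add: L_def)
  obtain R where R: "projection_op R" "L o\<^sub>L (id_blinfun - 2 *\<^sub>R R) o\<^sub>L L = L o\<^sub>L (c *\<^sub>R E) o\<^sub>L L"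
    using contraction_dilation[OF inf cE f(1)] unfolding L_def by blast
  define U where "U = id_blinfun - 2 *\<^sub>R R"
  have saU: "self_adjoint U" unfolding U_def by (rule reflection_unitary(3)[OF R(1)])
  note saL = projection_op_self_adjoint[OF L] and saq = projection_op_self_adjoint[OF q]
  have LUq: "L (U (q z)) = c *\<^sub>R E (q z)" for z
  proof -
    have "L (U (L (q z))) =
        L ((c *\<^sub>R E) (L (q z)))"
      using R(2) by (metis U_def blinfun_apply_blinfun_compose)
    then show ?thesis by (simp add: Lq LEq blinfun_linear)
  qed
  have qUL: "q (U (L z)) = c *\<^sub>R q (E z)" for z
  proof (rule vector_eq_ldot[THEN iffD1], rule allI)
    fix x
    have "inner x (q (U (L z))) = inner (c *\<^sub>R E (q x)) z"
      by (simp flip: self_adjointD[OF saq] self_adjointD[OF saU] self_adjointD[OF saL] LUq)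
    then show "inner x (q (U (L z))) = inner x (c *\<^sub>R q (E z))"
      by (simp add: self_adjointD[OF saq] self_adjointD[OF E(1)])
  qed
  have sandwich: "q o\<^sub>L (U o\<^sub>L (L o\<^sub>L T o\<^sub>L L) o\<^sub>L U) o\<^sub>L q = c\<^sup>2 *\<^sub>R (q o\<^sub>L (E o\<^sub>L T o\<^sub>L E) o\<^sub>L q)" for T
    by (rule blinfun_eqI) (simp add: LUq qUL blinfun_linear power2_eq_square)
  have qq: "q o\<^sub>L id_blinfun o\<^sub>L q = q" using q by (simp add: projection_op_def)
  have LAB: "psd_op (L o\<^sub>L A o\<^sub>L L)" "psd_op (L o\<^sub>L B o\<^sub>L L)" using AB saL by simp_all
  have ULAB: "psd_op (U o\<^sub>L (L o\<^sub>L A o\<^sub>L L) o\<^sub>L U)" "psd_op (U o\<^sub>L (L o\<^sub>L B o\<^sub>L L) o\<^sub>L U)" using LAB saU by simp_all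
  have psdq: "psd_op q" "psd_op (diag_op e l n)" using projection_op_psd[OF q] l0 by (auto intro: diag_op_psd)
  \<comment> \<open>conjugation by \<open>U\<close> of the pair compressed by \<open>L\<close>, followed by compression by \<open>q\<close>\<close>
  have "c\<^sup>2 * form q (diag_op e l n) y = form (c\<^sup>2 *\<^sub>R q) (c\<^sup>2 *\<^sub>R diag_op e l n) y"
    using c psdq by (simp add: F_homogeneous blinfun.scaleR_left)
  also have "\<dots> = form (q o\<^sub>L (U o\<^sub>L (L o\<^sub>L A o\<^sub>L L) o\<^sub>L U) o\<^sub>L q) (q o\<^sub>L (U o\<^sub>L (L o\<^sub>L B o\<^sub>L L) o\<^sub>L U) o\<^sub>L q) (q y)"
    unfolding sandwich E(2) qq qy X[symmetric] e(3)[folded q_def] ..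
  also have "\<dots> \<le> form (U o\<^sub>L (L o\<^sub>L A o\<^sub>L L) o\<^sub>L U) (U o\<^sub>L (L o\<^sub>L B o\<^sub>L L) o\<^sub>L U) (q y)"
    by (rule F_compression[OF q ULAB])
  also have "\<dots> = form (L o\<^sub>L A o\<^sub>L L) (L o\<^sub>L B o\<^sub>L L) (U y)"
    unfolding F_reflection[OF R(1) LAB, folded U_def] qy by (simp flip: self_adjointD[OF saU])
  also have "\<dots> = form (L o\<^sub>L A o\<^sub>L L) (L o\<^sub>L B o\<^sub>L L) (L (U y))"
    by (subst F_corner[OF L AB]) (simp flip: self_adjointD[OF saL])
  also have "\<dots> \<le> form A B (L (U y))"
    by (rule F_compression[OF L AB])
  also have "L (U y) = c *\<^sub>R E y" using LUq[of y] by (simp add: qy)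
  also have "form A B (c *\<^sub>R E y) = c\<^sup>2 * form A B (E y)"
    by (simp add: blinfun.scaleR_right power2_eq_square)
  finally have main: "form q (diag_op e l n) y \<le> form A B (E y)"
    using c by simp
  have "form id_blinfun (diag_op e l n) y = form q (diag_op e l n) y"
    using F_diag_op[OF e(1), of "\<lambda>_. 1" l] l0 qy
    by (simp add: F_one_diag_op[OF e(1) l0] blinfun_linear q_def)
  moreover have "form id_blinfun X y - form id_blinfun (diag_op e l n) y \<le> \<epsilon>"
  proof -
    have "form id_blinfun X y - form id_blinfun (diag_op e l n) y =
        inner y (F (id_blinfun, X) y - F (id_blinfun, diag_op e l n) y)"
      by (simp add: inner_diff_right)
    also have "\<dots> \<le> norm y * \<delta>"
      by (rule order_trans[OF norm_cauchy_schwarz mult_left_mono]) (use e(5) in \<open>auto simp: norm_minus_commute\<close>)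
    also have "\<dots> \<le> \<epsilon>" unfolding \<delta>_def by (rule scale_divide_le) (use \<open>0 < \<epsilon>\<close> in auto)
    finally show ?thesis .
  qed
  ultimately show "form id_blinfun X y \<le> form A B (E y) + \<epsilon>" using main by linarith
qed

text \<open>Two self-adjoint operators with the same quadratic form are equal.\<close>

lemma F_eq_perspective:
  assumes inf: "infinite_dimensional TYPE('h)" and A: "psd_op A" "invertible_op A" and B: "psd_op B"
  shows "F (A, B) = perspective (scalar_value 1) A B"
proof -
  note nontriv = infinite_dimensional_nontrivial[OF inf]
  define C where "C = sqrt_op A"
  have C: "psd_op C" "C o\<^sub>L C = A" unfolding C_def by (rule sqrt_op[OF A(1)])+
  note saC = psd_op_self_adjoint[OF C(1)]
  have "invertible_op C"
    by (rule invertible_op_square_root) (use C A(2) self_adjoint_in_bounded_ops[OF saC] in auto)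
  define E where "E = inverse_op C"
  have EC: "is_inverse_op C E" unfolding E_def by (rule is_inverse_inverse_op[OF \<open>invertible_op C\<close>])
  have saE: "self_adjoint E" by (rule inverse_self_adjoint[OF saC EC])
  have app: "C (E x) = x" "E (C x) = x" for x
    using is_inverse_op_apply[OF EC] by simp_all
  define X where "X = E o\<^sub>L B o\<^sub>L E"
  have X: "psd_op X" unfolding X_def using saE B by simp
  have CXC: "C o\<^sub>L X o\<^sub>L C = B" by (rule blinfun_eqI) (simp add: X_def app)
  have EAE: "E o\<^sub>L A o\<^sub>L E = id_blinfun" by (rule blinfun_eqI) (simp add: C(2)[symmetric] app)
  have "F (A, B) = C o\<^sub>L F (id_blinfun, X) o\<^sub>L C"
  proof (rule self_adjoint_eqI_quadratic)
    show "self_adjoint (F (A, B))" by (rule F_self_adjoint[OF A(1) B])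
    show "self_adjoint (C o\<^sub>L F (id_blinfun, X) o\<^sub>L C)" using saC F_self_adjoint[of id_blinfun X] X by simp
    fix x
    have "form A B x \<le> form id_blinfun X (C x)"
      using F_congruence_upper[OF saC X, of x] by (simp add: C(2) CXC)
    moreover have "form id_blinfun X (C x) \<le> form A B x"
      using F_congruence_lower[OF inf A(1) B saE EAE X_def, of "C x"] by (simp add: app)
    ultimately show "form A B x = inner x ((C o\<^sub>L F (id_blinfun, X) o\<^sub>L C) x)"
      by (simp add: self_adjointD[OF saC, symmetric])
  qed
  then show ?thesis
    by (simp add: perspective_def Let_def fun_op_scalar_value[OF nontriv X] flip: C_def E_def X_def)
qed

section \<open>Operator convexity\<close>

text \<open>By strong continuity, \<open>F (1, _)\<close> is continuous along segments, so midpoint convexity extends to all convex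
  combinations.\<close>

lemma F_one_convex:
  assumes X: "psd_op X" and Y: "psd_op Y" and l: "l \<in> {0..1}"
  shows "form id_blinfun (l *\<^sub>R X + (1 - l) *\<^sub>R Y) x \<le> l * form id_blinfun X x + (1 - l) * form id_blinfun Y x"
proof -
  define G where "G s = s *\<^sub>R X + (1 - s) *\<^sub>R Y" for s :: real
  have psd: "psd_op (G s)" if "s \<in> {0..1}" for s using that X Y by (simp add: G_def)
  have "form id_blinfun (G l) x \<le> l * form id_blinfun (G 1) x + (1 - l) * form id_blinfun (G 0) x"
  proof (rule midpoint_convex_imp_convex[OF _ _ l])
    show "continuous_on {0..1} (\<lambda>s. form id_blinfun (G s) x)"
      by (intro continuous_intros F_continuous_along psd) (auto simp: G_def intro!: continuous_intros)
    fix s t :: real assume st: "s \<in> {0..1}" "t \<in> {0..1}"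
    have "G ((s + t) / 2) = (1/2) *\<^sub>R (G s + G t)"
    proof -
      have "(1/2) *\<^sub>R (G s + G t) = (s / 2 + t / 2) *\<^sub>R X + ((1 - s) / 2 + (1 - t) / 2) *\<^sub>R Y"
        by (simp add: G_def scaleR_add_left scaleR_add_right)
      also have "\<dots> = G ((s + t) / 2)"
      proof -
        have "s / 2 + t / 2 = (s + t) / 2" "(1 - s) / 2 + (1 - t) / 2 = 1 - (s + t) / 2"
          by (simp_all add: field_simps)
        then show ?thesis by (simp only: G_def)
      qed
      finally show ?thesis ..
    qed
    moreover have "(1/2) *\<^sub>R (id_blinfun + id_blinfun) = (id_blinfun :: 'h \<Rightarrow>\<^sub>L 'h)" by (simp flip: scaleR_2)
    ultimately show "form id_blinfun (G ((s + t) / 2)) x \<le> (form id_blinfun (G s) x + form id_blinfun (G t) x) / 2"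
      using op_leD[OF F_midpoint[of id_blinfun "G s" id_blinfun "G t"], of x] psd st
      by (simp add: blinfun_linear inner_add_right del: scaleR_add_right)
  qed
  then show ?thesis by (simp add: G_def)
qed

text \<open>The right-hand side does not mention a diagonalization; that all diagonalizations of \<open>X\<close> lead to it is
  what makes the definite description in \<open>fun_mat\<close> meaningful.\<close>

lemma fun_mat_scalar_value:
  assumes X: "psd_mat n X" and g: "orthonormal g n"
  shows "fun_mat (scalar_value 1) X =
    Matrix.mat n n (\<lambda>(i, j). cinner (g i) (F (id_blinfun, mat_op g n X) (g j)))"
    (is "_ = ?M")
proof -
  have Xc: "X \<in> carrier_mat n n" "dim_row X = n" using X by (auto simp: psd_mat_def)
  have unique: "U * mat_diag n (\<lambda>i. complex_of_real (scalar_value 1 (d i))) * mat_adjoint U = ?M"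
    if U: "unitary_mat n U" and XU: "X = U * mat_diag n (\<lambda>i. complex_of_real (d i)) * mat_adjoint U" for U d
  proof -
    define e where "e = (\<lambda>k. \<Sum>i<n. U $$ (i, k) *\<^sub>C g i)"
    note frame = unitary_frame[OF U g, folded e_def]
    have Xe: "mat_op g n X = diag_op e d n" unfolding XU by (rule frame(2))
    have d0: "0 \<le> d k" if k: "k < n" for k
      using psd_opD[OF mat_op_psd[OF X, of g], of "e k"] orthonormal_norm[OF frame(1) k]
      by (simp add: Xe diag_op_basis[OF frame(1) k] power2_norm_eq_inner[symmetric])
    have Pg: "span_proj e n (g j) = g j" if "j < n" for j
      using diag_op_basis[OF g that, of "\<lambda>_. 1"] by (simp add: frame(3))
    show ?thesis
    proof (rule eq_matI)
      fix i j assume "i < dim_row ?M" "j < dim_col ?M"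
      then have ij: "i < n" "j < n" by simp_all
      have "?M $$ (i, j) = cinner (g i) (diag_op e (\<lambda>i. scalar_value 1 (d i)) n (g j))"
        using ij by (simp add: Xe F_one_diag_op[OF frame(1) d0] blinfun_linear Pg)
      also have "\<dots> = (U * mat_diag n (\<lambda>i. complex_of_real (scalar_value 1 (d i))) * mat_adjoint U) $$ (i, j)"
        unfolding frame(2)[symmetric] by (rule mat_op_entry[OF g ij])
      finally show "(U * mat_diag n (\<lambda>i. complex_of_real (scalar_value 1 (d i))) * mat_adjoint U) $$ (i, j) = ?M $$ (i, j)" ..
    qed (use U mat_adjoint_carrier[of U n] in \<open>auto simp: unitary_mat_def\<close>)
  qed
  obtain U d where "unitary_mat n U" "X = U * mat_diag n (\<lambda>i. complex_of_real (d i)) * mat_adjoint U"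
    using psd_mat_diagonalize[OF X g] by blast
  then show ?thesis
    unfolding fun_mat_def Xc(2) using unique by (intro the_equality) metis+
qed

text \<open>For an orthonormal family \<open>g\<close> of length \<open>n\<close>, the entries of the matrix in question are \<open>\<langle>g i, W (g j)\<rangle>\<close>, where
  \<open>W\<close> is the convexity defect of \<open>F (1, _)\<close> at the embedded matrices.\<close>

lemma scalar_value_operator_convex:
  assumes inf: "infinite_dimensional TYPE('h)"
  shows "operator_convex (scalar_value 1)"
  unfolding operator_convex_def
proof (intro allI ballI impI)
  fix n X Y and l :: real
  assume l: "l \<in> {0..1}" and XY: "pd_mat n X \<and> pd_mat n Y"
  then have X: "psd_mat n X" and Y: "psd_mat n Y" using pd_mat_imp_psd_mat by blast+
  have c: "X \<in> carrier_mat n n" "Y \<in> carrier_mat n n" using X Y by (auto simp: psd_mat_def)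
  define Z where "Z = complex_of_real l \<cdot>\<^sub>m X + complex_of_real (1 - l) \<cdot>\<^sub>m Y"
  have Zc: "Z \<in> carrier_mat n n" using c by (simp add: Z_def)
  obtain g :: "nat \<Rightarrow> 'h" where g: "orthonormal g n"
    using infinite_dimensional_extend[OF inf, of "\<lambda>_. 0" 0 n] by (auto simp: orthonormal_def)
  have Z: "psd_mat n Z"
    unfolding psd_mat_iff
  proof (intro conjI allI impI Zc)
    have hX: "X $$ (i, j) = cnj (X $$ (j, i))" and hY: "Y $$ (i, j) = cnj (Y $$ (j, i))" if "i < n" "j < n" for i j
      using X Y that unfolding psd_mat_iff by blast+
    show "Z $$ (i, j) = cnj (Z $$ (j, i))" if "i < n" "j < n" for i j
      using hX[OF that] hY[OF that] c that by (simp add: Z_def)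
    fix v :: "nat \<Rightarrow> complex"
    have "(\<Sum>i<n. \<Sum>j<n. cnj (v i) * Z $$ (i, j) * v j) =
        of_real l * (\<Sum>i<n. \<Sum>j<n. cnj (v i) * X $$ (i, j) * v j) +
        of_real (1 - l) * (\<Sum>i<n. \<Sum>j<n. cnj (v i) * Y $$ (i, j) * v j)"
      unfolding sum_distrib_left sum.distrib[symmetric]
      by (intro sum.cong refl) (use c in \<open>simp add: Z_def algebra_simps\<close>)
    moreover have "0 \<le> Re (\<Sum>i<n. \<Sum>j<n. cnj (v i) * X $$ (i, j) * v j)"
      "0 \<le> Re (\<Sum>i<n. \<Sum>j<n. cnj (v i) * Y $$ (i, j) * v j)"
      using X Y unfolding psd_mat_iff by blast+
    ultimately show "0 \<le> Re (\<Sum>i<n. \<Sum>j<n. cnj (v i) * Z $$ (i, j) * v j)"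
      using l by (simp only: plus_complex.sel Re_complex_of_real times_complex.sel Im_complex_of_real) simp
  qed
  define W where "W = l *\<^sub>R F (id_blinfun, mat_op g n X) + (1 - l) *\<^sub>R F (id_blinfun, mat_op g n Y)
    - F (id_blinfun, mat_op g n Z)"
  have Zop: "mat_op g n Z = l *\<^sub>R mat_op g n X + (1 - l) *\<^sub>R mat_op g n Y"
    unfolding Z_def by (rule mat_op_combination[OF c])
  note psd = mat_op_psd[OF X, of g] mat_op_psd[OF Y, of g] mat_op_psd[OF Z, of g]
  have W: "psd_op W"
    unfolding psd_op_iff
  proof (intro conjI allI)
    show "self_adjoint W" unfolding W_def using psd by (auto intro!: self_adjoint_simps F_self_adjoint)
    show "0 \<le> inner x (W x)" for x
      using F_one_convex[OF psd(1,2) l, of x]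
      by (simp add: W_def Zop blinfun_linear inner_diff_right inner_add_right)
  qed
  define M where "M = (complex_of_real l \<cdot>\<^sub>m fun_mat (scalar_value 1) X + complex_of_real (1 - l) \<cdot>\<^sub>m fun_mat (scalar_value 1) Y)
        - fun_mat (scalar_value 1) Z"
  have M: "M $$ (i, j) = cinner (g i) (W (g j))" if "i < n" "j < n" for i j
    using that by (simp add: M_def fun_mat_scalar_value[OF X g] fun_mat_scalar_value[OF Y g] fun_mat_scalar_value[OF Z g]
        W_def blinfun_linear cinner_diff_right cinner_add_right cinner_scaleR_right)
  have "psd_mat n M"
    unfolding psd_mat_iff
  proof (intro conjI allI impI)
    show "M \<in> carrier_mat n n"
      unfolding M_def fun_mat_scalar_value[OF X g] fun_mat_scalar_value[OF Y g] fun_mat_scalar_value[OF Z g]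
      by (intro minus_carrier_mat) auto
    show "M $$ (i, j) = cnj (M $$ (j, i))" if "i < n" "j < n" for i j
      unfolding M[OF that] M[OF that(2,1)] by (metis W cinner_commute psd_op_self_adjoint self_adjointD_cinner)
    fix v :: "nat \<Rightarrow> complex"
    define x where "x = (\<Sum>i<n. v i *\<^sub>C g i)"
    have "(\<Sum>i<n. \<Sum>j<n. cnj (v i) * M $$ (i, j) * v j) = (\<Sum>i<n. \<Sum>j<n. cnj (v i) * cinner (g i) (W (g j)) * v j)"
      by (intro sum.cong refl) (simp add: M)
    also have "\<dots> = cinner x (W x)"
      by (subst sum.swap) (simp add: x_def cinner_sum_left cinner_sum_right cinner_scaleC_left cinner_scaleC_right blinfun.sum_right
          bounded_opsD[OF self_adjoint_in_bounded_ops[OF psd_op_self_adjoint[OF W]]] sum_distrib_left mult_ac)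
    finally show "0 \<le> Re (\<Sum>i<n. \<Sum>j<n. cnj (v i) * M $$ (i, j) * v j)"
      using psd_opD[OF W, of x] by (simp add: inner_eq_Re_cinner)
  qed
  then show "psd_mat n ((complex_of_real l \<cdot>\<^sub>m fun_mat (scalar_value 1) X + complex_of_real (1 - l) \<cdot>\<^sub>m fun_mat (scalar_value 1) Y)
        - fun_mat (scalar_value 1) (complex_of_real l \<cdot>\<^sub>m X + complex_of_real (1 - l) \<cdot>\<^sub>m Y))"
    by (simp only: M_def Z_def)
qed

end


theorem theorem2p2:
  fixes D :: "(('h::chilbert_space \<Rightarrow>\<^sub>L 'h) \<times> ('h \<Rightarrow>\<^sub>L 'h)) set"
    and F :: "('h \<Rightarrow>\<^sub>L 'h) \<times> ('h \<Rightarrow>\<^sub>L 'h) \<Rightarrow> 'h \<Rightarrow>\<^sub>L 'h"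
  assumes inf_dim: "infinite_dimensional TYPE('h)"
    and D: "D = {(A, B). psd_op A \<and> psd_op B}"
    and regular: "regular_map D F"
    and self_adjoint: "\<forall>(A, B)\<in>D. self_adjoint (F (A, B))"
    and homogeneous:
      "\<forall>t>0. \<forall>(A, B)\<in>D. F (t *\<^sub>R A, t *\<^sub>R B) = t *\<^sub>R F (A, B)"
    and midpoint_convex:
      "\<forall>(A\<^sub>1, B\<^sub>1)\<in>D. \<forall>(A\<^sub>2, B\<^sub>2)\<in>D.
         F ((1/2) *\<^sub>R (A\<^sub>1 + A\<^sub>2), (1/2) *\<^sub>R (B\<^sub>1 + B\<^sub>2))
           \<preceq> (1/2) *\<^sub>R (F (A\<^sub>1, B\<^sub>1) + F (A\<^sub>2, B\<^sub>2))"
    and zero: "F (0, 0) = 0"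
    and strongly_continuous:
      "\<forall>S. S \<subseteq> {B. psd_op B} \<and> bounded S \<longrightarrow>
         continuous_map (subtopology strong_operator_topology S) strong_operator_topology
           (\<lambda>B. F (id_blinfun, B))"
  shows "\<exists>f :: real \<Rightarrow> real. operator_convex f \<and>
           (\<forall>t>0. F (id_blinfun, t *\<^sub>R id_blinfun) = f t *\<^sub>R id_blinfun) \<and>
           (\<forall>A B. psd_op A \<and> invertible_op A \<and> psd_op B \<and> invertible_op B \<longrightarrow>
              F (A, B) = perspective f A B)"
proof -
  have in_D: "(A, B) \<in> D \<longleftrightarrow> psd_op A \<and> psd_op B" for A B by (simp add: D)
  interpret convex_regular_map F
  proof
    fix A B :: "'h \<Rightarrow>\<^sub>L 'h" assume AB: "psd_op A" "psd_op B"
    then have ABD: "(A, B) \<in> D" by (simp add: in_D)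
    show "Defs.self_adjoint (F (A, B))" using self_adjoint ABD by blast
    show "F (t *\<^sub>R A, t *\<^sub>R B) = t *\<^sub>R F (A, B)" if "0 < t" for t using homogeneous ABD that by blast
    show "F (adj_op u o\<^sub>L A o\<^sub>L u, adj_op u o\<^sub>L B o\<^sub>L u) = adj_op u o\<^sub>L F (A, B) o\<^sub>L u" if "unitary_op u" for u
      using regular ABD that unfolding regular_map_def by blast
    show "F ((p o\<^sub>L A o\<^sub>L p) + (q o\<^sub>L A o\<^sub>L q), (p o\<^sub>L B o\<^sub>L p) + (q o\<^sub>L B o\<^sub>L q)) =
        (p o\<^sub>L F (p o\<^sub>L A o\<^sub>L p, p o\<^sub>L B o\<^sub>L p) o\<^sub>L p) +
        (q o\<^sub>L F (q o\<^sub>L A o\<^sub>L q, q o\<^sub>L B o\<^sub>L q) o\<^sub>L q)"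
      if pq: "projection_op p" "projection_op q" "p o\<^sub>L q = 0" for p q
    proof -
      have "(p o\<^sub>L A o\<^sub>L p, p o\<^sub>L B o\<^sub>L p) \<in> D" "(q o\<^sub>L A o\<^sub>L q, q o\<^sub>L B o\<^sub>L q) \<in> D"
        using AB pq by (simp_all add: in_D projection_op_self_adjoint)
      moreover have "A \<in> \<B>" "B \<in> \<B>" using AB by (auto intro: self_adjoint_in_bounded_ops psd_op_self_adjoint)
      ultimately show ?thesis using regular pq unfolding regular_map_def by blast
    qed
    show "F ((1/2) *\<^sub>R (A + A\<^sub>2), (1/2) *\<^sub>R (B + B\<^sub>2)) \<preceq> (1/2) *\<^sub>R (F (A, B) + F (A\<^sub>2, B\<^sub>2))"
      if "psd_op A\<^sub>2" "psd_op B\<^sub>2" for A\<^sub>2 B\<^sub>2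
      using midpoint_convex ABD that in_D by blast
  qed (use zero strongly_continuous in auto)
  show ?thesis
  proof (intro exI conjI allI impI)
    show "operator_convex (scalar_value 1)" by (rule scalar_value_operator_convex[OF inf_dim])
    show "F (id_blinfun, t *\<^sub>R id_blinfun) = scalar_value 1 t *\<^sub>R id_blinfun" if "0 < t" for t
      using F_scalar[of 1 t] that by simp
    show "F (A, B) = perspective (scalar_value 1) A B"
      if "psd_op A \<and> invertible_op A \<and> psd_op B \<and> invertible_op B" for A B
      using F_eq_perspective[OF inf_dim] that by blast
  qed
qed

end
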